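(* Let $u,v$ be spectral parameters, set $z=u/v$, and let $a,b\in K^\times$ satisfy $ab=-(q+q^{-1})$ if $\bar1=1$ and $ab=(-1)^{\bar2}$ if $\bar1=0$. Let $$\begin{aligned}R(z)=\ &(z-q^{-m+n+2})\Big\{\mathrm I+(q^{1/2}-q^{-1/2})\sum_{i=1}^N(-1)^{\bar i}E_{ii}\otimes\Big(q^{(\varepsilon_i,\varepsilon_i)/2}E_{ii}-q^{-(\varepsilon_i,\varepsilon_i)/2}E_{i'i'}\Big)\\&\qquad+(q-q^{-1})\sum_{i>j}(-1)^{\bar j}E_{ij}\otimes\Big(E_{ji}-(-1)^{\bar j(\bar i+\bar j)}\vartheta_i\vartheta_jq^{(\rho,\varepsilon_i-\varepsilon_j)}E_{i'j'}\Big)\Big\}\\&+(q-q^{-1})\frac{z-q^{-m+n+2}}{z-1}\,\tau-(q-q^{-1})q^{-m+n+2}\sum_{i,j=1}^N(-1)^{\bar i\,\bar j}\vartheta_i\vartheta_jq^{(\rho,\varepsilon_i-\varepsilon_j)}E_{ij}\otimes E_{i'j'}.\end{aligned}$$ Then $\hat R(z)=\tau\circ R(z)$ satisfies, for the evaluation modules $\varrho^{a,b}_u,\varrho^{a,b}_v$ of $U_q(\widehat{\mathfrak{osp}}(V))$, $$\hat R(u/v)\circ(\varrho^{a,b}_u\otimes\varrho^{a,b}_v)(x)=(\varrho^{a,b}_v\otimes\varrho^{a,b}_u)(x)\circ\hat R(u/v)\qquad\text{for all }x\in U_q(\widehat{\mathfrak{osp}}(V)).$$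
   Context: **Setup.** Fix integers $m,n\ge0$ with $n$ even, $N=m+n>2$, $s=\lfloor N/2\rfloor$, $i'=N+1-i$, $K=\mathbb C(q^{1/2})$. $V$ is a superspace over $K$ with homogeneous basis $v_1,\dots,v_N$, $m$ of them even and $n$ odd; $\bar i\in\{0,1\}$ is the parity of $v_i$, and $\bar i=\overline{i'}$. Fix $\vartheta_i\in\{\pm1\}$ with $\vartheta_i=1$ if $\bar i=0$, $\vartheta_i=-\vartheta_{i'}$ if $\bar i=1$. $E_{ij}$ are matrix units, of parity $\bar i+\bar j$. Tensor products are graded: $(x\otimes y)(x'\otimes y')=(-1)^{|y||x'|}xx'\otimes yy'$, $(X\otimes Y)(v\otimes w)=(-1)^{|Y||v|}Xv\otimes Yw$. $\tau(v_i\otimes v_j)=(-1)^{\bar i\,\bar j}v_j\otimes v_i$, i.e. $\tau=\sum_{i,j}(-1)^{\bar j}E_{ij}\otimes E_{ji}$. $X_{ij}=E_{ij}-(-1)^{\bar i(\bar i+\bar j)}\vartheta_i\vartheta_jE_{j'i'}$. For diagonal $D=\mathrm{diag}(d_k)$, $q^D=\mathrm{diag}(q^{d_k})$. **Roots.** $\varepsilon_1,\dots,\varepsilon_s$ are linearly independent with $(\varepsilon_i,\varepsilon_j)=\delta_{ij}(-1)^{\bar i}$; $\varepsilon_{i'}=-\varepsilon_i$, $\varepsilon_{s+1}=0$ if $N$ odd. $\Phi^+=\{\varepsilon_a-\varepsilon_b:a<b<a'\}\cup\{2\varepsilon_a:\bar a=1,a\le s\}$; $\varepsilon_a-\varepsilon_b$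 has parity $\bar a+\bar b$, $2\varepsilon_a$ is even. $\rho$ is half the sum of even positive roots minus half the sum of odd positive roots. **Simple roots and matrices.** For $1\le i\le s$ if $m$ is odd, and $1\le i<s$ if $m$ is even: $\alpha_i=\varepsilon_i-\varepsilon_{i+1}$, $\mathsf e_i=X_{i,i+1}$, $\mathsf f_i=(-1)^{\bar i}X_{i+1,i}$, $\mathsf h_i=(-1)^{\bar i}X_{ii}-(-1)^{\overline{i+1}}X_{i+1,i+1}$. If $m$ even, $\bar s=0$: $\alpha_s=\varepsilon_{s-1}+\varepsilon_s$, $\mathsf e_s=X_{s-1,s+1}$, $\mathsf f_s=(-1)^{\overline{s-1}}X_{s+1,s-1}$, $\mathsf h_s=(-1)^{\overline{s-1}}X_{s-1,s-1}-(-1)^{\overline{s+1}}X_{s+1,s+1}$. If $m$ even, $\bar s=1$: $\alpha_s=2\varepsilon_s$, $\mathsf e_s=E_{s,s+1}$, $\mathsf f_s=-2E_{s+1,s}$, $\mathsf h_s=-2X_{ss}$. The highest root is $\theta=\varepsilon_1+\varepsilon_2$ if $\bar1=0$ and $\theta=2\varepsilon_1$ if $\bar1=1$; write $\theta=\sum_{i=1}^s\mathsf k_i\alpha_i$. $\alpha_0=\delta-\theta$ with $(\delta,\delta)=(\delta,\varepsilon_i)=0$, of the parity of $\theta$; $a_{ij}=(\alpha_i,\alpha_j)$ for $0\le i,j\le s$. **Algebra.** $U_q(\widehat{\mathfrak{osp}}(V))$ is the $K$-superalgebra generated by $e_i,f_i,q^{\pm h_i/2}$ ($0\le i\le s$),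 $\gamma^{\pm1},D^{\pm1}$, with $|e_i|=|f_i|$ the parity of $\alpha_i$ and the other generators even, subject to: $D^{\pm1}D^{\mp1}=1$, $[D,q^{h_i/2}]=0$, $De_iD^{-1}=q^{\delta_{0i}}e_i$, $Df_iD^{-1}=q^{-\delta_{0i}}f_i$; $\gamma^{\pm1}\gamma^{\mp1}=1$, $\gamma=q^{h_0/2}\prod_{i=1}^s(q^{h_i/2})^{\mathsf k_i}$, $\gamma$ central; $[q^{h_i/2},q^{h_j/2}]=0$, $q^{\pm h_i/2}q^{\mp h_i/2}=1$, $q^{h_i/2}e_jq^{-h_i/2}=q^{a_{ij}/2}e_j$, $q^{h_i/2}f_jq^{-h_i/2}=q^{-a_{ij}/2}f_j$, $e_if_j-(-1)^{|e_i||f_j|}f_je_i=\delta_{ij}\frac{q^{h_i}-q^{-h_i}}{q-q^{-1}}$ ($0\le i,j\le s$); and Yamane's $q$-Serre relations. The latter can be described as follows: for words $\mathbf i,\mathbf j$ of length $d$ in $\{0,\dots,s\}$ put $B(\mathbf i,\mathbf j)=\sum_{\sigma\in S_d}\prod_{k<l,\,\sigma(k)>\sigma(l)}\big((-1)^{|e_{j_k}||e_{j_l}|}q^{-(\alpha_{j_k},\alpha_{j_l})}\big)\prod_p\delta_{i_p,j_{\sigma^{-1}(p)}}$; one imposes $\sum_{\mathbf j}c_{\mathbf j}e_{j_1}\cdots e_{j_d}=0=\sum_{\mathbf j}c_{\mathbf j}f_{j_1}\cdots f_{j_d}$ whenever $\sum_{\mathbf j}c_{\mathbf j}B(\mathbf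 i,\mathbf j)=0$ for all $\mathbf i$. Coproduct: $\Delta(e_i)=q^{h_i/2}\otimes e_i+e_i\otimes q^{-h_i/2}$, $\Delta(f_i)=q^{h_i/2}\otimes f_i+f_i\otimes q^{-h_i/2}$, and $q^{\pm h_i/2},\gamma^{\pm1},D^{\pm1}$ are group-like. **Evaluation modules.** For an indeterminate $u$, $V(u)=V\otimes K[u,u^{-1}]$ with action $\varrho_u^{a,b}$: for $1\le i\le s$, $e_i\mapsto\mathsf e_i$, $f_i\mapsto\kappa_i\mathsf f_i$, $q^{\pm h_i/2}\mapsto q^{\pm\mathsf h_i/2}$, where $\kappa_i=\frac{q+q^{-1}}2$ if $m$ even, $\bar s=1$, $i=s$, and $\kappa_i=1$ otherwise; $\gamma^{\pm1}\mapsto\mathrm I$; $D^{\pm1}(v\otimes u^k)=q^{\pm k}v\otimes u^k$; if $\bar1=1$: $e_0\mapsto au\,E_{1'1}$, $f_0\mapsto bu^{-1}E_{11'}$, $q^{\pm h_0/2}\mapsto q^{\pm X_{11}}$; if $\bar1=0$: $e_0\mapsto au\,X_{2'1}$, $f_0\mapsto bu^{-1}X_{12'}$, $q^{\pm h_0/2}\mapsto q^{\mp((-1)^{\bar1}X_{11}+(-1)^{\bar2}X_{22})/2}$. **Meaning of the identity.** $(\varrho_u\otimes\varrho_v)(x)$ denotes the action of $\Delta(x)$ on $V(u)\otimes V(v)$. The identity is understood after extending scalars so that $\hat R(z)$, with matrix entries rational in $z=u/v$, is defined; it is equivalent to the identity of $N^2\times N^2$ matrices over $K(u,v)$ for all $x$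 in the subalgebra generated by all generators other than $D^{\pm1}$. *)

theory Defs
  imports
    "HOL-Library.Poly_Mapping"
    "HOL-Combinatorics.Permutations"
    "HOL-Computational_Algebra.Computational_Algebra"
    "HOL-Algebra.QuotRing"
begin

text \<open>
  \<open>K\<close> is the field of rational functions in the indeterminate \<open>q\<^sup>1\<^sup>/\<^sup>2\<close>.
  \<open>L\<close> is \<open>K(u,v)\<close>: the inner polynomial variable is \<open>u\<close>, the outer one is \<open>v\<close>.
\<close>

type_synonym K = "complex poly fract"
type_synonym L = "K poly poly fract"

definition qhalf :: K where "qhalf = to_fract [:0, 1:]"

definition qq :: K where "qq = qhalf\<^sup>2"

text \<open>\<open>q\<^sup>r\<close>; only used when \<open>2 r\<close> is an integer.\<close>

definition qpow :: "rat \<Rightarrow> K" where "qpow r = qhalf powi \<lfloor>2 * r\<rfloor>"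

definition emb :: "K \<Rightarrow> L" where "emb c = to_fract [:[:c:]:]"

datatype spectral = Param_u | Param_v

fun indet :: "spectral \<Rightarrow> L" where
  "indet Param_u = to_fract [:[:0, 1:]:]"
| "indet Param_v = to_fract [:0, 1:]"

fun scale_poly :: "spectral \<Rightarrow> K \<Rightarrow> K poly poly \<Rightarrow> K poly poly" where
  "scale_poly Param_u c f = map_poly (\<lambda>r. pcompose r [:0, c:]) f"
| "scale_poly Param_v c f = pcompose f [:0, [:c:]:]"

text \<open>
  For \<open>c \<noteq> 0\<close>, \<open>scale w c\<close> is the automorphism of \<open>K(u,v)\<close> over \<open>K\<close> that multiplies the
  indeterminate \<open>w\<close> by \<open>c\<close> and fixes the other one.
\<close>

definition scale :: "spectral \<Rightarrow> K \<Rightarrow> L \<Rightarrow> L" where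
  "scale w c x = (THE y. \<exists>f g. g \<noteq> 0 \<and> x = Fract f g \<and> y = Fract (scale_poly w c f) (scale_poly w c g))"

lemma scale_poly_mult: "scale_poly w c (f * g) = scale_poly w c f * scale_poly w c g"
proof (cases w)
  case Param_u
  show ?thesis
    unfolding Param_u scale_poly.simps
  proof (rule poly_eqI)
    fix k
    show "coeff (map_poly (\<lambda>r. r \<circ>\<^sub>p [:0, c:]) (f * g)) k =
      coeff (map_poly (\<lambda>r. r \<circ>\<^sub>p [:0, c:]) f * map_poly (\<lambda>r. r \<circ>\<^sub>p [:0, c:]) g) k"
     by (simp only: coeff_map_poly coeff_mult pcompose_mult pcompose_sum pcompose_0)
  qed
next
  case Param_v
  then show ?thesis by (simp only: scale_poly.simps pcompose_mult)
qed

lemma scale_poly_nonzero: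
  assumes "c \<noteq> 0" and "f \<noteq> 0"
  shows "scale_poly w c f \<noteq> 0"
proof (cases w)
  case Param_u
  have nz: "r = 0" if "pcompose r [:0, c:] = 0" for r :: "K poly"
    using that by (rule pcompose_eq_0) (use assms(1) in simp)
  obtain k where "coeff f k \<noteq> 0"
    using assms(2) by (meson leading_coeff_0_iff)
  then have "coeff (scale_poly w c f) k \<noteq> 0"
    using nz by (auto simp only: Param_u scale_poly.simps coeff_map_poly pcompose_0)
  then show ?thesis by (metis coeff_0)
next
  case Param_v
  have "degree [:0, [:c:]:] > 0" using assms(1) by simp
  then show ?thesis using assms(2) unfolding Param_v scale_poly.simps by (metis pcompose_eq_0)
qed

lemma scale_Fract:
  assumes "c \<noteq> 0" and "g \<noteq> 0"
  shows "scale w c (Fract f g) = Fract (scale_poly w c f) (scale_poly w c g)"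
  unfolding scale_def
proof (rule the_equality)
  show "\<exists>f' g'. g' \<noteq> 0 \<and> Fract f g = Fract f' g' \<and>
      Fract (scale_poly w c f) (scale_poly w c g) = Fract (scale_poly w c f') (scale_poly w c g')"
    using assms(2) by blast
next
  fix y
  assume "\<exists>f' g'. g' \<noteq> 0 \<and> Fract f g = Fract f' g' \<and> y = Fract (scale_poly w c f') (scale_poly w c g')"
  then obtain f' g' where *: "g' \<noteq> 0" "Fract f g = Fract f' g'"
    "y = Fract (scale_poly w c f') (scale_poly w c g')" by blast
  then have "f * g' = f' * g" using assms(2) by (simp only: eq_fract simp_thms)
  then have "scale_poly w c f * scale_poly w c g' = scale_poly w c f' * scale_poly w c g"
    by (metis scale_poly_mult)
  then show "y = Fract (scale_poly w c f) (scale_poly w c g)"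
    using * assms by (metis eq_fract(1) scale_poly_nonzero)
qed

text \<open>The free monoid, so that \<open>'g word \<Rightarrow>\<^sub>0 K\<close> is the free associative \<open>K\<close>-algebra.\<close>

datatype 'g word = Word (letters: "'g list")

instantiation word :: (type) monoid_add
begin

definition "0 = Word []"

definition "v + w = Word (letters v @ letters w)"

instance
  by standard (auto simp: zero_word_def plus_word_def)

end

text \<open>\<open>gE i\<close>, \<open>gF i\<close>, \<open>gQ i\<close>, \<open>gQi i\<close> stand for \<open>e\<^sub>i\<close>, \<open>f\<^sub>i\<close>, \<open>q\<^bsup>h\<^sub>i/2\<^esup>\<close>, \<open>q\<^bsup>-h\<^sub>i/2\<^esup>\<close>.\<close>

datatype gen = gE nat | gF nat | gQ nat | gQi nat | gGam | gGami | gD | gDi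

type_synonym free = "gen word \<Rightarrow>\<^sub>0 K"
type_synonym free2 = "(gen word \<times> gen word) \<Rightarrow>\<^sub>0 K"

definition gn :: "gen \<Rightarrow> free" where "gn g = Poly_Mapping.single (Word [g]) 1"

definition cst :: "K \<Rightarrow> free" where "cst c = Poly_Mapping.single 0 c"

type_synonym 'a mtx = "nat \<Rightarrow> nat \<Rightarrow> 'a"
type_synonym 'a mtx2 = "nat \<times> nat \<Rightarrow> nat \<times> nat \<Rightarrow> 'a"

definition munit :: "nat \<Rightarrow> nat \<Rightarrow> 'a::comm_ring_1 mtx" where
  "munit i j = (\<lambda>k l. if k = i \<and> l = j then 1 else 0)"

definition qdiag :: "rat mtx \<Rightarrow> K mtx" where
  "qdiag D = (\<lambda>k l. if k = l then qpow (D k k) else 0)"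

text \<open>
  \<open>p i\<close> is the parity of the basis vector \<open>v\<^sub>i\<close>, \<open>1 \<le> i \<le> m + n\<close>, and \<open>vt i\<close> is the sign
  \<open>\<vartheta>\<^sub>i\<close>.
\<close>

locale osp_data =
  fixes m n :: nat and p :: "nat \<Rightarrow> nat" and vt :: "nat \<Rightarrow> int"
  assumes even_n: "even n"
    and dim: "m + n > 2"
    and parity: "\<And>i. i \<in> {1..m+n} \<Longrightarrow> p i \<in> {0, 1}"
    and card_even: "card {i \<in> {1..m+n}. p i = 0} = m"
    and card_odd: "card {i \<in> {1..m+n}. p i = 1} = n"
    and parity_dual: "\<And>i. i \<in> {1..m+n} \<Longrightarrow> p i = p (m + n + 1 - i)"
    and sign: "\<And>i. i \<in> {1..m+n} \<Longrightarrow> vt i \<in> {1, -1}"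
    and sign_even: "\<And>i. i \<in> {1..m+n} \<Longrightarrow> p i = 0 \<Longrightarrow> vt i = 1"
    and sign_odd: "\<And>i. i \<in> {1..m+n} \<Longrightarrow> p i = 1 \<Longrightarrow> vt i = - vt (m + n + 1 - i)"
begin

definition N :: nat where "N = m + n"

definition s :: nat where "s = N div 2"

definition dual :: "nat \<Rightarrow> nat" where "dual i = N + 1 - i"

text \<open>
  A weight is given by its coordinates: coordinate \<open>0\<close> belongs to \<open>\<delta>\<close> and coordinate
  \<open>k \<in> {1..s}\<close> to \<open>\<epsilon>\<^sub>k\<close>.
\<close>

definition eps :: "nat \<Rightarrow> nat \<Rightarrow> rat" where
  "eps i = (\<lambda>k. if k \<in> {1..s} then (if k = i then 1 else if k = dual i then -1 else 0) else 0)"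

definition form :: "(nat \<Rightarrow> rat) \<Rightarrow> (nat \<Rightarrow> rat) \<Rightarrow> rat" where
  "form x y = (\<Sum>k=1..s. (-1) ^ p k * x k * y k)"

definition even_pos_roots :: "(nat \<Rightarrow> rat) set" where
  "even_pos_roots =
     {(\<lambda>k. eps i k - eps j k) | i j. 1 \<le> i \<and> i < j \<and> j < dual i \<and> even (p i + p j)}
     \<union> {(\<lambda>k. 2 * eps i k) | i. 1 \<le> i \<and> i \<le> s \<and> p i = 1}"

definition odd_pos_roots :: "(nat \<Rightarrow> rat) set" where
  "odd_pos_roots =
     {(\<lambda>k. eps i k - eps j k) | i j. 1 \<le> i \<and> i < j \<and> j < dual i \<and> odd (p i + p j)}"

definition rho :: "nat \<Rightarrow> rat" where
  "rho = (\<lambda>k. (\<Sum>\<beta>\<in>even_pos_roots. \<beta> k) / 2 - (\<Sum>\<beta>\<in>odd_pos_roots. \<beta> k) / 2)"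

definition highest :: "nat \<Rightarrow> rat" where
  "highest = (if p 1 = 0 then (\<lambda>k. eps 1 k + eps 2 k) else (\<lambda>k. 2 * eps 1 k))"

definition alpha :: "nat \<Rightarrow> nat \<Rightarrow> rat" where
  "alpha i =
    (if i = 0 then (\<lambda>k. (if k = 0 then 1 else 0) - highest k)
     else if odd m \<or> i < s then (\<lambda>k. eps i k - eps (i + 1) k)
     else if p s = 0 then (\<lambda>k. eps (s - 1) k + eps s k)
     else (\<lambda>k. 2 * eps s k))"

text \<open>The parity of \<open>\<alpha>\<^sub>i\<close>, as an exponent of \<open>-1\<close> (so only relevant modulo 2).\<close>

definition palpha :: "nat \<Rightarrow> nat" where
  "palpha i =
    (if i = 0 then (if p 1 = 0 then p 1 + p 2 else 0)
     else if odd m \<or> i < s then p i + p (i + 1)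
     else if p s = 0 then p (s - 1) + p s
     else 0)"

definition cartan :: "nat \<Rightarrow> nat \<Rightarrow> rat" where
  "cartan i j = form (alpha i) (alpha j)"

definition marks :: "nat \<Rightarrow> nat" where
  "marks = (THE c. (\<forall>i. i \<notin> {1..s} \<longrightarrow> c i = 0) \<and>
                   (\<forall>k. highest k = (\<Sum>i=1..s. of_nat (c i) * alpha i k)))"

definition Xm :: "nat \<Rightarrow> nat \<Rightarrow> 'a::comm_ring_1 mtx" where
  "Xm i j = (\<lambda>k l. munit i j k l
      - (-1) ^ (p i * (p i + p j)) * of_int (vt i * vt j) * munit (dual j) (dual i) k l)"

definition e_mat :: "nat \<Rightarrow> K mtx" where
  "e_mat i =
    (if odd m \<or> i < s then Xm i (i + 1)
     else if p s = 0 then Xm (s - 1) (s + 1)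
     else munit s (s + 1))"

definition f_mat :: "nat \<Rightarrow> K mtx" where
  "f_mat i =
    (if odd m \<or> i < s then (\<lambda>k l. (-1) ^ p i * Xm (i + 1) i k l)
     else if p s = 0 then (\<lambda>k l. (-1) ^ p (s - 1) * Xm (s + 1) (s - 1) k l)
     else (\<lambda>k l. - 2 * munit (s + 1) s k l))"

definition h_mat :: "nat \<Rightarrow> rat mtx" where
  "h_mat i =
    (if odd m \<or> i < s
       then (\<lambda>k l. (-1) ^ p i * Xm i i k l - (-1) ^ p (i + 1) * Xm (i + 1) (i + 1) k l)
     else if p s = 0
       then (\<lambda>k l. (-1) ^ p (s - 1) * Xm (s - 1) (s - 1) k l
                 - (-1) ^ p (s + 1) * Xm (s + 1) (s + 1) k l)
     else (\<lambda>k l. - 2 * Xm s s k l))"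

fun gpar :: "gen \<Rightarrow> nat" where
  "gpar (gE i) = palpha i"
| "gpar (gF i) = palpha i"
| "gpar _ = 0"

definition wpar :: "gen word \<Rightarrow> nat" where
  "wpar w = sum_list (map gpar (letters w))"

definition gens :: "gen set" where
  "gens = gE ` {0..s} \<union> gF ` {0..s} \<union> gQ ` {0..s} \<union> gQi ` {0..s} \<union> {gGam, gGami, gD, gDi}"

definition free_alg :: "free ring" where
  "free_alg =
    \<lparr>carrier = {x. \<forall>w \<in> Poly_Mapping.keys x. set (letters w) \<subseteq> gens},
     mult = (*), one = 1, zero = 0, add = (+)\<rparr>"

lemma carrier_free_alg:
  "x \<in> carrier free_alg \<longleftrightarrow> (\<forall>w \<in> Poly_Mapping.keys x. set (letters w) \<subseteq> gens)"
  by (simp add: free_alg_def)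

lemma free_alg_closed:
  "0 \<in> carrier free_alg" "1 \<in> carrier free_alg" "cst c \<in> carrier free_alg"
  "x \<in> carrier free_alg \<Longrightarrow> y \<in> carrier free_alg \<Longrightarrow> x + y \<in> carrier free_alg"
  "x \<in> carrier free_alg \<Longrightarrow> - x \<in> carrier free_alg"
  "x \<in> carrier free_alg \<Longrightarrow> y \<in> carrier free_alg \<Longrightarrow> x * y \<in> carrier free_alg"
proof -
  show "0 \<in> carrier free_alg" "1 \<in> carrier free_alg" "cst c \<in> carrier free_alg"
    by (auto simp: carrier_free_alg cst_def zero_word_def)
  show "x + y \<in> carrier free_alg" if "x \<in> carrier free_alg" "y \<in> carrier free_alg"
    using that keys_add[of x y] unfolding carrier_free_alg by blast
  show "- x \<in> carrier free_alg" if "x \<in> carrier free_alg"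
    using that by (simp add: carrier_free_alg)
  show "x * y \<in> carrier free_alg" if "x \<in> carrier free_alg" "y \<in> carrier free_alg"
    unfolding carrier_free_alg
  proof
    fix w assume "w \<in> Poly_Mapping.keys (x * y)"
    then obtain w1 w2 where w: "w1 \<in> Poly_Mapping.keys x" "w2 \<in> Poly_Mapping.keys y" "w = w1 + w2"
      using keys_mult[of x y] by blast
    then have "set (letters w1) \<subseteq> gens" "set (letters w2) \<subseteq> gens"
      using that by (simp_all add: carrier_free_alg)
    then show "set (letters w) \<subseteq> gens" using w(3) by (simp add: plus_word_def)
  qed
qed

lemma free_alg_closed':
  "x \<in> carrier free_alg \<Longrightarrow> y \<in> carrier free_alg \<Longrightarrow> x - y \<in> carrier free_alg"
  "x \<in> carrier free_alg \<Longrightarrow> x ^ k \<in> carrier free_alg"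
  "(\<And>y. y \<in> set ys \<Longrightarrow> y \<in> carrier free_alg) \<Longrightarrow> prod_list ys \<in> carrier free_alg"
  "(\<And>i. i \<in> A \<Longrightarrow> g i \<in> carrier free_alg) \<Longrightarrow> sum g A \<in> carrier free_alg"
  "h \<in> gens \<Longrightarrow> gn h \<in> carrier free_alg"
proof -
  show "x - y \<in> carrier free_alg" if "x \<in> carrier free_alg" "y \<in> carrier free_alg"
    using free_alg_closed(4)[OF that(1) free_alg_closed(5)[OF that(2)]] by simp
  show "x ^ k \<in> carrier free_alg" if "x \<in> carrier free_alg"
    by (induction k) (use that free_alg_closed in auto)
  show "prod_list ys \<in> carrier free_alg" if "\<And>y. y \<in> set ys \<Longrightarrow> y \<in> carrier free_alg"
    using that by (induction ys) (use free_alg_closed in auto)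
  show "sum g A \<in> carrier free_alg" if "\<And>i. i \<in> A \<Longrightarrow> g i \<in> carrier free_alg"
    using that by (induction A rule: infinite_finite_induct) (use free_alg_closed in auto)
  show "gn h \<in> carrier free_alg" if "h \<in> gens"
    using that by (simp add: carrier_free_alg gn_def)
qed

lemma ring_free_alg: "ring free_alg"
proof -
  have simps: "x \<oplus>\<^bsub>free_alg\<^esub> y = x + y" "x \<otimes>\<^bsub>free_alg\<^esub> y = x * y"
    "\<zero>\<^bsub>free_alg\<^esub> = 0" "\<one>\<^bsub>free_alg\<^esub> = 1" for x y
    by (simp_all add: free_alg_def)
  have "abelian_group free_alg"
    by (rule abelian_groupI; unfold simps)
       (simp_all only: free_alg_closed add_0_left add.assoc, simp_all only: add.commute,
        metis free_alg_closed(5) add.right_inverse)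
  moreover have "monoid free_alg"
    by (rule monoidI; unfold simps)
       (simp_all only: free_alg_closed mult.assoc mult_1_left mult_1_right)
  ultimately show ?thesis
    by (rule ringI; unfold simps) (simp_all only: distrib_left distrib_right)
qed

definition index_words :: "nat \<Rightarrow> nat list set" where
  "index_words d = {is. length is = d \<and> set is \<subseteq> {0..s}}"

text \<open>Positions in words are counted from \<open>0\<close>.\<close>

definition serre_form :: "nat list \<Rightarrow> nat list \<Rightarrow> K" where
  "serre_form is js =
    (let d = length js in
     \<Sum>\<sigma> \<in> {\<sigma>. \<sigma> permutes {..<d}}.
       (\<Prod>(k, l) \<in> {(k, l). k < l \<and> l < d \<and> \<sigma> k > \<sigma> l}.
          (-1) ^ (palpha (js ! k) * palpha (js ! l)) * qpow (- cartan (js ! k) (js ! l)))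
       * (\<Prod>r<d. if is ! r = js ! (inv_into UNIV \<sigma> r) then 1 else 0))"

definition in_radical :: "nat \<Rightarrow> (nat list \<Rightarrow> K) \<Rightarrow> bool" where
  "in_radical d c \<longleftrightarrow>
    (\<forall>is \<in> index_words d. (\<Sum>js \<in> index_words d. c js * serre_form is js) = 0)"

text \<open>Each relation \<open>x = y\<close> is entered as the element \<open>x - y\<close> of the free algebra.\<close>

inductive_set relations :: "free set" where
  D_inv: "gn gD * gn gDi - 1 \<in> relations"
| D_inv': "gn gDi * gn gD - 1 \<in> relations"
| D_q: "i \<le> s \<Longrightarrow> gn gD * gn (gQ i) - gn (gQ i) * gn gD \<in> relations"
| D_e: "i \<le> s \<Longrightarrow>
    gn gD * gn (gE i) * gn gDi - cst (if i = 0 then qq else 1) * gn (gE i) \<in> relations"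
| D_f: "i \<le> s \<Longrightarrow>
    gn gD * gn (gF i) * gn gDi - cst (if i = 0 then inverse qq else 1) * gn (gF i) \<in> relations"
| gam_inv: "gn gGam * gn gGami - 1 \<in> relations"
| gam_inv': "gn gGami * gn gGam - 1 \<in> relations"
| gam: "gn gGam - gn (gQ 0) * prod_list (map (\<lambda>i. gn (gQ i) ^ marks i) [1..<s+1]) \<in> relations"
| gam_central: "g \<in> gens \<Longrightarrow> gn gGam * gn g - gn g * gn gGam \<in> relations"
| q_comm: "i \<le> s \<Longrightarrow> j \<le> s \<Longrightarrow> gn (gQ i) * gn (gQ j) - gn (gQ j) * gn (gQ i) \<in> relations"
| q_inv: "i \<le> s \<Longrightarrow> gn (gQ i) * gn (gQi i) - 1 \<in> relations"
| q_inv': "i \<le> s \<Longrightarrow> gn (gQi i) * gn (gQ i) - 1 \<in> relations"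
| q_e: "i \<le> s \<Longrightarrow> j \<le> s \<Longrightarrow>
    gn (gQ i) * gn (gE j) * gn (gQi i) - cst (qpow (cartan i j / 2)) * gn (gE j) \<in> relations"
| q_f: "i \<le> s \<Longrightarrow> j \<le> s \<Longrightarrow>
    gn (gQ i) * gn (gF j) * gn (gQi i) - cst (qpow (- cartan i j / 2)) * gn (gF j) \<in> relations"
| e_f: "i \<le> s \<Longrightarrow> j \<le> s \<Longrightarrow>
    gn (gE i) * gn (gF j) - cst ((-1) ^ (palpha i * palpha j)) * (gn (gF j) * gn (gE i))
    - (if i = j then cst (1 / (qq - inverse qq)) * (gn (gQ i) ^ 2 - gn (gQi i) ^ 2) else 0)
    \<in> relations"
| serre_e: "in_radical d c \<Longrightarrow>
    (\<Sum>js \<in> index_words d. cst (c js) * prod_list (map (\<lambda>j. gn (gE j)) js)) \<in> relations"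
| serre_f: "in_radical d c \<Longrightarrow>
    (\<Sum>js \<in> index_words d. cst (c js) * prod_list (map (\<lambda>j. gn (gF j)) js)) \<in> relations"

lemma relations_carrier: "relations \<subseteq> carrier free_alg"
proof
  have g: "gE i \<in> gens" "gF i \<in> gens" "gQ i \<in> gens" "gQi i \<in> gens" if "i \<le> s" for i
    using that by (auto simp: gens_def)
  have g': "gGam \<in> gens" "gGami \<in> gens" "gD \<in> gens" "gDi \<in> gens"
    by (auto simp: gens_def)
  have le: "j \<le> s" if "is \<in> index_words d" "j \<in> set is" for j d "is"
    using that by (auto simp: index_words_def)
  fix x assume "x \<in> relations"
  then show "x \<in> carrier free_alg"
  proof cases
    case gam
    show ?thesis unfolding gam
      by (intro free_alg_closed' free_alg_closed g g') (auto intro!: free_alg_closed' g)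
  next
    case (serre_e d c)
    show ?thesis unfolding serre_e
      by (intro free_alg_closed' free_alg_closed) (auto intro!: free_alg_closed' g dest: le)
  next
    case (serre_f d c)
    show ?thesis unfolding serre_f
      by (intro free_alg_closed' free_alg_closed) (auto intro!: free_alg_closed' g dest: le)
  next
    case (e_f i j)
    show ?thesis unfolding e_f(1)
      by (intro free_alg_closed'(1) free_alg_closed(3,6) free_alg_closed'(5) g e_f(2,3))
         (auto intro!: free_alg_closed free_alg_closed' g e_f(2,3))
  qed (simp_all only:, (intro free_alg_closed' free_alg_closed g g'; assumption?)+)
qed

definition Uq :: "free set ring" where
  "Uq = free_alg Quot (genideal free_alg relations)"

lemma ring_Uq: "ring Uq"
  unfolding Uq_def
  by (intro ideal.quotient_is_ring ring.genideal_ideal ring_free_alg relations_carrier)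

text \<open>Graded tensor square: \<open>(x \<otimes> y) (x' \<otimes> y') = (-1)\<^bsup>|y| |x'|\<^esup> x x' \<otimes> y y'\<close>.\<close>

definition gmult :: "free2 \<Rightarrow> free2 \<Rightarrow> free2" where
  "gmult S T = (\<Sum>(x, y) \<in> Poly_Mapping.keys S. \<Sum>(x', y') \<in> Poly_Mapping.keys T.
     Poly_Mapping.single (x + x', y + y')
       ((-1) ^ (wpar y * wpar x') * Poly_Mapping.lookup S (x, y) * Poly_Mapping.lookup T (x', y')))"

definition pure :: "gen \<Rightarrow> gen \<Rightarrow> free2" where
  "pure g h = Poly_Mapping.single (Word [g], Word [h]) 1"

fun Delta_gen :: "gen \<Rightarrow> free2" where
  "Delta_gen (gE i) = pure (gQ i) (gE i) + pure (gE i) (gQi i)"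
| "Delta_gen (gF i) = pure (gQ i) (gF i) + pure (gF i) (gQi i)"
| "Delta_gen g = pure g g"

definition Delta_word :: "gen word \<Rightarrow> free2" where
  "Delta_word w =
    foldr (\<lambda>g. gmult (Delta_gen g)) (letters w) (Poly_Mapping.single (0, 0) 1)"

text \<open>
  The coproduct, lifted to the free superalgebra, as the homomorphism of superalgebras with
  the prescribed values on generators.
\<close>

definition Delta :: "free \<Rightarrow> free2" where
  "Delta x = (\<Sum>w \<in> Poly_Mapping.keys x.
     Poly_Mapping.map (\<lambda>r. Poly_Mapping.lookup x w * r) (Delta_word w))"

text \<open>
  With scalars extended from Laurent polynomials to \<open>L\<close>, \<open>V(w)\<close> is the space of coordinate
  vectors \<open>nat \<Rightarrow> L\<close> and a tensor product \<open>V(w) \<otimes> V(w')\<close> is the space of coordinate vectors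
  \<open>nat \<times> nat \<Rightarrow> L\<close>, with support in the index range. The generator \<open>D\<close> acts semilinearly: the
  rule \<open>D (v\<^sub>i \<otimes> w\<^sup>k) = q\<^sup>k v\<^sub>i \<otimes> w\<^sup>k\<close> is the substitution of \<open>q w\<close> for \<open>w\<close> in coordinates.
\<close>

definition VV :: "(nat \<times> nat \<Rightarrow> L) set" where
  "VV = {\<phi>. \<forall>x. x \<notin> {1..N} \<times> {1..N} \<longrightarrow> \<phi> x = 0}"

definition mat_op :: "L mtx \<Rightarrow> (nat \<Rightarrow> L) \<Rightarrow> nat \<Rightarrow> L" where
  "mat_op A \<phi> = (\<lambda>k. if k \<in> {1..N} then \<Sum>l=1..N. A k l * \<phi> l else 0)"

definition mat_op2 :: "L mtx2 \<Rightarrow> (nat \<times> nat \<Rightarrow> L) \<Rightarrow> nat \<times> nat \<Rightarrow> L" where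
  "mat_op2 A \<phi> = (\<lambda>x. if x \<in> {1..N} \<times> {1..N} then \<Sum>y \<in> {1..N} \<times> {1..N}. A x y * \<phi> y else 0)"

definition kappa :: "nat \<Rightarrow> K" where
  "kappa i = (if even m \<and> p s = 1 \<and> i = s then (qq + inverse qq) / 2 else 1)"

definition e0_mat :: "K mtx" where
  "e0_mat = (if p 1 = 1 then munit (dual 1) 1 else Xm (dual 2) 1)"

definition f0_mat :: "K mtx" where
  "f0_mat = (if p 1 = 1 then munit 1 (dual 1) else Xm 1 (dual 2))"

text \<open>The diagonal matrix \<open>H\<close> such that \<open>q\<^bsup>h\<^sub>i/2\<^esup>\<close> acts as \<open>q\<^bsup>H\<^esup>\<close>.\<close>

definition half_h :: "nat \<Rightarrow> rat mtx" where
  "half_h i = (\<lambda>k l.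
    if i \<noteq> 0 then h_mat i k l / 2
    else if p 1 = 1 then Xm 1 1 k l
    else - ((-1) ^ p 1 * Xm 1 1 k l + (-1) ^ p 2 * Xm 2 2 k l) / 2)"

fun ev_gen :: "K \<Rightarrow> K \<Rightarrow> spectral \<Rightarrow> gen \<Rightarrow> (nat \<Rightarrow> L) \<Rightarrow> nat \<Rightarrow> L" where
  "ev_gen a b w (gE i) =
     mat_op (\<lambda>k l. if i = 0 then emb a * indet w * emb (e0_mat k l) else emb (e_mat i k l))"
| "ev_gen a b w (gF i) =
     mat_op (\<lambda>k l. if i = 0 then emb b * inverse (indet w) * emb (f0_mat k l)
                   else emb (kappa i * f_mat i k l))"
| "ev_gen a b w (gQ i) = mat_op (\<lambda>k l. emb (qdiag (half_h i) k l))"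
| "ev_gen a b w (gQi i) = mat_op (\<lambda>k l. emb (qdiag (\<lambda>k l. - half_h i k l) k l))"
| "ev_gen a b w gGam = id"
| "ev_gen a b w gGami = id"
| "ev_gen a b w gD = (\<lambda>\<phi> k. scale w qq (\<phi> k))"
| "ev_gen a b w gDi = (\<lambda>\<phi> k. scale w (inverse qq) (\<phi> k))"

definition ev_word :: "K \<Rightarrow> K \<Rightarrow> spectral \<Rightarrow> gen word \<Rightarrow> (nat \<Rightarrow> L) \<Rightarrow> nat \<Rightarrow> L" where
  "ev_word a b w x = foldr (\<lambda>g A. ev_gen a b w g \<circ> A) (letters x) id"

text \<open>
  \<open>X \<otimes> Y = (X \<otimes> 1) (1 \<otimes> Y)\<close> for a homogeneous operator \<open>Y\<close> of parity \<open>d\<close>; on \<open>v\<^sub>i \<otimes> V\<close> the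
  second factor is \<open>(-1)\<^bsup>d p i\<^esup> Y\<close>.
\<close>

definition tensor_op :: "nat \<Rightarrow> ((nat \<Rightarrow> L) \<Rightarrow> nat \<Rightarrow> L) \<Rightarrow> ((nat \<Rightarrow> L) \<Rightarrow> nat \<Rightarrow> L)
    \<Rightarrow> (nat \<times> nat \<Rightarrow> L) \<Rightarrow> nat \<times> nat \<Rightarrow> L" where
  "tensor_op d X Y \<phi> =
    (\<lambda>(k, l). X (\<lambda>i. (-1) ^ (d * p i) * Y (\<lambda>j. \<phi> (i, j)) l) k)"

definition ev2 :: "K \<Rightarrow> K \<Rightarrow> spectral \<Rightarrow> spectral \<Rightarrow> free2
    \<Rightarrow> (nat \<times> nat \<Rightarrow> L) \<Rightarrow> nat \<times> nat \<Rightarrow> L" where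
  "ev2 a b w w' T \<phi> = (\<lambda>k. \<Sum>(x, y) \<in> Poly_Mapping.keys T.
     emb (Poly_Mapping.lookup T (x, y))
     * tensor_op (wpar y) (ev_word a b w x) (ev_word a b w' y) \<phi> k)"

text \<open>
  The action \<open>(\<rho>\<^sub>w \<otimes> \<rho>\<^sub>w') \<circ> \<Delta>\<close> on \<open>V(w) \<otimes> V(w')\<close> is written down on the free superalgebra; an
  element of \<^term>\<open>Uq\<close>, which is a coset of the ideal of relations, acts through its representatives.
\<close>

definition act :: "K \<Rightarrow> K \<Rightarrow> spectral \<Rightarrow> spectral \<Rightarrow> free
    \<Rightarrow> (nat \<times> nat \<Rightarrow> L) \<Rightarrow> nat \<times> nat \<Rightarrow> L" where
  "act a b w w' x = ev2 a b w w' (Delta x)"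

text \<open>
  The matrix of \<open>X \<otimes> Y\<close> in the basis \<open>v\<^sub>i \<otimes> v\<^sub>j\<close>; the component of \<open>Y\<close> at \<open>(k', l')\<close> has parity
  \<open>p k' + p l'\<close>.
\<close>

definition gtensor :: "L mtx \<Rightarrow> L mtx \<Rightarrow> L mtx2" where
  "gtensor X Y = (\<lambda>(k, k') (l, l'). (-1) ^ ((p k' + p l') * p l) * X k l * Y k' l')"

definition tau :: "L mtx2" where
  "tau = (\<lambda>x (i, j). if x = (j, i) then (-1) ^ (p i * p j) else 0)"

definition sgn_q :: "nat \<Rightarrow> nat \<Rightarrow> L" where
  "sgn_q i j = of_int (vt i * vt j) * emb (qpow (form rho (\<lambda>k. eps i k - eps j k)))"

definition crit :: L where
  "crit = emb (qpow (- of_nat m + of_nat n + 2))"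

definition R :: "L \<Rightarrow> L mtx2" where
  "R z = (\<lambda>x y.
    (z - crit) *
      ((if x = y then 1 else 0)
       + emb (qhalf - inverse qhalf) *
           (\<Sum>i=1..N. (-1) ^ p i * gtensor (munit i i)
              (\<lambda>k l. emb (qpow (form (eps i) (eps i) / 2)) * munit i i k l
                    - emb (qpow (- form (eps i) (eps i) / 2)) * munit (dual i) (dual i) k l) x y)
       + emb (qq - inverse qq) *
           (\<Sum>(i, j) \<in> {(i, j). i \<in> {1..N} \<and> j \<in> {1..N} \<and> i > j}.
              (-1) ^ p j * gtensor (munit i j)
              (\<lambda>k l. munit j i k l
                    - (-1) ^ (p j * (p i + p j)) * sgn_q i j * munit (dual i) (dual j) k l) x y))
    + emb (qq - inverse qq) * ((z - crit) / (z - 1)) * tau x y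
    - emb (qq - inverse qq) * crit *
        (\<Sum>i=1..N. \<Sum>j=1..N. (-1) ^ (p i * p j) * sgn_q i j
           * gtensor (munit i j) (munit (dual i) (dual j)) x y))"

definition Rhat :: "L \<Rightarrow> (nat \<times> nat \<Rightarrow> L) \<Rightarrow> nat \<times> nat \<Rightarrow> L" where
  "Rhat z = mat_op2 tau \<circ> mat_op2 (R z)"

end

end

theory Submission
  imports Defs
begin

text \<open>
  Both sides are multiplicative in \<open>x\<close>, so the identity only has to be checked on the generators
  of the free algebra. It holds for \<open>q\<^bsup>\<plusminus>h\<^sub>i/2\<^esup>\<close> by weight considerations and for \<open>D\<^sup>\<plusminus>\<^sup>1\<close> because
  \<open>R(z)\<close> depends only on \<open>u/v\<close>. Put \<open>c = q\<^bsup>-m+n+2\<^esup>\<close> and \<open>h = q - q\<^sup>-\<^sup>1\<close>. Then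
  \<open>\<tau>R(z) = (z - c) S + h (z - c)/(z - 1) I - h c K\<close> with \<open>S\<close> and \<open>K\<close> independent of \<open>z\<close>. For
  \<open>e\<^sub>i\<close> with \<open>\<alpha>\<^sub>i = \<epsilon>\<^sub>i - \<epsilon>\<^sub>i\<^sub>+\<^sub>1\<close> or \<open>\<alpha>\<^sub>i = 2\<epsilon>\<^sub>i\<close> the operators \<open>S\<close> and \<open>K\<close> commute with the
  coproduct separately, which is seen column by column. The remaining generators follow by symmetry:
  exchanging \<open>v\<^sub>s\<close> and \<open>v\<^sub>s\<^sub>'\<close> turns \<open>\<epsilon>\<^sub>s\<^sub>-\<^sub>1 - \<epsilon>\<^sub>s\<close> into \<open>\<epsilon>\<^sub>s\<^sub>-\<^sub>1 + \<epsilon>\<^sub>s\<close>; exchanging \<open>v\<^sub>1\<close> and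
  \<open>v\<^sub>1\<^sub>'\<close> and rescaling them by the spectral parameter turns \<open>e\<^sub>1\<close> into \<open>e\<^sub>0\<close> when \<open>\<theta> = \<epsilon>\<^sub>1 + \<epsilon>\<^sub>2\<close>;
  and transposition turns \<open>e\<^sub>i\<close> into \<open>f\<^sub>i\<close>. Only \<open>e\<^sub>0\<close> with \<open>\<theta> = 2\<epsilon>\<^sub>1\<close> needs the relation between
  the three summands, again column by column.
\<close>

section \<open>Intertwining equations for a single root\<close>

text \<open>Even and odd basis vectors may come in any order symmetric under i -> i', so the proof
  cannot run through a list of diagrams. It uses the Weyl vector only through two facts: 2 (rho,
  alpha_i) = (alpha_i, alpha_i) for the finite simple roots, and c q^(2 (rho, eps_1)) = 1 or q^2
  according as v_1 is even or odd. The second fact is the origin of the constant c: it is the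
  condition under which the affine root vector is compatible with the K-type entries. Both facts
  enter the matrix calculations as hypotheses on an abstract \<open>Q\<close>, over an arbitrary
  field. The obstacle is the K-type part of S. The order of the indices cuts it off, so it is no
  longer of rank one. For a finite simple root, however, a and b are neighbours: every other index
  compares alike with both, and the cut-off sums belonging to a and b differ in a single row. K
  itself has no cut-off; it is an invariant vector times an invariant covector, and the coproduct of
  a root vector annihilates it from both sides.\<close>

text \<open>
  \<open>t\<close> stands for \<open>q\<^sup>1\<^sup>/\<^sup>2\<close>, \<open>w i\<close> for \<open>\<vartheta>\<^sub>i\<close>, \<open>Q i\<close> for \<open>q\<close> to the power \<open>(\<rho>, \<epsilon>\<^sub>i)\<close> and \<open>od i\<close> for
  \<open>v\<^sub>i\<close> being odd. In terms of these, \<open>tp i\<close> is \<open>q\<close> to the power \<open>(\<epsilon>\<^sub>i, \<epsilon>\<^sub>i)/2\<close>, \<open>root_mat a b\<close> is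
  \<open>X\<^sub>a\<^sub>b\<close> and \<open>root_wt a b k\<close> is the eigenvalue of \<open>q\<^bsup>h/2\<^esup>\<close> on \<open>v\<^sub>k\<close> for the root \<open>\<epsilon>\<^sub>a - \<epsilon>\<^sub>b\<close>. A matrix on
  \<open>V \<otimes> V\<close> is a function of the row \<open>(i, j)\<close> and the column \<open>(k, l)\<close>; \<open>Rh z c\<close> is \<open>\<tau>R(z)\<close>.
\<close>

locale osp_rmatrix =
  fixes N :: nat and od :: "nat \<Rightarrow> bool" and w Q :: "nat \<Rightarrow> 'a::field" and t :: 'a
  assumes t: "t \<noteq> 0"
    and w: "\<And>i. i \<in> {1..N} \<Longrightarrow> w i \<in> {1, -1}"
    and od_dual: "\<And>i. i \<in> {1..N} \<Longrightarrow> od (N + 1 - i) = od i"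
    and w_dual: "\<And>i. i \<in> {1..N} \<Longrightarrow> w (N + 1 - i) = (if od i then - w i else w i)"
    and Q: "\<And>i. i \<in> {1..N} \<Longrightarrow> Q i \<noteq> 0"
    and Q_dual: "\<And>i. i \<in> {1..N} \<Longrightarrow> Q (N + 1 - i) = 1 / Q i"
begin

definition dl :: "nat \<Rightarrow> nat" where "dl i = N + 1 - i"

definition tp :: "nat \<Rightarrow> 'a" where "tp i = (if od i then 1 / t else t)"

definition hh :: 'a where "hh = t\<^sup>2 - 1 / t\<^sup>2"

text \<open>This is q to the power (eps_k, eps_l). The case k = l = k' is listed apart because the
  middle vector has weight 0 although \<open>tp\<close> takes the value t there.\<close>

definition Dg :: "nat \<Rightarrow> nat \<Rightarrow> 'a" where
  "Dg k l = (if l = dl k then (if k = l then 1 else 1 / (tp k)\<^sup>2) else if k = l then (tp k)\<^sup>2 else 1)"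

definition sn :: "bool \<Rightarrow> bool \<Rightarrow> 'a" where "sn x y = (if x \<and> y then -1 else 1)"

definition ut :: "nat \<Rightarrow> nat \<Rightarrow> nat \<Rightarrow> nat \<Rightarrow> 'a" where
  "ut x y i j = (if i = x \<and> j = y then 1 else 0)"

text \<open>The common shape of all operators below: a flip part, a diagonal part, and a part that
  maps the v_k \<otimes> v_k' to combinations of the v_i \<otimes> v_i'. In the last part the row
  factor \<open>w i / Q i\<close> of the invariant vector is split off, so that \<open>Z\<close>
  keeps only the column and the order cut-off.\<close>

definition M4 :: "(nat \<Rightarrow> nat \<Rightarrow> 'a) \<Rightarrow> (nat \<Rightarrow> nat \<Rightarrow> 'a) \<Rightarrow> (nat \<Rightarrow> nat \<Rightarrow> 'a) \<Rightarrow> nat \<Rightarrow> nat \<Rightarrow> nat \<Rightarrow> nat \<Rightarrow> 'a" where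
  "M4 A B Z i j k l = A k l * ut l k i j + B k l * ut k l i j - (if l = dl k \<and> j = dl i then Z k j * w i / Q i else 0)"

text \<open>The invariant covector that belongs to the invariant vector with coefficients
  \<open>w i / Q i\<close>.\<close>

definition gg :: "nat \<Rightarrow> 'a" where "gg k = sn (od k) True * w k / Q k"

definition S :: "nat \<Rightarrow> nat \<Rightarrow> nat \<Rightarrow> nat \<Rightarrow> 'a" where
  "S = M4 (\<lambda>k l. sn (od k) (od l) * Dg k l) (\<lambda>k l. if k < l then hh else 0) (\<lambda>k j. if k < j then hh * gg k else 0)"

definition Kt :: "nat \<Rightarrow> nat \<Rightarrow> nat \<Rightarrow> nat \<Rightarrow> 'a" where
  "Kt = M4 (\<lambda>k l. 0) (\<lambda>k l. 0) (\<lambda>k j. - gg k)"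

text \<open>The matrix form of the commutation with \<open>q^(h/2)\<close> \<otimes> e + e \<otimes>
  \<open>q^(-h/2)\<close>, where e has parity \<open>P\<close> and \<open>x\<close> lists the
  eigenvalues of \<open>q^(h/2)\<close>. \<open>U\<close> and \<open>V\<close> are the spectral
  factors of e on the first and second factor of the source; on the target they are exchanged. The
  sign arises when e passes the first vector.\<close>

definition intertwines ::
  "(nat \<Rightarrow> nat \<Rightarrow> nat \<Rightarrow> nat \<Rightarrow> 'a) \<Rightarrow> bool \<Rightarrow> 'a \<Rightarrow> 'a \<Rightarrow> (nat \<Rightarrow> 'a) \<Rightarrow> (nat \<Rightarrow> nat \<Rightarrow> 'a) \<Rightarrow> bool" where
  "intertwines M P U V x e \<longleftrightarrow> (\<forall>i\<in>{1..N}. \<forall>j\<in>{1..N}. \<forall>k\<in>{1..N}. \<forall>l\<in>{1..N}.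
     V * sn P (od k) * x k * (\<Sum>r=1..N. M i j k r * e r l)
     + U / x l * (\<Sum>r=1..N. M i j r l * e r k)
     = U * sn P (od i) * x i * (\<Sum>r=1..N. e j r * M i r k l)
     + V / x j * (\<Sum>r=1..N. e i r * M r j k l))"

definition root_mat :: "nat \<Rightarrow> nat \<Rightarrow> nat \<Rightarrow> nat \<Rightarrow> 'a" where
  "root_mat a b r l = (if r = a \<and> l = b then 1 else 0)
     - (if r = dl b \<and> l = dl a then sn (od a) (od a \<noteq> od b) * w a * w b else 0)"

definition root_wt :: "nat \<Rightarrow> nat \<Rightarrow> nat \<Rightarrow> 'a" where
  "root_wt a b k = (if k = a then tp a else 1) * (if k = dl a then 1 / tp a else 1)
     * (if k = b then 1 / tp b else 1) * (if k = dl b then tp b else 1)"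

lemma root_mat_sum:
  assumes "a \<in> {1..N}" "b \<in> {1..N}"
  shows "(\<Sum>r=1..N. f r * root_mat a b r l)
      = (if l = b then f a else 0) - (if l = dl a then sn (od a) (od a \<noteq> od b) * w a * w b * f (dl b) else 0)"
    "(\<Sum>r=1..N. root_mat a b j r * f r)
      = (if j = a then f b else 0) - (if j = dl b then sn (od a) (od a \<noteq> od b) * w a * w b * f (dl a) else 0)"
proof -
  have d: "dl a \<in> {1..N}" "dl b \<in> {1..N}" using assms by (auto simp: dl_def)
  have "f r * root_mat a b r l = (if r = a then if l = b then f a else 0 else 0)
      - (if r = dl b then if l = dl a then sn (od a) (od a \<noteq> od b) * w a * w b * f (dl b) else 0 else 0)"
    for r by (simp add: root_mat_def algebra_simps)
  then show "(\<Sum>r=1..N. f r * root_mat a b r l)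
      = (if l = b then f a else 0) - (if l = dl a then sn (od a) (od a \<noteq> od b) * w a * w b * f (dl b) else 0)"
    using assms d by (simp add: sum_subtractf)
  have "root_mat a b j r * f r = (if r = b then if j = a then f b else 0 else 0)
      - (if r = dl a then if j = dl b then sn (od a) (od a \<noteq> od b) * w a * w b * f (dl a) else 0 else 0)"
    for r by (simp add: root_mat_def algebra_simps)
  then show "(\<Sum>r=1..N. root_mat a b j r * f r)
      = (if j = a then f b else 0) - (if j = dl b then sn (od a) (od a \<noteq> od b) * w a * w b * f (dl a) else 0)"
    using assms d by (simp add: sum_subtractf)
qed

lemma dl_dl: "i \<in> {1..N} \<Longrightarrow> dl (dl i) = i"
  by (auto simp: dl_def)

text \<open>The target coproduct applied to the basis vector with indices r, y, read off in a fixed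
  row: \<open>u\<close> tests which basis vector that row is, and \<open>\<eta>\<close> is the
  coefficient of the second matrix unit in \<open>root_mat\<close>.\<close>

definition act4 where
  "act4 P U V x \<eta> a b u r y =
     U * sn P (od r) * x r * ((if y = b then u r a else 0) - (if y = dl a then \<eta> * u r (dl b) else 0))
     + V / x y * ((if r = b then u a y else 0) - (if r = dl a then \<eta> * u (dl b) y else (0::'a)))"

text \<open>
  For a fixed row, both sides of the equation are combinations of four entries of \<open>M4\<close>. What is left
  after evaluating the right-hand side depends only on how the column \<open>(k, l)\<close> meets \<open>a, b, a', b'\<close>.
\<close>

lemma intertwines_M4I:
  assumes a: "a \<in> {1..N}" and b: "b \<in> {1..N}"
    and \<eta>: "\<eta> = sn (od a) (od a \<noteq> od b) * w a * w b"
    and column: "\<And>i j k l u. i \<in> {1..N} \<Longrightarrow> j \<in> {1..N} \<Longrightarrow> k \<in> {1..N} \<Longrightarrow> l \<in> {1..N} \<Longrightarrow>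
      u = (\<lambda>r y. ut r y i j) \<Longrightarrow>
      V * sn P (od k) * x k * ((if l = b then M4 A B Z i j k a else 0) - (if l = dl a then \<eta> * M4 A B Z i j k (dl b) else 0))
      + U / x l * ((if k = b then M4 A B Z i j a l else 0) - (if k = dl a then \<eta> * M4 A B Z i j (dl b) l else 0))
      = A k l * act4 P U V x \<eta> a b u l k + B k l * act4 P U V x \<eta> a b u k l
        - (if l = dl k then
            u (dl b) a * (U * sn P (od b) * x (dl b) * (Z k b * w (dl b) / Q (dl b))
               - \<eta> * (V / x a) * (Z k a * w (dl a) / Q (dl a)))
          + u a (dl b) * (V / x (dl b) * (Z k (dl b) * w b / Q b)
               - \<eta> * (U * sn P (od a) * x a) * (Z k (dl a) * w a / Q a)) else 0)"
  shows "intertwines (M4 A B Z) P U V x (root_mat a b)"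
  unfolding intertwines_def
proof (intro ballI)
  fix i j k l assume ijkl: "i \<in> {1..N}" "j \<in> {1..N}" "k \<in> {1..N}" "l \<in> {1..N}"
  define u where "u = (\<lambda>r y. ut r y i j)"
  \<comment> \<open>The right-hand side as a linear functional of one column, so that the three
    parts of \<open>M4\<close> can be treated separately.\<close>
  define RO where "RO f = U * sn P (od i) * x i * ((if j = a then f i b else 0) - (if j = dl b then \<eta> * f i (dl a) else 0))
      + V / x j * ((if i = a then f b j else 0) - (if i = dl b then \<eta> * f (dl a) j else 0))" for f
  have lin: "RO (\<lambda>i j. \<alpha> * f i j + \<beta> * g i j - h i j) = \<alpha> * RO f + \<beta> * RO g - RO h" for \<alpha> \<beta> f g h
    unfolding RO_def by (cases "j = a"; cases "j = dl b"; cases "i = a"; cases "i = dl b"; simp add: algebra_simps)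
  have z: "RO (\<lambda>i j. if l = dl k \<and> Q' i j then f i j else 0) = (if l = dl k then RO (\<lambda>i j. if Q' i j then f i j else 0) else 0)" for f Q'
    unfolding RO_def by simp
  have od: "od (dl a) = od a" "od (dl b) = od b" using a b od_dual by (auto simp: dl_def)
  have 1: "RO (ut r y) = act4 P U V x \<eta> a b u r y" for r y
  proof -
    have "x i * (if j = a then ut r y i b else 0) = x r * (if y = b then u r a else 0)"
      "x i * (if j = dl b then \<eta> * ut r y i (dl a) else 0) = x r * (if y = dl a then \<eta> * u r (dl b) else 0)"
      "1 / x j * (if i = a then ut r y b j else 0) = 1 / x y * (if r = b then u a y else 0)"
      "1 / x j * (if i = dl b then \<eta> * ut r y (dl a) j else 0) = 1 / x y * (if r = dl a then \<eta> * u (dl b) y else 0)"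
      "sn P (od i) * ut r y i b = sn P (od r) * ut r y i b"
      "sn P (od i) * ut r y i (dl a) = sn P (od r) * ut r y i (dl a)"
      by (auto simp: ut_def u_def)
    note * = this
    have "RO (ut r y) = U * (if j = a then sn P (od i) * ut r y i b * x i else 0) - U * (if j = dl b then sn P (od i) * ut r y i (dl a) * \<eta> * x i else 0)
      + V * (1 / x j * (if i = a then ut r y b j else 0)) - V * (1 / x j * (if i = dl b then \<eta> * ut r y (dl a) j else 0))"
      unfolding RO_def by (simp add: algebra_simps)
    also have "\<dots> = U * sn P (od r) * (x i * (if j = a then ut r y i b else 0)) - U * sn P (od r) * (x i * (if j = dl b then \<eta> * ut r y i (dl a) else 0))
      + V * (1 / x j * (if i = a then ut r y b j else 0)) - V * (1 / x j * (if i = dl b then \<eta> * ut r y (dl a) j else 0))"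
      unfolding *(5,6) by simp
    also have "\<dots> = act4 P U V x \<eta> a b u r y" unfolding *(1-4) act4_def by (simp add: algebra_simps)
    finally show ?thesis .
  qed
  \<comment> \<open>From vectors v_i \<otimes> v_i' the root vector reaches only the rows (b', a)
    and (a, b'), each from two values of i. Hence two differences of values of \<open>Z\<close>
    remain, and they vanish when \<open>Z\<close> has no cut-off and \<open>Q\<close> fits the
    root.\<close>
  have 2: "RO (\<lambda>i j. if j = dl i then Z k j * w i / Q i else 0) =
            u (dl b) a * (U * sn P (od b) * x (dl b) * (Z k b * w (dl b) / Q (dl b))
               - \<eta> * (V / x a) * (Z k a * w (dl a) / Q (dl a)))
          + u a (dl b) * (V / x (dl b) * (Z k (dl b) * w b / Q b)
               - \<eta> * (U * sn P (od a) * x a) * (Z k (dl a) * w a / Q a))"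
  proof -
    have e: "(b = dl i) = (i = dl b)" "(dl a = dl i) = (i = a)" "(j = dl (dl a)) = (j = a)"
      using a b ijkl dl_dl by metis+
    have "U * sn P (od i) * x i * (if j = a then if b = dl i then Z k b * w i / Q i else 0 else 0)
        = u (dl b) a * (U * sn P (od b) * x (dl b) * (Z k b * w (dl b) / Q (dl b)))"
      "U * sn P (od i) * x i * (if j = dl b then \<eta> * (if dl a = dl i then Z k (dl a) * w i / Q i else 0) else 0)
        = u a (dl b) * (\<eta> * (U * sn P (od a) * x a) * (Z k (dl a) * w a / Q a))"
      "V / x j * (if i = a then if j = dl b then Z k j * w b / Q b else 0 else 0)
        = u a (dl b) * (V / x (dl b) * (Z k (dl b) * w b / Q b))"
      "V / x j * (if i = dl b then \<eta> * (if j = dl (dl a) then Z k j * w (dl a) / Q (dl a) else 0) else 0)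
        = u (dl b) a * (\<eta> * (V / x a) * (Z k a * w (dl a) / Q (dl a)))"
      unfolding e by (auto simp: ut_def u_def od mult_ac)
    then show ?thesis unfolding RO_def by (simp only: right_diff_distrib) (simp add: algebra_simps)
  qed
  have R: "RO (\<lambda>i j. M4 A B Z i j k l) = A k l * act4 P U V x \<eta> a b u l k + B k l * act4 P U V x \<eta> a b u k l
        - (if l = dl k then
            u (dl b) a * (U * sn P (od b) * x (dl b) * (Z k b * w (dl b) / Q (dl b))
               - \<eta> * (V / x a) * (Z k a * w (dl a) / Q (dl a)))
          + u a (dl b) * (V / x (dl b) * (Z k (dl b) * w b / Q b)
               - \<eta> * (U * sn P (od a) * x a) * (Z k (dl a) * w a / Q a)) else 0)"
    unfolding M4_def lin z 1 2 ..
  show "V * sn P (od k) * x k * (\<Sum>r=1..N. M4 A B Z i j k r * root_mat a b r l)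
     + U / x l * (\<Sum>r=1..N. M4 A B Z i j r l * root_mat a b r k)
     = U * sn P (od i) * x i * (\<Sum>r=1..N. root_mat a b j r * M4 A B Z i r k l)
     + V / x j * (\<Sum>r=1..N. root_mat a b i r * M4 A B Z r j k l)"
    unfolding root_mat_sum[OF a b] \<eta>[symmetric] column[OF ijkl u_def] R[symmetric] RO_def ..
qed

section \<open>Commutation of S and K with the finite simple root vectors\<close>

lemma S_simple:
  assumes a: "a \<in> {1..N}" and b: "b = a + 1" and ord: "b < dl b"
    and Qab: "Q a = Q b * tp a * tp b"
  shows "intertwines S (od a \<noteq> od b) 1 1 (root_wt a b) (root_mat a b)"
proof -
  define a' b' where "a' = dl a" and "b' = dl b"
  have bN: "b \<in> {1..N}" using a ord b by (auto simp: dl_def)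
  have du: "dl a = a'" "dl b = b'" "dl a' = a" "dl b' = b"
    using a bN by (auto simp: a'_def b'_def dl_dl)
  have ne: "a \<noteq> b" "b \<noteq> a" "a \<noteq> a'" "a' \<noteq> a" "a \<noteq> b'" "b' \<noteq> a" "b \<noteq> a'" "a' \<noteq> b" "b \<noteq> b'" "b' \<noteq> b" "a' \<noteq> b'" "b' \<noteq> a'"
    and lt: "a < b" "a < b'" "a < a'" "b < b'" "b < a'" "b' < a'"
      "\<not> b < a" "\<not> b' < a" "\<not> a' < a" "\<not> b' < b" "\<not> a' < b" "\<not> a' < b'"
    using a b ord by (auto simp: a'_def b'_def dl_def)
  have oo: "od a' = od a" "od b' = od b" and ww: "w a' = (if od a then - w a else w a)" "w b' = (if od b then - w b else w b)"
    and QQ: "Q a' = 1 / Q a" "Q b' = 1 / Q b" and qn: "Q b \<noteq> 0"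
    using a bN od_dual w_dual Q_dual Q by (auto simp: a'_def b'_def dl_def)
  have wab: "w a = 1 \<or> w a = -1" "w b = 1 \<or> w b = -1" using w[OF a] w[OF bN] by auto
  define oth where "oth x \<longleftrightarrow> x \<noteq> a \<and> x \<noteq> b \<and> x \<noteq> a' \<and> x \<noteq> b'" for x
  \<comment> \<open>Since a, b are neighbours and so are b', a', an index outside these four is
    subject to the same cut-off for both members of each pair.\<close>
  have oth_lt: "oth x \<Longrightarrow> x < b \<longleftrightarrow> x < a" "oth x \<Longrightarrow> b < x \<longleftrightarrow> a < x"
     "oth x \<Longrightarrow> x < a' \<longleftrightarrow> x < b'" "oth x \<Longrightarrow> a' < x \<longleftrightarrow> b' < x" for x
    using a b ord by (auto simp: oth_def a'_def b'_def dl_def)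
  have cls: "x = a \<or> x = b \<or> x = a' \<or> x = b' \<or> oth x" for x unfolding oth_def by blast
  have othd: "x \<noteq> a" "x \<noteq> b" "x \<noteq> a'" "x \<noteq> b'" "a \<noteq> x" "b \<noteq> x" "a' \<noteq> x" "b' \<noteq> x" if "oth x" for x
    using that unfolding oth_def by auto
  have othd2: "a \<noteq> dl x" "b \<noteq> dl x" "a' \<noteq> dl x" "b' \<noteq> dl x" "dl x \<noteq> a" "dl x \<noteq> b" "dl x \<noteq> a'" "dl x \<noteq> b'" if "oth x" "x \<in> {1..N}" for x
    using that a b ord unfolding oth_def a'_def b'_def dl_def by auto
  have xa: "root_wt a b a = tp a" "root_wt a b b = 1 / tp b" "root_wt a b a' = 1 / tp a" "root_wt a b b' = tp b"
    and xo: "oth r \<Longrightarrow> root_wt a b r = 1" for r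
    using ne unfolding root_wt_def du oth_def by auto
  show ?thesis unfolding S_def
  proof (rule intertwines_M4I[OF a bN refl], goal_cases)
    case (1 i j k l u)
    have un: "ut r y i j = u r y" for r y using 1 by simp
    consider "oth k" "oth l" | "k = a" "oth l" | "k = b" "oth l" | "k = a'" "oth l" | "k = b'" "oth l"
     | "oth k" "l = a" | "oth k" "l = b" | "oth k" "l = a'" | "oth k" "l = b'"
     | "k = a" "l = a" | "k = a" "l = b" | "k = a" "l = a'" | "k = a" "l = b'"
     | "k = b" "l = a" | "k = b" "l = b" | "k = b" "l = a'" | "k = b" "l = b'"
     | "k = a'" "l = a" | "k = a'" "l = b" | "k = a'" "l = a'" | "k = a'" "l = b'"
     | "k = b'" "l = a" | "k = b'" "l = b" | "k = b'" "l = a'" | "k = b'" "l = b'"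
      using cls[of k] cls[of l] by argo
    note cs = this
    let ?P = "od a \<noteq> od b" and ?e = "sn (od a) (od a \<noteq> od b) * w a * w b"
    have aux: "1 * p * x * (Z * c / d) - e * (1 / y) * (Z' * c' / d') = Z * (p * x * c / d) - Z' * (e / y * c' / d')"
      for p x Z c d e y Z' c' d' :: 'a by (simp add: mult_ac)
    have aux2: "1 / y * (Z * c / d) - e * (1 * p * x) * (Z' * c' / d') = Z * (c / d / y) - Z' * (e * p * x * c' / d')"
      for p x Z c d e y Z' c' d' :: 'a by (simp add: mult_ac)
    \<comment> \<open>The cut-offs k < b and k < a disagree only at k = a. Wherever they agree the
      two terms cancel by \<open>E\<close>, which is where \<open>Qab\<close> enters.\<close>
    have C0: "1 * sn ?P (od b) * root_wt a b (dl b) * ((if k < b then hh * gg k else 0) * w (dl b) / Q (dl b))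
               - ?e * (1 / root_wt a b a) * ((if k < a then hh * gg k else 0) * w (dl a) / Q (dl a))
        = (if k = a then hh * gg a * (sn ?P (od b) * tp b * w b' / Q b') else 0)"
    proof -
      have E: "?e / tp a * w a' / Q a' = sn ?P (od b) * tp b * w b' / Q b'"
        using wab qn t unfolding ww QQ Qab sn_def tp_def by (cases "od a"; cases "od b"; auto simp: field_simps)
      have "k < b \<longleftrightarrow> k < a \<or> k = a" using b by auto
      then show ?thesis unfolding xa du aux E using lt by auto
    qed
    have C1: "1 / root_wt a b (dl b) * ((if k < dl b then hh * gg k else 0) * w b / Q b)
               - ?e * (1 * sn ?P (od a) * root_wt a b a) * ((if k < dl a then hh * gg k else 0) * w a / Q a)
        = (if k = b' then - (hh * gg b' * (w b / Q b / tp b)) else 0)"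
    proof -
      have E: "?e * sn ?P (od a) * tp a * w a / Q a = w b / Q b / tp b"
        using wab qn t unfolding ww QQ Qab sn_def tp_def by (cases "od a"; cases "od b"; auto simp: field_simps)
      have "k < a' \<longleftrightarrow> k < b' \<or> k = b'" using b a ord by (auto simp: a'_def b'_def dl_def)
      then show ?thesis unfolding xa du aux2 E using lt by auto
    qed
    have lti: "a < dl i \<longleftrightarrow> b < dl i \<or> i = b'" "b' < dl i \<longleftrightarrow> a' < dl i \<or> i = a"
      using 1(1) a b ord unfolding a'_def b'_def dl_def by auto
    have un2: "u r y = (if i = r \<and> j = y then 1 else 0)" for r y using 1(5) by (simp add: ut_def)
    \<comment> \<open>The cut-off invariant vector in the given row. The columns (b, a') and (a', b)
      need it: each is mapped to two columns of dual pairs, whose cut-offs differ in exactly one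
      row. Expressing one tail through the other leaves only finitely many indicators to
      compare.\<close>
    define G where "G c = (if j = dl i \<and> c < j then hh * w i / Q i else 0)" for c
    let ?M = "M4 (\<lambda>k l. sn (od k) (od l) * Dg k l) (\<lambda>k l. if k < l then hh else 0) (\<lambda>k j. if k < j then hh * gg k else 0)"
    have G: "G a = G b + hh * w b' / Q b' * u b' b" "G b' = G a' + hh * w a / Q a * u a a'"
      using 1(1,2) lti lt unfolding G_def un2 by (auto simp: du)
    define Mm where "Mm = ?M"
    have m: "Mm i j c (dl c) = sn (od c) (od (dl c)) * Dg c (dl c) * u (dl c) c
        + (if c < dl c then hh else 0) * u c (dl c) - gg c * G c" for c
      unfolding Mm_def M4_def un G_def by simp
    have m16: "Mm i j a a' = sn (od a) (od a') * Dg a a' * u a' a + hh * u a a' - gg a * (G b + hh * w b' / Q b' * u b' b)"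
      "Mm i j b b' = sn (od b) (od b') * Dg b b' * u b' b + hh * u b b' - gg b * G b"
      using m[of a] m[of b] unfolding du G by (simp_all add: lt)
    have m19: "Mm i j a' a = sn (od a') (od a) * Dg a' a * u a a' - gg a' * G a'"
      "Mm i j b' b = sn (od b') (od b) * Dg b' b * u b b' - gg b' * (G a' + hh * w a / Q a * u a a')"
      using m[of a'] m[of b'] unfolding du G by (simp_all add: lt)
    note ss16 = ne lt du Dg_def oo oth_lt xa xo act4_def gg_def
    note ss = ne lt du Dg_def oo oth_lt xa xo othd othd2[OF _ 1(3)] othd2[OF _ 1(4)] act4_def M4_def un
    note s2 = oo ww QQ qn t Qab tp_def hh_def field_simps sn_def gg_def
    show ?case
    proof (cases rule: cs)
      case 16 then show ?thesis
        unfolding C0 C1 Mm_def[symmetric] by (simp add: ss16 m16; insert wab; cases "od a"; cases "od b"; auto simp: s2; simp add: numeral_eq_Suc)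
    next
      case 19 then show ?thesis
        unfolding C0 C1 Mm_def[symmetric] by (simp add: ss16 m19; insert wab; cases "od a"; cases "od b"; auto simp: s2; simp add: numeral_eq_Suc)
    qed (unfold C0 C1, (simp add: ss; insert wab; cases "od a"; cases "od b"; auto simp: s2; simp add: numeral_eq_Suc)+)
  qed
qed

lemma sn_sq [simp]: "sn x y * sn x y = 1" by (simp add: sn_def)

text \<open>\<open>Kt\<close> is the product of the vector \<open>w i / Q i\<close> and the covector
  \<open>gg\<close>. By \<open>E1\<close> and \<open>E2\<close> the coproduct of the root vector
  kills the vector, by \<open>E3\<close> and \<open>E4\<close> the covector kills its image, so both
  sides are 0.\<close>

lemma K_intertwines:
  assumes a: "a \<in> {1..N}" and b: "b \<in> {1..N}"
    and x: "x a \<noteq> 0" "x b \<noteq> 0" "x (dl a) = 1 / x a" "x (dl b) = 1 / x b"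
    and Qab: "Q a * x b = Q b * x a"
  shows "intertwines Kt (od a \<noteq> od b) 1 1 x (root_mat a b)"
proof -
  let ?P = "od a \<noteq> od b" and ?e = "sn (od a) (od a \<noteq> od b) * w a * w b"
  have oo: "od (dl a) = od a" "od (dl b) = od b"
    and ww: "w (dl a) = (if od a then - w a else w a)" "w (dl b) = (if od b then - w b else w b)"
    and QQ: "Q (dl a) = 1 / Q a" "Q (dl b) = 1 / Q b" and qn: "Q a \<noteq> 0" "Q b \<noteq> 0"
    using a b od_dual w_dual Q_dual Q by (auto simp: dl_def)
  have wab: "w a = 1 \<or> w a = -1" "w b = 1 \<or> w b = -1" using w[OF a] w[OF b] by auto
  \<comment> \<open>\<open>Qab\<close> says that \<open>Q\<close> is proportional to
    \<open>x\<close> on a, b. Once the common ratio is removed, the four identities are the pure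
    sign identities \<open>s\<close>.\<close>
  define \<mu> where "\<mu> = Q a / x a"
  have \<mu>: "Q a = \<mu> * x a" "Q b = \<mu> * x b" "\<mu> \<noteq> 0" using Qab x qn by (auto simp: \<mu>_def field_simps)
  have s: "sn ?P (od b) * w (dl b) = ?e * w (dl a)" "w b = ?e * sn ?P (od a) * w a"
    "sn ?P (od a) * (sn (od a) True * w (dl a)) = ?e * (sn (od b) True * w (dl b))"
    "sn (od a) True * w a = ?e * sn ?P (od b) * (sn (od b) True * w b)"
    using wab unfolding ww sn_def by (cases "od a"; cases "od b"; auto)+
  have E1: "sn ?P (od b) * x (dl b) * w (dl b) / Q (dl b) = ?e / x a * w (dl a) / Q (dl a)"
    using arg_cong[OF s(1), of "\<lambda>y. y * \<mu>"] unfolding QQ x(3,4) \<mu> by (simp add: x \<mu>(3) mult_ac)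
  have E2: "w b / Q b / x (dl b) = ?e * sn ?P (od a) * x a * w a / Q a"
    using arg_cong[OF s(2), of "\<lambda>y. y / \<mu>"] unfolding QQ x(3,4) \<mu> by (simp add: x \<mu>(3) mult_ac)
  have E3: "sn ?P (od a) * x (dl a) * gg (dl a) = ?e * gg (dl b) / x b"
    using arg_cong[OF s(3), of "\<lambda>y. y * \<mu>"] unfolding gg_def oo QQ x(3,4) \<mu> by (simp add: x \<mu>(3) mult_ac)
  have E4: "gg a / x (dl a) = ?e * sn ?P (od b) * x b * gg b"
    using arg_cong[OF s(4), of "\<lambda>y. y / \<mu>"] unfolding gg_def oo QQ x(3,4) \<mu> by (simp add: x \<mu>(3) mult_ac)
  show ?thesis unfolding Kt_def
  proof (rule intertwines_M4I[OF a b refl], goal_cases)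
    case (1 i j k l u)
    have C: "1 * sn ?P (od b) * x (dl b) * (- gg k * w (dl b) / Q (dl b))
            - ?e * (1 / x a) * (- gg k * w (dl a) / Q (dl a)) = 0"
      "1 / x (dl b) * (- gg k * w b / Q b) - ?e * (1 * sn ?P (od a) * x a) * (- gg k * w a / Q a) = 0"
      using arg_cong[OF E1, of "\<lambda>y. gg k * y"] arg_cong[OF E2, of "\<lambda>y. gg k * y"] by (auto simp: mult_ac)
    have M: "M4 (\<lambda>k l. 0) (\<lambda>k l. 0) (\<lambda>k j. - gg k) i j k' l' = (if l' = dl k' then gg k' else 0) * (if j = dl i then w i / Q i else 0)" for k' l'
      by (simp add: M4_def)
    define g where "g = (if j = dl i then w i / Q i else 0)"
    have d: "(a = dl k) = (k = dl a)" "(dl b = dl k) = (k = b)" "(l = dl (dl b)) = (l = b)"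
      using 1(3,4) a b dl_dl by metis+
    have z1: "A - B + (B - A) = 0" and z2: "0 * A + 0 * B - (if c then v * 0 + v' * 0 else 0) = 0" for A B v v' :: 'a and c
      by simp_all
    have T: "sn ?P (od k) * x k * (if l = b then (if a = dl k then gg k else 0) * g else 0)
        = g * (if k = dl a \<and> l = b then sn ?P (od a) * x (dl a) * gg (dl a) else 0)"
      "sn ?P (od k) * x k * (if l = dl a then ?e * ((if dl b = dl k then gg k else 0) * g) else 0)
        = g * (if k = b \<and> l = dl a then ?e * sn ?P (od b) * x b * gg b else 0)"
      "1 / x l * (if k = b then (if l = dl a then gg a else 0) * g else 0)
        = g * (if k = b \<and> l = dl a then gg a / x (dl a) else 0)"
      "1 / x l * (if k = dl a then ?e * ((if l = dl (dl b) then gg (dl b) else 0) * g) else 0)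
        = g * (if k = dl a \<and> l = b then ?e * gg (dl b) / x b else 0)"
      unfolding d by (simp_all add: oo mult_ac)
    have "1 * sn ?P (od k) * x k * ((if l = b then (if a = dl k then gg k else 0) * g else 0) - (if l = dl a then ?e * ((if dl b = dl k then gg k else 0) * g) else 0))
      + 1 / x l * ((if k = b then (if l = dl a then gg a else 0) * g else 0) - (if k = dl a then ?e * ((if l = dl (dl b) then gg (dl b) else 0) * g) else 0))
      = 0"
      unfolding right_diff_distrib mult_1_left T E3 E4 by (rule z1)
    then show ?case unfolding C M g_def[symmetric] z2 .
  qed
qed

lemma root_wt_dual:
  assumes "a \<in> {1..N}" and "b \<in> {1..N}"
  shows "root_wt a b (dl a) = 1 / root_wt a b a" "root_wt a b (dl b) = 1 / root_wt a b b"
    "root_wt a b k \<noteq> 0"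
proof -
  have e: "(dl a = b) = (a = dl b)" "(dl a = dl b) = (a = b)" "dl (dl a) = a" "dl (dl b) = b" "(dl b = a) = (b = dl a)" "(dl b = dl a) = (a = b)"
    using assms dl_dl by metis+
  show "root_wt a b (dl a) = 1 / root_wt a b a" "root_wt a b (dl b) = 1 / root_wt a b b" "root_wt a b k \<noteq> 0"
    unfolding root_wt_def e using t assms by (auto simp: tp_def e dl_dl)
qed

text \<open>Transposition reverses the order of the two operators, so the roles of \<open>U\<close>
  and \<open>V\<close> are exchanged. The parity hypotheses guarantee that all four sums acquire the
  same sign \<open>\<gamma>\<close>, which depends only on row and column.\<close>

lemma intertwines_transpose:
  assumes M: "intertwines M P U V x e"
    and sym: "\<And>i j k l. i \<in> {1..N} \<Longrightarrow> j \<in> {1..N} \<Longrightarrow> k \<in> {1..N} \<Longrightarrow> l \<in> {1..N} \<Longrightarrow>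
      M k l i j = sn (od i) (od j) * sn (od k) (od l) * M i j k l"
    and par: "\<And>i j k l. i \<in> {1..N} \<Longrightarrow> j \<in> {1..N} \<Longrightarrow> k \<in> {1..N} \<Longrightarrow> l \<in> {1..N} \<Longrightarrow>
      M i j k l \<noteq> 0 \<Longrightarrow> (od i = od j) = (od k = od l)"
    and e: "\<And>r l. r \<in> {1..N} \<Longrightarrow> l \<in> {1..N} \<Longrightarrow> e r l \<noteq> 0 \<Longrightarrow> P = (od r \<noteq> od l)"
  shows "intertwines M P V U x (\<lambda>r l. sn P (od r) * e l r)"
  unfolding intertwines_def
proof (intro ballI)
  fix i j k l assume ijkl: "i \<in> {1..N}" "j \<in> {1..N}" "k \<in> {1..N}" "l \<in> {1..N}"
  define J where "J a b = sn (od a) (od b)" for a b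
  define \<gamma> where "\<gamma> = J i j * J k l * sn P (od i) * sn P (od j)"
  have 1: "\<gamma> * (V * sn P (od i) * x i * (\<Sum>r=1..N. M k l i r * e r j)) =
     V * sn P (od i) * x i * (\<Sum>r=1..N. sn P (od j) * e r j * M i r k l)"
  proof -
    have "\<gamma> * (M k l i r * e r j) = sn P (od j) * e r j * M i r k l" if "r \<in> {1..N}" for r
      using e[of r j] that ijkl unfolding sym[OF ijkl(1) that ijkl(3,4)] \<gamma>_def J_def
      by (cases "e r j = 0"; auto simp: sn_def)
    then have "\<gamma> * (\<Sum>r=1..N. M k l i r * e r j) = (\<Sum>r=1..N. sn P (od j) * e r j * M i r k l)"
      unfolding sum_distrib_left by (intro sum.cong refl)
    then show ?thesis by (metis (no_types, lifting) mult.left_commute)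
  qed
  have 2: "\<gamma> * (U / x j * (\<Sum>r=1..N. M k l r j * e r i)) =
     U / x j * (\<Sum>r=1..N. sn P (od i) * e r i * M r j k l)"
  proof -
    have "\<gamma> * (M k l r j * e r i) = sn P (od i) * e r i * M r j k l" if "r \<in> {1..N}" for r
      using e[of r i] that ijkl unfolding sym[OF that ijkl(2,3,4)] \<gamma>_def J_def
      by (cases "e r i = 0"; auto simp: sn_def)
    then have "\<gamma> * (\<Sum>r=1..N. M k l r j * e r i) = (\<Sum>r=1..N. sn P (od i) * e r i * M r j k l)"
      unfolding sum_distrib_left by (intro sum.cong refl)
    then show ?thesis by (metis (no_types, lifting) mult.left_commute)
  qed
  have 3: "\<gamma> * (U * sn P (od k) * x k * (\<Sum>r=1..N. e l r * M k r i j)) =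
     U * sn P (od k) * x k * (\<Sum>r=1..N. M i j k r * (sn P (od r) * e l r))"
  proof -
    have "\<gamma> * (e l r * M k r i j) = M i j k r * (sn P (od r) * e l r)" if "r \<in> {1..N}" for r
      using e[of l r] par[OF ijkl(1-3) that] that ijkl unfolding sym[OF ijkl(1,2,3) that] \<gamma>_def J_def
      by (cases "e l r = 0"; cases "M i j k r = 0"; auto simp: sn_def)
    then have "\<gamma> * (\<Sum>r=1..N. e l r * M k r i j) = (\<Sum>r=1..N. M i j k r * (sn P (od r) * e l r))"
      unfolding sum_distrib_left by (intro sum.cong refl)
    then show ?thesis by (metis (no_types, lifting) mult.left_commute)
  qed
  have 4: "\<gamma> * (V / x l * (\<Sum>r=1..N. e k r * M r l i j)) =
     V / x l * (\<Sum>r=1..N. M i j r l * (sn P (od r) * e k r))"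
  proof -
    have "\<gamma> * (e k r * M r l i j) = M i j r l * (sn P (od r) * e k r)" if "r \<in> {1..N}" for r
      using e[of k r] par[OF ijkl(1,2) that ijkl(4)] that ijkl unfolding sym[OF ijkl(1,2) that ijkl(4)] \<gamma>_def J_def
      by (cases "e k r = 0"; cases "M i j r l = 0"; auto simp: sn_def)
    then have "\<gamma> * (\<Sum>r=1..N. e k r * M r l i j) = (\<Sum>r=1..N. M i j r l * (sn P (od r) * e k r))"
      unfolding sum_distrib_left by (intro sum.cong refl)
    then show ?thesis by (metis (no_types, lifting) mult.left_commute)
  qed
  show "U * sn P (od k) * x k * (\<Sum>r=1..N. M i j k r * (sn P (od r) * e l r))
     + V / x l * (\<Sum>r=1..N. M i j r l * (sn P (od r) * e k r))
     = V * sn P (od i) * x i * (\<Sum>r=1..N. sn P (od j) * e r j * M i r k l)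
     + U / x j * (\<Sum>r=1..N. sn P (od i) * e r i * M r j k l)"
    using arg_cong[OF M[unfolded intertwines_def, rule_format, OF ijkl(3,4,1,2)], of "\<lambda>y. \<gamma> * y"]
    unfolding distrib_left 1 2 3 4 by simp
qed

text \<open>
  Conjugation by the permutation \<open>\<pi>\<close> and the diagonal matrices \<open>\<gamma>u\<close>, \<open>\<gamma>v\<close> on the two tensor factors.
\<close>

lemma intertwines_gauge:
  assumes M: "intertwines M P 1 1 x e"
    and \<pi>: "\<And>i. i \<in> {1..N} \<Longrightarrow> \<pi> i \<in> {1..N} \<and> \<pi> (\<pi> i) = i \<and> od (\<pi> i) = od i"
    and \<gamma>: "\<And>i. \<gamma>u i \<noteq> 0" "\<And>i. \<gamma>v i \<noteq> 0"
    and sym: "\<And>i j k l. i \<in> {1..N} \<Longrightarrow> j \<in> {1..N} \<Longrightarrow> k \<in> {1..N} \<Longrightarrow> l \<in> {1..N} \<Longrightarrow>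
      M (\<pi> i) (\<pi> j) (\<pi> k) (\<pi> l) * (\<gamma>u k * \<gamma>v l) = \<gamma>v i * \<gamma>u j * M i j k l"
    and e': "\<And>r l. r \<in> {1..N} \<Longrightarrow> l \<in> {1..N} \<Longrightarrow> \<gamma>u l * e (\<pi> r) (\<pi> l) = U * e' r l * \<gamma>u r"
      "\<And>r l. r \<in> {1..N} \<Longrightarrow> l \<in> {1..N} \<Longrightarrow> \<gamma>v l * e (\<pi> r) (\<pi> l) = V * e' r l * \<gamma>v r"
    and x': "\<And>i. i \<in> {1..N} \<Longrightarrow> x' i = x (\<pi> i)"
  shows "intertwines M P U V x' e'"
  unfolding intertwines_def
proof (intro ballI)
  fix i j k l assume ijkl: "i \<in> {1..N}" "j \<in> {1..N}" "k \<in> {1..N}" "l \<in> {1..N}"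
  have bij: "bij_betw \<pi> {1..N} {1..N}"
    by (rule bij_betw_byWitness[of _ \<pi>]) (use \<pi> in auto)
  have re: "(\<Sum>r=1..N. f r) = (\<Sum>r=1..N. f (\<pi> r))" for f :: "nat \<Rightarrow> 'a"
    using sum.reindex_bij_betw[OF bij] by metis
  \<comment> \<open>The source carries the gauge \<open>\<gamma>u\<close> \<otimes>
    \<open>\<gamma>v\<close>, the target \<open>\<gamma>v\<close> \<otimes>
    \<open>\<gamma>u\<close>. Conjugation therefore multiplies all four sums by the same 1 / g,
    besides the factor \<open>U\<close> or \<open>V\<close> contributed by the root vector.\<close>
  define g where "g = \<gamma>u k * \<gamma>v l / (\<gamma>v i * \<gamma>u j)"
  have sym': "M (\<pi> i) (\<pi> j) (\<pi> k) (\<pi> l) = \<gamma>v i * \<gamma>u j * M i j k l / (\<gamma>u k * \<gamma>v l)"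
    if "i \<in> {1..N}" "j \<in> {1..N}" "k \<in> {1..N}" "l \<in> {1..N}" for i j k l
    using sym[OF that] by (simp add: eq_divide_eq \<gamma> mult_ac)
  have eu: "e (\<pi> r) (\<pi> l) = U * e' r l * \<gamma>u r / \<gamma>u l"
    and ev: "e (\<pi> r) (\<pi> l) = V * e' r l * \<gamma>v r / \<gamma>v l" if "r \<in> {1..N}" "l \<in> {1..N}" for r l
    using e'(1)[OF that] e'(2)[OF that] by (simp_all add: eq_divide_eq \<gamma> mult.commute)
  have 1: "(\<Sum>r=1..N. M (\<pi> i) (\<pi> j) (\<pi> k) r * e r (\<pi> l)) = V * (\<Sum>r=1..N. M i j k r * e' r l) / g"
    unfolding re[of "\<lambda>r. M (\<pi> i) (\<pi> j) (\<pi> k) r * e r (\<pi> l)"] sum_distrib_left sum_divide_distrib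
  proof (rule sum.cong[OF refl])
    fix r assume r: "r \<in> {1..N}"
    show "M (\<pi> i) (\<pi> j) (\<pi> k) (\<pi> r) * e (\<pi> r) (\<pi> l) = V * (M i j k r * e' r l) / g"
      unfolding sym'[OF ijkl(1-3) r] ev[OF r ijkl(4)] g_def by (simp add: \<gamma> mult_ac)
  qed
  have 2: "(\<Sum>r=1..N. M (\<pi> i) (\<pi> j) r (\<pi> l) * e r (\<pi> k)) = U * (\<Sum>r=1..N. M i j r l * e' r k) / g"
    unfolding re[of "\<lambda>r. M (\<pi> i) (\<pi> j) r (\<pi> l) * e r (\<pi> k)"] sum_distrib_left sum_divide_distrib
  proof (rule sum.cong[OF refl])
    fix r assume r: "r \<in> {1..N}"
    show "M (\<pi> i) (\<pi> j) (\<pi> r) (\<pi> l) * e (\<pi> r) (\<pi> k) = U * (M i j r l * e' r k) / g"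
      unfolding sym'[OF ijkl(1,2) r ijkl(4)] eu[OF r ijkl(3)] g_def by (simp add: \<gamma> mult_ac)
  qed
  have 3: "(\<Sum>r=1..N. e (\<pi> j) r * M (\<pi> i) r (\<pi> k) (\<pi> l)) = U * (\<Sum>r=1..N. e' j r * M i r k l) / g"
    unfolding re[of "\<lambda>r. e (\<pi> j) r * M (\<pi> i) r (\<pi> k) (\<pi> l)"] sum_distrib_left sum_divide_distrib
  proof (rule sum.cong[OF refl])
    fix r assume r: "r \<in> {1..N}"
    show "e (\<pi> j) (\<pi> r) * M (\<pi> i) (\<pi> r) (\<pi> k) (\<pi> l) = U * (e' j r * M i r k l) / g"
      unfolding sym'[OF ijkl(1) r ijkl(3,4)] eu[OF ijkl(2) r] g_def by (simp add: \<gamma> mult_ac)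
  qed
  have 4: "(\<Sum>r=1..N. e (\<pi> i) r * M r (\<pi> j) (\<pi> k) (\<pi> l)) = V * (\<Sum>r=1..N. e' i r * M r j k l) / g"
    unfolding re[of "\<lambda>r. e (\<pi> i) r * M r (\<pi> j) (\<pi> k) (\<pi> l)"] sum_distrib_left sum_divide_distrib
  proof (rule sum.cong[OF refl])
    fix r assume r: "r \<in> {1..N}"
    show "e (\<pi> i) (\<pi> r) * M (\<pi> r) (\<pi> j) (\<pi> k) (\<pi> l) = V * (e' i r * M r j k l) / g"
      unfolding sym'[OF r ijkl(2-4)] ev[OF ijkl(1) r] g_def by (simp add: \<gamma> mult_ac)
  qed
  have g: "g \<noteq> 0" using \<gamma> by (simp add: g_def)
  have \<pi>i: "\<pi> i \<in> {1..N}" "\<pi> j \<in> {1..N}" "\<pi> k \<in> {1..N}" "\<pi> l \<in> {1..N}" using \<pi> ijkl by blast+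
  have od\<pi>: "od (\<pi> i) = od i" "od (\<pi> k) = od k" using \<pi> ijkl by blast+
  have fin: "V * a1 * s1 + U / b1 * s2 = U * c1 * s3 + V / d1 * s4"
    if "a1 * (V * s1 / g) + 1 / b1 * (U * s2 / g) = c1 * (U * s3 / g) + 1 / d1 * (V * s4 / g)"
    for a1 b1 c1 d1 s1 s2 s3 s4
  proof -
    have "(V * a1 * s1 + U / b1 * s2) / g = (U * c1 * s3 + V / d1 * s4) / g"
      using that by (simp add: add_divide_distrib mult_ac)
    then show ?thesis using g by simp
  qed
  have "1 * sn P (od (\<pi> k)) * x (\<pi> k) * (V * (\<Sum>r=1..N. M i j k r * e' r l) / g)
     + 1 / x (\<pi> l) * (U * (\<Sum>r=1..N. M i j r l * e' r k) / g)
     = 1 * sn P (od (\<pi> i)) * x (\<pi> i) * (U * (\<Sum>r=1..N. e' j r * M i r k l) / g)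
     + 1 / x (\<pi> j) * (V * (\<Sum>r=1..N. e' i r * M r j k l) / g)"
    unfolding 1[symmetric] 2[symmetric] 3[symmetric] 4[symmetric]
    by (rule M[unfolded intertwines_def, rule_format, OF \<pi>i])
  then have "sn P (od k) * x' k * (V * (\<Sum>r=1..N. M i j k r * e' r l) / g)
     + 1 / x' l * (U * (\<Sum>r=1..N. M i j r l * e' r k) / g)
     = sn P (od i) * x' i * (U * (\<Sum>r=1..N. e' j r * M i r k l) / g)
     + 1 / x' j * (V * (\<Sum>r=1..N. e' i r * M r j k l) / g)"
    by (simp only: x'[OF ijkl(1)] x'[OF ijkl(2)] x'[OF ijkl(3)] x'[OF ijkl(4)] od\<pi> mult_1_left)
  from fin[OF this] show "V * sn P (od k) * x' k * (\<Sum>r=1..N. M i j k r * e' r l)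
     + U / x' l * (\<Sum>r=1..N. M i j r l * e' r k)
     = U * sn P (od i) * x' i * (\<Sum>r=1..N. e' j r * M i r k l)
     + V / x' j * (\<Sum>r=1..N. e' i r * M r j k l)"
    by (simp only: mult.assoc)
qed

text \<open>The last simple root for odd N, where b is its own dual and a, b, a' are consecutive.
  The argument is that of \<open>S_simple\<close> with b' merged into b; the values of
  \<open>Q\<close> say that (rho, eps_a) is half of (eps_a, eps_a).\<close>

lemma S_middle:
  assumes a: "a \<in> {1..N}" and b: "b = a + 1" and ord: "b = dl b"
    and evb: "\<not> od b" and Qb: "Q b = 1" and Qab: "Q a = tp a"
  shows "intertwines S (od a \<noteq> od b) 1 1 (\<lambda>k. root_wt a b k) (root_mat a b)"
proof -
  define a' where "a' = dl a"
  have bN: "b \<in> {1..N}" using a ord b by (auto simp: dl_def)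
  have du: "dl a = a'" "dl b = b" "dl a' = a"
    using a ord[symmetric] by (auto simp: a'_def dl_dl)
  have ne: "a \<noteq> b" "b \<noteq> a" "a \<noteq> a'" "a' \<noteq> a" "b \<noteq> a'" "a' \<noteq> b"
    and lt: "a < b" "a < a'" "b < a'" "\<not> b < a" "\<not> a' < a" "\<not> a' < b"
    using a b ord by (auto simp: a'_def dl_def)
  have oo: "od a' = od a" and ww: "w a' = (if od a then - w a else w a)"
    and QQ: "Q a' = 1 / Q a"
    using a od_dual w_dual Q_dual by (auto simp: a'_def dl_def)
  have wab: "w a = 1 \<or> w a = -1" "w b = 1 \<or> w b = -1" using w[OF a] w[OF bN] by auto
  define oth where "oth x \<longleftrightarrow> x \<noteq> a \<and> x \<noteq> b \<and> x \<noteq> a'" for x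
  have oth_lt: "oth x \<Longrightarrow> x < b \<longleftrightarrow> x < a" "oth x \<Longrightarrow> b < x \<longleftrightarrow> a < x"
     "oth x \<Longrightarrow> x < a' \<longleftrightarrow> x < a" "oth x \<Longrightarrow> a' < x \<longleftrightarrow> a < x" for x
    using a b ord by (auto simp: oth_def a'_def dl_def)
  have cls: "x = a \<or> x = b \<or> x = a' \<or> oth x" for x unfolding oth_def by blast
  have othd: "x \<noteq> a" "x \<noteq> b" "x \<noteq> a'" "a \<noteq> x" "b \<noteq> x" "a' \<noteq> x" if "oth x" for x
    using that unfolding oth_def by auto
  have othd2: "a \<noteq> dl x" "b \<noteq> dl x" "a' \<noteq> dl x" "dl x \<noteq> a" "dl x \<noteq> b" "dl x \<noteq> a'" if "oth x" "x \<in> {1..N}" for x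
    using that a b ord unfolding oth_def a'_def dl_def by auto
  have xa: "root_wt a b a = tp a" "root_wt a b b = 1" "root_wt a b a' = 1 / tp a"
    and xo: "oth r \<Longrightarrow> root_wt a b r = 1" for r
    using ne t unfolding root_wt_def du oth_def by (auto simp: tp_def)
  show ?thesis unfolding S_def
  proof (rule intertwines_M4I[OF a bN refl], goal_cases)
    case (1 i j k l u)
    have un: "ut r y i j = u r y" for r y using 1 by simp
    let ?P = "od a \<noteq> od b" and ?e = "sn (od a) (od a \<noteq> od b) * w a * w b"
    have aux: "1 * p * x * (Z * c / d) - e * (1 / y) * (Z' * c' / d') = Z * (p * x * c / d) - Z' * (e / y * c' / d')"
      for p x Z c d e y Z' c' d' :: 'a by (simp add: mult_ac)
    have aux2: "1 / y * (Z * c / d) - e * (1 * p * x) * (Z' * c' / d') = Z * (c / d / y) - Z' * (e * p * x * c' / d')"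
      for p x Z c d e y Z' c' d' :: 'a by (simp add: mult_ac)
    have C0: "1 * sn ?P (od b) * root_wt a b (dl b) * ((if k < b then hh * gg k else 0) * w (dl b) / Q (dl b))
               - ?e * (1 / root_wt a b a) * ((if k < a then hh * gg k else 0) * w (dl a) / Q (dl a))
        = (if k = a then hh * gg a * w b else 0)"
    proof -
      have E: "?e / tp a * w a' / Q a' = w b" "sn ?P (od b) * 1 * w b / 1 = w b"
        using wab t evb unfolding ww QQ Qab sn_def tp_def by (cases "od a"; auto simp: field_simps)+
      have "k < b \<longleftrightarrow> k < a \<or> k = a" using b by auto
      then show ?thesis unfolding xa du aux Qb E using lt by auto
    qed
    have C1: "1 / root_wt a b (dl b) * ((if k < dl b then hh * gg k else 0) * w b / Q b)
               - ?e * (1 * sn ?P (od a) * root_wt a b a) * ((if k < dl a then hh * gg k else 0) * w a / Q a)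
        = (if k = b then - (hh * gg b * w b) else 0)"
    proof -
      have E: "?e * sn ?P (od a) * tp a * w a / Q a = w b" "w b / 1 / 1 = w b"
        using wab t evb unfolding ww QQ Qab sn_def tp_def by (cases "od a"; auto simp: field_simps)+
      have "k < a' \<longleftrightarrow> k < b \<or> k = b" using b a ord by (auto simp: a'_def dl_def)
      then show ?thesis unfolding xa du aux2 Qb E using lt by auto
    qed
    have lti: "a < dl i \<longleftrightarrow> b < dl i \<or> i = b" "b < dl i \<longleftrightarrow> a' < dl i \<or> i = a"
      using 1(1) a b ord unfolding a'_def dl_def by auto
    have un2: "u r y = (if i = r \<and> j = y then 1 else 0)" for r y using 1(5) by (simp add: ut_def)
    define G where "G c = (if j = dl i \<and> c < j then hh * w i / Q i else 0)" for c
    let ?M = "M4 (\<lambda>k l. sn (od k) (od l) * Dg k l) (\<lambda>k l. if k < l then hh else 0) (\<lambda>k j. if k < j then hh * gg k else 0)"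
    have G: "G a = G b + hh * w b * u b b" "G b = G a' + hh * w a / Q a * u a a'"
      using 1(1,2) lti lt unfolding G_def un2 by (auto simp: du Qb)
    define Mm where "Mm = ?M"
    have m: "Mm i j c (dl c) = sn (od c) (od (dl c)) * Dg c (dl c) * u (dl c) c
        + (if c < dl c then hh else 0) * u c (dl c) - gg c * G c" for c
      unfolding Mm_def M4_def un G_def by simp
    have m16: "Mm i j a a' = sn (od a) (od a') * Dg a a' * u a' a + hh * u a a' - gg a * (G b + hh * w b * u b b)"
      "Mm i j b b = u b b - gg b * G b"
      using m[of a] m[of b] unfolding du G by (simp_all add: lt evb sn_def Dg_def du)
    have m19: "Mm i j a' a = sn (od a') (od a) * Dg a' a * u a a' - gg a' * G a'"
      "Mm i j b b = u b b - gg b * (G a' + hh * w a / Q a * u a a')"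
      using m[of a'] m[of b] unfolding du G by (simp_all add: lt evb sn_def Dg_def du)
    note ss16 = ne lt du Dg_def oo oth_lt xa xo act4_def gg_def evb Qb
    note ss = ne lt du Dg_def oo oth_lt xa xo othd othd2[OF _ 1(3)] othd2[OF _ 1(4)] act4_def M4_def un gg_def evb Qb
    note s2 = oo ww QQ t Qab tp_def hh_def field_simps sn_def gg_def
    consider "oth k" "oth l"
     | "oth k" "l = a"
     | "oth k" "l = b"
     | "oth k" "l = a'"
     | "k = a" "oth l"
     | "k = a" "l = a"
     | "k = a" "l = b"
     | "k = a" "l = a'"
     | "k = b" "oth l"
     | "k = b" "l = a"
     | "k = b" "l = b"
     | "k = b" "l = a'"
     | "k = a'" "oth l"
     | "k = a'" "l = a"
     | "k = a'" "l = b"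
     | "k = a'" "l = a'"
      using cls[of k] cls[of l] by argo
    note cs = this
    show ?case
    proof (cases rule: cs)
      case 12 then show ?thesis
        unfolding C0 C1 Mm_def[symmetric] by (simp add: ss16 m16; insert wab; cases "od a"; auto simp: s2; simp add: numeral_eq_Suc)
    next
      case 15 then show ?thesis
        unfolding C0 C1 Mm_def[symmetric] by (simp add: ss16 m19; insert wab; cases "od a"; auto simp: s2; simp add: numeral_eq_Suc)
    qed (unfold C0 C1, (simp add: ss; insert wab; cases "od a"; cases "od b"; auto simp: s2; simp add: numeral_eq_Suc)+)
  qed
qed

text \<open>With b = a' the two terms of \<open>root_mat\<close> coincide and add up to twice a
  matrix unit of even parity. The tails of the cut-off vector now meet in the single column (b, b),
  which is mapped to (a, b) and (b, a).\<close>

lemma S_long: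
  assumes a: "a \<in> {1..N}" and b: "b = a + 1" and ord: "b = dl a"
    and oda: "od a" and Qab: "Q a = (tp a)\<^sup>2"
  shows "intertwines S (od a \<noteq> od b) 1 1 (root_wt a b) (root_mat a b)"
proof -
  have bN: "b \<in> {1..N}" using a ord b by (auto simp: dl_def)
  have du: "dl a = b" "dl b = a"
    using a ord by (auto simp: dl_dl)
  have ne: "a \<noteq> b" "b \<noteq> a" and lt: "a < b" "\<not> b < a"
    using a b by auto
  have oo: "od b" and ww: "w b = - w a" and QQ: "Q b = 1 / Q a"
    using a od_dual[OF a] w_dual[OF a] Q_dual[OF a] oda unfolding ord dl_def by auto
  have wab: "w a = 1 \<or> w a = -1" using w[OF a] by auto
  define oth where "oth x \<longleftrightarrow> x \<noteq> a \<and> x \<noteq> b" for x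
  have oth_lt: "oth x \<Longrightarrow> x < b \<longleftrightarrow> x < a" "oth x \<Longrightarrow> b < x \<longleftrightarrow> a < x" for x
    using a b by (auto simp: oth_def)
  have cls: "x = a \<or> x = b \<or> oth x" for x unfolding oth_def by blast
  have othd: "x \<noteq> a" "x \<noteq> b" "a \<noteq> x" "b \<noteq> x" if "oth x" for x
    using that unfolding oth_def by auto
  have othd2: "a \<noteq> dl x" "b \<noteq> dl x" "dl x \<noteq> a" "dl x \<noteq> b" if "oth x" "x \<in> {1..N}" for x
    using that a b ord unfolding oth_def dl_def by auto
  have xa: "root_wt a b a = 1 / t\<^sup>2" "root_wt a b b = t\<^sup>2"
    and xo: "oth r \<Longrightarrow> root_wt a b r = 1" for r
    using ne t oda oo unfolding root_wt_def du oth_def by (auto simp: tp_def power2_eq_square)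
  have Qa: "Q a = 1 / t\<^sup>2" using Qab oda by (simp add: tp_def power2_eq_square)
  show ?thesis unfolding S_def
  proof (rule intertwines_M4I[OF a bN refl], goal_cases)
    case (1 i j k l u)
    have un: "ut r y i j = u r y" for r y using 1 by simp
    let ?P = "od a \<noteq> od b" and ?e = "sn (od a) (od a \<noteq> od b) * w a * w b"
    have e1: "?e = -1" "sn ?P x = 1" for x using wab oda oo by (auto simp: sn_def ww)
    have ba: "k < b \<longleftrightarrow> k < a \<or> k = a" using b by auto
    have C0: "1 * sn ?P (od b) * root_wt a b (dl b) * ((if k < b then hh * gg k else 0) * w (dl b) / Q (dl b))
               - ?e * (1 / root_wt a b a) * ((if k < a then hh * gg k else 0) * w (dl a) / Q (dl a))
        = (if k = a then hh * gg a * w a else 0)"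
      unfolding e1 unfolding xa du ba QQ Qa ww using t lt by auto
    have C1: "1 / root_wt a b (dl b) * ((if k < dl b then hh * gg k else 0) * w b / Q b)
               - ?e * (1 * sn ?P (od a) * root_wt a b a) * ((if k < dl a then hh * gg k else 0) * w a / Q a)
        = (if k = a then hh * gg a * w a else 0)"
      unfolding e1 unfolding xa du ba QQ Qa ww using t lt by auto
    have lti: "a < dl i \<longleftrightarrow> b < dl i \<or> i = a"
      using 1(1) a b ord unfolding dl_def by auto
    have un2: "u r y = (if i = r \<and> j = y then 1 else 0)" for r y using 1(5) by (simp add: ut_def)
    define G where "G c = (if j = dl i \<and> c < j then hh * w i / Q i else 0)" for c
    let ?M = "M4 (\<lambda>k l. sn (od k) (od l) * Dg k l) (\<lambda>k l. if k < l then hh else 0) (\<lambda>k j. if k < j then hh * gg k else 0)"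
    have G: "G a = G b + hh * w a / Q a * u a b"
      using 1(1,2) lti lt unfolding G_def un2 by (auto simp: du)
    define Mm where "Mm = ?M"
    have m: "Mm i j c (dl c) = sn (od c) (od (dl c)) * Dg c (dl c) * u (dl c) c
        + (if c < dl c then hh else 0) * u c (dl c) - gg c * G c" for c
      unfolding Mm_def M4_def un G_def by simp
    have m16: "Mm i j a b = - (Dg a b * u b a) + hh * u a b - gg a * (G b + hh * w a / Q a * u a b)"
      "Mm i j b a = - (Dg b a * u a b) - gg b * G b"
      using m[of a] m[of b] unfolding du G by (simp_all add: lt oda oo sn_def)
    note ss16 = ne lt du Dg_def oo oda oth_lt xa xo act4_def gg_def e1
    note ss = ne lt du Dg_def oo oda oth_lt xa xo othd othd2[OF _ 1(3)] othd2[OF _ 1(4)] act4_def M4_def un gg_def e1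
    note s2 = oo oda ww QQ t Qa tp_def hh_def field_simps sn_def gg_def
    consider "oth k" "oth l"
     | "oth k" "l = a"
     | "oth k" "l = b"
     | "k = a" "oth l"
     | "k = a" "l = a"
     | "k = a" "l = b"
     | "k = b" "oth l"
     | "k = b" "l = a"
     | "k = b" "l = b"
      using cls[of k] cls[of l] by argo
    note cs = this
    show ?case
    proof (cases rule: cs)
      case 9 then show ?thesis
        unfolding C0 C1 Mm_def[symmetric] by (simp add: ss16 m16; insert wab; auto simp: s2; simp add: numeral_eq_Suc)
    qed (unfold C0 C1, (simp add: ss; insert wab; auto simp: s2; simp add: numeral_eq_Suc)+)
  qed
qed

section \<open>The operator \<open>Rh\<close>: decomposition, support and symmetry under
  transposition\<close>

definition Rh :: "'a \<Rightarrow> 'a \<Rightarrow> nat \<Rightarrow> nat \<Rightarrow> nat \<Rightarrow> nat \<Rightarrow> 'a" where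
  "Rh z c = M4 (\<lambda>k l. (z - c) * (sn (od k) (od l) * Dg k l))
     (\<lambda>k l. hh * (z - c) / (z - 1) * (if k < l then z else 1))
     (\<lambda>k j. hh * gg k * (if k < j then z else c))"

lemma od_dl: "i \<in> {1..N} \<Longrightarrow> od (dl i) = od i" and tp_dl: "i \<in> {1..N} \<Longrightarrow> tp (dl i) = tp i"
  and dl_in: "i \<in> {1..N} \<Longrightarrow> dl i \<in> {1..N}"
  and w_dl: "i \<in> {1..N} \<Longrightarrow> w (dl i) = (if od i then - w i else w i)"
  and Q_dl: "i \<in> {1..N} \<Longrightarrow> Q (dl i) = 1 / Q i"
  using od_dual w_dual Q_dual by (auto simp: dl_def tp_def)

lemma intertwines_lincomb:
  assumes "intertwines M P U V x e" and "intertwines M' P U V x e"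
  shows "intertwines (\<lambda>i j k l. \<alpha> * M i j k l + \<beta> * M' i j k l) P U V x e"
  unfolding intertwines_def
proof (intro ballI)
  fix i j k l assume *: "i \<in> {1..N}" "j \<in> {1..N}" "k \<in> {1..N}" "l \<in> {1..N}"
  have s: "(\<Sum>r=1..N. (\<alpha> * f r + \<beta> * f' r) * g r) = \<alpha> * (\<Sum>r=1..N. f r * g r) + \<beta> * (\<Sum>r=1..N. f' r * g r)"
    "(\<Sum>r=1..N. g r * (\<alpha> * f r + \<beta> * f' r)) = \<alpha> * (\<Sum>r=1..N. g r * f r) + \<beta> * (\<Sum>r=1..N. g r * f' r)"
    for f f' g
    by (simp_all add: sum.distrib[symmetric] sum_distrib_left algebra_simps)
  have c: "A * (\<alpha> * X + \<beta> * X') + B * (\<alpha> * Y + \<beta> * Y') = A' * (\<alpha> * S + \<beta> * S') + B' * (\<alpha> * T + \<beta> * T')"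
    if "A * X + B * Y = A' * S + B' * T" "A * X' + B * Y' = A' * S' + B' * T'" for A B A' B' X X' Y Y' S S' T T'
  proof -
    have "A * (\<alpha> * X + \<beta> * X') + B * (\<alpha> * Y + \<beta> * Y') = \<alpha> * (A * X + B * Y) + \<beta> * (A * X' + B * Y')"
      by (simp add: algebra_simps)
    also have "\<dots> = A' * (\<alpha> * S + \<beta> * S') + B' * (\<alpha> * T + \<beta> * T')"
      unfolding that by (simp add: algebra_simps)
    finally show ?thesis .
  qed
  show "V * sn P (od k) * x k * (\<Sum>r=1..N. (\<alpha> * M i j k r + \<beta> * M' i j k r) * e r l)
     + U / x l * (\<Sum>r=1..N. (\<alpha> * M i j r l + \<beta> * M' i j r l) * e r k)
     = U * sn P (od i) * x i * (\<Sum>r=1..N. e j r * (\<alpha> * M i r k l + \<beta> * M' i r k l))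
     + V / x j * (\<Sum>r=1..N. e i r * (\<alpha> * M r j k l + \<beta> * M' r j k l))"
    unfolding s
    by (rule c[OF assms(1)[unfolded intertwines_def, rule_format, OF *] assms(2)[unfolded intertwines_def, rule_format, OF *]])
qed

lemma intertwines_ident: "intertwines (\<lambda>i j k l. ut k l i j) P 1 1 x e"
  unfolding intertwines_def
proof (intro ballI)
  fix i j k l assume *: "i \<in> {1..N}" "j \<in> {1..N}" "k \<in> {1..N}" "l \<in> {1..N}"
  have "(\<Sum>r=1..N. ut k r i j * e r l) = (if i = k then e j l else 0)"
    "(\<Sum>r=1..N. ut r l i j * e r k) = (if j = l then e i k else 0)"
    "(\<Sum>r=1..N. e j r * ut k l i r) = (if i = k then e j l else 0)"
    "(\<Sum>r=1..N. e i r * ut k l r j) = (if j = l then e i k else 0)"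
    using * by (simp_all add: ut_def if_distrib[of "\<lambda>y. y * _"] if_distrib[of "\<lambda>y. _ * y"] cong: if_cong)
  then show "1 * sn P (od k) * x k * (\<Sum>r=1..N. ut k r i j * e r l)
     + 1 / x l * (\<Sum>r=1..N. ut r l i j * e r k)
     = 1 * sn P (od i) * x i * (\<Sum>r=1..N. e j r * ut k l i r)
     + 1 / x j * (\<Sum>r=1..N. e i r * ut k l r j)"
    by auto
qed

text \<open>z / (z - 1) = 1 + 1 / (z - 1) splits the diagonal part and z = (z - c) + c the K part.
  The order cut-offs of S thus appear in \<open>Rh\<close> as z against 1 in the former and as z
  against c in the latter.\<close>

lemma Rh_decomp:
  assumes z: "z \<noteq> 1"
  shows "Rh z c i j k l = 1 * ((z - c) * S i j k l + (hh * (z - c) / (z - 1)) * ut k l i j) + (- hh * c) * Kt i j k l"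
proof -
  have B: "hh * (z - c) / (z - 1) * (if k < l then z else 1) = (z - c) * (if k < l then hh else 0) + hh * (z - c) / (z - 1)"
    using z by (simp add: field_simps)
  have 2: "hh * g * z * w' / q' = (z - c) * (hh * g * w' / q') + hh * c * (g * w' / q')"
    "hh * g * c * w' / q' = hh * c * (g * w' / q')" for g w' q'
    by (simp_all add: diff_divide_distrib add_divide_distrib algebra_simps)
  have Z: "(if l = dl k \<and> j = dl i then hh * gg k * (if k < j then z else c) * w i / Q i else 0)
      = (z - c) * (if l = dl k \<and> j = dl i then (if k < j then hh * gg k else 0) * w i / Q i else 0)
        - hh * c * (if l = dl k \<and> j = dl i then - gg k * w i / Q i else 0)"
    by (cases "k < j"; cases "l = dl k \<and> j = dl i") (simp_all only: 2 if_True if_False, simp_all)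
  have r: "\<alpha> * A * u1 + (\<alpha> * B' + \<beta>) * u2 - (\<alpha> * C - h * h' * D) = 1 * (\<alpha> * (A * u1 + B' * u2 - C) + \<beta> * u2) + (- h * h') * (0 * u1 + 0 * u2 - D)"
    for \<alpha> \<beta> h h' A B' C D u1 u2 :: 'a
    by (simp add: algebra_simps)
  show ?thesis
    unfolding Rh_def S_def Kt_def M4_def B Z by (rule r)
qed

lemma Rh_intertwinesI:
  assumes z: "z \<noteq> 1" and S: "intertwines S P 1 1 x e" and K: "intertwines Kt P 1 1 x e"
  shows "intertwines (Rh z c) P 1 1 x e"
proof -
  have "Rh z c = (\<lambda>i j k l. 1 * ((z - c) * S i j k l + (hh * (z - c) / (z - 1)) * ut k l i j) + (- hh * c) * Kt i j k l)"
    by (intro ext Rh_decomp z)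
  then show ?thesis
    using intertwines_lincomb[OF intertwines_lincomb[OF S intertwines_ident, where \<alpha> = "z - c" and \<beta> = "hh * (z - c) / (z - 1)"] K,
        where \<alpha> = 1 and \<beta> = "- hh * c"]
    by (simp only:)
qed

lemma Dg_commute: "k \<in> {1..N} \<Longrightarrow> l \<in> {1..N} \<Longrightarrow> Dg k l = Dg l k"
  unfolding Dg_def using dl_dl tp_dl by auto

lemma Rh_commute:
  assumes ijkl: "i \<in> {1..N}" "j \<in> {1..N}" "k \<in> {1..N}" "l \<in> {1..N}"
  shows "Rh z c k l i j = sn (od i) (od j) * sn (od k) (od l) * Rh z c i j k l"
proof -
  have 1: "A i j * ut j i k l = sn (od i) (od j) * sn (od k) (od l) * (A k l * ut l k i j)"
    if "A i j = A j i" for A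
    using that by (auto simp: ut_def sn_def)
  have 2: "B i j * ut i j k l = sn (od i) (od j) * sn (od k) (od l) * (B k l * ut k l i j)" for B
    by (auto simp: ut_def sn_def)
  have 3: "(if j = dl i \<and> l = dl k then hh * gg i * (if i < l then z else c) * w k / Q k else 0)
      = sn (od i) (od j) * sn (od k) (od l) * (if l = dl k \<and> j = dl i then hh * gg k * (if k < j then z else c) * w i / Q i else 0)"
  proof (cases "j = dl i \<and> l = dl k")
    case True
    \<comment> \<open>Here l = k' and j = i', and i < k' is equivalent to k < i': the cut-off
      survives transposition.\<close>
    then have "(i < l) = (k < j)" using ijkl by (auto simp: dl_def)
    moreover have "od j = od i" "od l = od k" using True od_dl ijkl by auto
    ultimately show ?thesis using True by (auto simp: gg_def sn_def mult_ac)
  qed auto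
  have D: "(z - c) * (sn (od i) (od j) * Dg i j) = (z - c) * (sn (od j) (od i) * Dg j i)"
    using Dg_commute[OF ijkl(1,2)] by (simp add: sn_def)
  have r: "A' + B' - C' = g * g' * (A + B - C)" if "A' = g * g' * A" "B' = g * g' * B" "C' = g * g' * C"
    for A B C A' B' C' g g' :: 'a
    unfolding that by (simp add: algebra_simps)
  show ?thesis
    unfolding Rh_def M4_def
    by (rule r, rule 1[of "\<lambda>k l. (z - c) * (sn (od k) (od l) * Dg k l)", OF D],
        rule 2[of "\<lambda>k l. hh * (z - c) / (z - 1) * (if k < l then z else 1)"], rule 3)
qed

lemma Rh_support:
  assumes "Rh z c i j k l \<noteq> 0"
  shows "(i = l \<and> j = k) \<or> (i = k \<and> j = l) \<or> (l = dl k \<and> j = dl i)"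
proof (rule ccontr)
  assume "\<not> ?thesis"
  then have h: "ut l k i j = 0" "ut k l i j = 0" "(l = dl k \<and> j = dl i) = False" by (auto simp: ut_def)
  have "Rh z c i j k l = 0" unfolding Rh_def M4_def h by simp
  then show False using assms by contradiction
qed

lemma Rh_parity:
  assumes "i \<in> {1..N}" "j \<in> {1..N}" "k \<in> {1..N}" "l \<in> {1..N}" and "Rh z c i j k l \<noteq> 0"
  shows "(od i = od j) = (od k = od l)"
  using Rh_support[OF assms(5)] od_dl[OF assms(1)] od_dl[OF assms(3)] by auto

lemma root_mat_parity:
  assumes "a \<in> {1..N}" "b \<in> {1..N}" and "root_mat a b r l \<noteq> 0"
  shows "(od a \<noteq> od b) = (od r \<noteq> od l)"
proof -
  have "(r = a \<and> l = b) \<or> (r = dl b \<and> l = dl a)"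
  proof (rule ccontr)
    assume "\<not> ?thesis"
    then have h: "(r = a \<and> l = b) = False" "(r = dl b \<and> l = dl a) = False" by auto
    have "root_mat a b r l = 0" unfolding root_mat_def h by simp
    then show False using assms(3) by contradiction
  qed
  then show ?thesis using od_dl[OF assms(1)] od_dl[OF assms(2)] by auto
qed

text \<open>The sign on the left is the one produced by \<open>intertwines_transpose\<close>; up to
  a constant sign, the supertranspose of \<open>X_ab\<close> is \<open>X_ba\<close>.\<close>

lemma root_mat_transpose:
  assumes "a \<in> {1..N}" "b \<in> {1..N}"
  shows "sn (od a \<noteq> od b) (od r) * root_mat a b l r = sn (od b) (od a \<noteq> od b) * root_mat b a r l"
proof -
  have "sn (od a \<noteq> od b) (od r) * (if l = a \<and> r = b then 1 else 0) = sn (od b) (od a \<noteq> od b) * (if r = b \<and> l = a then 1 else 0)"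
    by (simp add: sn_def)
  moreover have "sn (od a \<noteq> od b) (od r) * (if l = dl b \<and> r = dl a then sn (od a) (od a \<noteq> od b) * w a * w b else 0)
      = sn (od b) (od a \<noteq> od b) * (if r = dl a \<and> l = dl b then sn (od b) (od b \<noteq> od a) * w b * w a else 0)"
    using od_dl[OF assms(1)] by (simp add: sn_def mult.commute)
  ultimately show ?thesis unfolding root_mat_def by (simp only: right_diff_distrib)
qed

text \<open>Since eps_a - eps_b = eps_b' - eps_a', both pairs of indices name the same root vector
  up to a scalar.\<close>

lemma root_mat_dual:
  assumes "a \<in> {1..N}" "b \<in> {1..N}"
  shows "root_mat (dl b) (dl a) r l = - (sn (od a) (od a \<noteq> od b) * w a * w b) * root_mat a b r l"
proof -
  have od: "od (dl a) = od a" "od (dl b) = od b" and dd: "dl (dl a) = a" "dl (dl b) = b"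
    using od_dl dl_dl assms by auto
  let ?g = "sn (od a) (od a \<noteq> od b) * w a * w b"
  have g: "sn (od b) (od b \<noteq> od a) * w (dl b) * w (dl a) * x = ?g * x" "?g * ?g = 1" for x
    using w[OF assms(1)] w[OF assms(2)] unfolding w_dl[OF assms(1)] w_dl[OF assms(2)] sn_def
    by (cases "od a"; cases "od b"; auto)+
  have "root_mat (dl b) (dl a) r l = (if r = dl b \<and> l = dl a then 1 else 0) - ?g * (if r = a \<and> l = b then 1 else 0)"
    unfolding root_mat_def od dd using g(1)[of 1] by (simp only: mult_1_right) simp
  also have "\<dots> = - ?g * ((if r = a \<and> l = b then 1 else 0) - (if r = dl b \<and> l = dl a then ?g else 0))"
    using g(2) by (simp add: right_diff_distrib mult.assoc)
  finally show ?thesis unfolding root_mat_def .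
qed

lemma intertwines_scale:
  assumes M: "intertwines M P U V x e"
    and e: "\<And>r l. r \<in> {1..N} \<Longrightarrow> l \<in> {1..N} \<Longrightarrow> e' r l = \<alpha> * e r l"
    and x: "\<And>r. r \<in> {1..N} \<Longrightarrow> x' r = x r"
  shows "intertwines M P U V x' e'"
  unfolding intertwines_def
proof (intro ballI)
  fix i j k l assume *: "i \<in> {1..N}" "j \<in> {1..N}" "k \<in> {1..N}" "l \<in> {1..N}"
  have s: "(\<Sum>r=1..N. f r * e' r c) = \<alpha> * (\<Sum>r=1..N. f r * e r c)"
    "(\<Sum>r=1..N. e' c r * f r) = \<alpha> * (\<Sum>r=1..N. e c r * f r)" if "c \<in> {1..N}" for f c
    unfolding sum_distrib_left using e that by (auto intro!: sum.cong)
  have c: "A * (\<alpha> * X) + B * (\<alpha> * Y) = A' * (\<alpha> * S) + B' * (\<alpha> * T)"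
    if "A * X + B * Y = A' * S + B' * T" for A B A' B' X Y S T
  proof -
    have "A * (\<alpha> * X) + B * (\<alpha> * Y) = \<alpha> * (A * X + B * Y)" by (simp add: algebra_simps)
    also have "\<dots> = A' * (\<alpha> * S) + B' * (\<alpha> * T)" unfolding that by (simp add: algebra_simps)
    finally show ?thesis .
  qed
  show "V * sn P (od k) * x' k * (\<Sum>r=1..N. M i j k r * e' r l)
     + U / x' l * (\<Sum>r=1..N. M i j r l * e' r k)
     = U * sn P (od i) * x' i * (\<Sum>r=1..N. e' j r * M i r k l)
     + V / x' j * (\<Sum>r=1..N. e' i r * M r j k l)"
    unfolding s(1)[OF *(4)] s(1)[OF *(3)] s(2)[OF *(2)] s(2)[OF *(1)] x[OF *(1)] x[OF *(2)] x[OF *(3)] x[OF *(4)]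
    by (rule c[OF M[unfolded intertwines_def, rule_format, OF *]])
qed

lemma Rh_intertwines_transpose:
  assumes a: "a \<in> {1..N}" "b \<in> {1..N}"
    and M: "intertwines (Rh z c) (od a \<noteq> od b) U V x (root_mat a b)"
  shows "intertwines (Rh z c) (od a \<noteq> od b) V U x (root_mat b a)"
proof -
  have *: "intertwines (Rh z c) (od a \<noteq> od b) V U x (\<lambda>r l. sn (od a \<noteq> od b) (od r) * root_mat a b l r)"
    by (rule intertwines_transpose[OF M]) (fact Rh_commute, fact Rh_parity, rule root_mat_parity[OF a])
  show ?thesis
    by (rule intertwines_scale[OF *, where \<alpha> = "sn (od b) (od a \<noteq> od b)"])
      (simp_all only: root_mat_transpose[OF a] mult.assoc[symmetric] sn_sq mult_1_left)
qed

text \<open>The root vector joins the two extreme indices, so every other index lies between them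
  and the cut-offs at a and b are opposite. This mixes the summands of \<open>Rh\<close>; they
  balance because the first spectral factor is z times the second and because c q^(2 (rho, eps_1)) =
  q^2.\<close>

lemma Rh_affine_long:
  assumes b: "b = 1" and aN: "a = dl b" and N: "N > 1"
    and odb: "od b" and c: "c * (Q b)\<^sup>2 = t ^ 4" and z: "z \<noteq> 1" "z \<noteq> 0" and V: "V \<noteq> 0"
  shows "intertwines (Rh z c) (od a \<noteq> od b) (z * V) V (root_wt a b) (root_mat a b)"
proof -
  have bN: "b \<in> {1..N}" and a: "a \<in> {1..N}" using N b aN by (auto simp: dl_def)
  have du: "dl a = b" "dl b = a"
    using bN aN by (auto simp: dl_dl)
  have ne: "a \<noteq> b" "b \<noteq> a" and lt: "b < a" "\<not> a < b"
    using N b aN by (auto simp: dl_def)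
  have oo: "od a" and ww: "w a = - w b" and QQ: "Q a = 1 / Q b" and qn: "Q b \<noteq> 0"
    using od_dual[OF bN] w_dual[OF bN] Q_dual[OF bN] Q[OF bN] odb unfolding aN dl_def by auto
  have wab: "w b = 1 \<or> w b = -1" using w[OF bN] by auto
  define oth where "oth x \<longleftrightarrow> x \<noteq> a \<and> x \<noteq> b \<and> x \<in> {1..N}" for x
  have oth_lt: "oth x \<Longrightarrow> x < b \<longleftrightarrow> False" "oth x \<Longrightarrow> b < x \<longleftrightarrow> True"
    "oth x \<Longrightarrow> x < a \<longleftrightarrow> True" "oth x \<Longrightarrow> a < x \<longleftrightarrow> False" for x
    using aN b by (auto simp: oth_def dl_def)
  have cls: "x = a \<or> x = b \<or> oth x" if "x \<in> {1..N}" for x using that unfolding oth_def by blast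
  have othd: "x \<noteq> a" "x \<noteq> b" "a \<noteq> x" "b \<noteq> x" if "oth x" for x
    using that unfolding oth_def by auto
  have othd2: "a \<noteq> dl x" "b \<noteq> dl x" "dl x \<noteq> a" "dl x \<noteq> b" if "oth x" "x \<in> {1..N}" for x
    using that b aN unfolding oth_def dl_def by auto
  have xa: "root_wt a b a = 1 / t\<^sup>2" "root_wt a b b = t\<^sup>2"
    and xo: "oth r \<Longrightarrow> root_wt a b r = 1" for r
    using ne t odb oo unfolding root_wt_def du oth_def by (auto simp: tp_def power2_eq_square)
  have cQ: "c = t ^ 4 / (Q b)\<^sup>2" using c qn by (simp add: field_simps)
  define \<alpha> \<beta> where "\<alpha> = z - c" and "\<beta> = hh * \<alpha> / (z - 1)"
  show ?thesis unfolding Rh_def \<alpha>_def[symmetric] \<beta>_def[symmetric]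
  proof (rule intertwines_M4I[OF a bN refl], goal_cases)
    case (1 i j k l u)
    have un: "ut r y i j = u r y" for r y using 1 by simp
    let ?P = "od a \<noteq> od b" and ?e = "sn (od a) (od a \<noteq> od b) * w a * w b"
    have e1: "?e = -1" "sn ?P x = 1" for x using wab odb oo by (auto simp: sn_def ww)
    have kb: "\<not> k < b" "k < a \<longleftrightarrow> k \<noteq> a" using 1(3) b aN by (auto simp: dl_def)
    \<comment> \<open>The first term carries z V times c, the second V times z, and the hypothesis
      on c cancels them. Only at k = a does the cut-off put c in place of z in the second term,
      which leaves a multiple of z - c.\<close>
    have C0: "z * V * sn ?P (od b) * root_wt a b (dl b) * (hh * gg k * (if k < b then z else c) * w (dl b) / Q (dl b))
               - ?e * (V / root_wt a b a) * (hh * gg k * (if k < a then z else c) * w (dl a) / Q (dl a))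
        = (if k = a then - (V * hh * \<alpha> * t\<^sup>2) else 0)"
      unfolding e1 unfolding xa du QQ ww cQ \<alpha>_def using t kb qn wab by (auto simp: gg_def oo sn_def QQ ww field_simps; simp add: numeral_eq_Suc)
    have C1: "V / root_wt a b (dl b) * (hh * gg k * (if k < dl b then z else c) * w b / Q b)
               - ?e * (z * V * sn ?P (od a) * root_wt a b a) * (hh * gg k * (if k < dl a then z else c) * w a / Q a)
        = (if k = a then - (V * hh * \<alpha> * t\<^sup>2) else 0)"
      unfolding e1 unfolding xa du QQ ww cQ \<alpha>_def using t kb qn wab by (auto simp: gg_def oo sn_def QQ ww field_simps; simp add: numeral_eq_Suc)
    have un2: "u r y = (if i = r \<and> j = y then 1 else 0)" for r y using 1(5) by (simp add: ut_def)
    define F where "F = (if j = dl i then hh * w i / Q i else 0)"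
    let ?M = "M4 (\<lambda>k l. \<alpha> * (sn (od k) (od l) * Dg k l))
     (\<lambda>k l. \<beta> * (if k < l then z else 1))
     (\<lambda>k j. hh * gg k * (if k < j then z else c))"
    have F: "(if j = dl i then hh * gg a * (if a < j then z else c) * w i / Q i else 0) = gg a * c * F"
      "(if j = dl i then hh * gg b * (if b < j then z else c) * w i / Q i else 0) = gg b * (z * F + (c - z) * hh * w a / Q a * u a b)"
      using 1(1,2) aN b unfolding F_def un2 by (auto simp: dl_def algebra_simps diff_divide_distrib)
    define Mm where "Mm = ?M"
    have m: "Mm i j c' (dl c') = \<alpha> * (sn (od c') (od (dl c')) * Dg c' (dl c')) * u (dl c') c'
        + \<beta> * (if c' < dl c' then z else 1) * u c' (dl c')
        - (if j = dl i then hh * gg c' * (if c' < j then z else c) * w i / Q i else 0)" for c'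
      unfolding Mm_def M4_def un by simp
    have m16: "Mm i j a b = - (\<alpha> * Dg a b * u b a) + \<beta> * u a b - gg a * c * F"
      "Mm i j b a = - (\<alpha> * Dg b a * u a b) + \<beta> * z * u b a - gg b * (z * F + (c - z) * hh * w a / Q a * u a b)"
      using m[of a] m[of b] unfolding du F by (simp_all add: lt odb oo sn_def)
    define s T where "s = 1 / t\<^sup>2" and "T = t\<^sup>2"
    have xs: "root_wt a b a = s" "root_wt a b b = T" "t\<^sup>2 = T"
      and Ds: "Dg a a = s" "Dg b b = s" "Dg a b = T" "Dg b a = T"
      and div: "y / s = y * T" "y / T = y * s" for y
      using ne odb oo t by (auto simp: xa s_def T_def Dg_def du tp_def field_simps)
    have hs: "hh = T - s" and sTc: "T * s = 1" and sT': "T * (V * (s * y)) = V * y" for y using t by (auto simp: s_def T_def hh_def)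
    have \<beta>: "\<beta> * (z - 1) = hh * \<alpha>" using z by (simp add: \<beta>_def)
    \<comment> \<open>The relation between the flip coefficient \<open>\<alpha>\<close> and the
      diagonal coefficient \<open>\<beta>\<close> that couples the summands; T and s stand for q and
      1/q.\<close>
    have \<beta>': "\<beta> * z = \<beta> + (T - s) * \<alpha>" using \<beta> unfolding hs by (simp add: algebra_simps)
    have gg1: "gg b * (w a / Q a) = 1" "gg a * c = - (gg b * T * T)"
      using wab qn by (auto simp: gg_def oo odb sn_def QQ ww cQ T_def power2_eq_square numeral_eq_Suc)
    have m16': "Mm i j a b = - (\<alpha> * T * u b a) + \<beta> * u a b - (gg a * c) * F"
      "Mm i j b a = - (\<alpha> * T * u a b) + \<beta> * z * u b a - gg b * z * F + \<alpha> * hh * u a b"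
    proof -
      show "Mm i j a b = - (\<alpha> * T * u b a) + \<beta> * u a b - (gg a * c) * F" unfolding m16 Ds by simp
      have "Mm i j b a = - (\<alpha> * T * u a b) + \<beta> * z * u b a - gg b * z * F - (gg b * (w a / Q a)) * (c - z) * hh * u a b"
        unfolding m16 Ds by (simp add: algebra_simps)
      then show "Mm i j b a = - (\<alpha> * T * u a b) + \<beta> * z * u b a - gg b * z * F + \<alpha> * hh * u a b"
        unfolding gg1 by (simp add: \<alpha>_def algebra_simps)
    qed
    note ss = ne lt du oth_lt xo othd othd2[OF _ 1(3)] othd2[OF _ 1(4)] act4_def M4_def un e1
    have wm: "w a * w b = -1" using wab ww by auto
    note ssO = ne lt du Dg_def oo odb oth_lt xa xo othd othd2[OF _ 1(3)] othd2[OF _ 1(4)] act4_def M4_def un gg_def e1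
    note s3 = ww sn_def z V add_divide_distrib diff_divide_distrib
    note s4 = xs Ds div oo odb sn_def
    consider "oth k" "oth l"
     | "oth k" "l = a"
     | "oth k" "l = b"
     | "k = a" "oth l"
     | "k = a" "l = a"
     | "k = a" "l = b"
     | "k = b" "oth l"
     | "k = b" "l = a"
     | "k = b" "l = b"
      using cls[OF 1(3)] cls[OF 1(4)] by argo
    note cs = this
    show ?case
    proof (cases rule: cs)
      case 5 then show ?thesis unfolding C0 C1 by (simp add: ss)
    next
      case 6 then show ?thesis
        unfolding C0 C1 using arg_cong[OF \<beta>', of "\<lambda>y. V * s * (2 * u a a) * y"]
        by (simp add: ss s4 wm; simp add: hs algebra_simps)
    next
      case 8 then show ?thesis unfolding C0 C1 by (simp add: ss s4 wm; simp add: algebra_simps)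
    next
      case 9 then show ?thesis
        unfolding C0 C1 Mm_def[symmetric] using arg_cong[OF \<beta>', of "\<lambda>y. V * s * (2 * u a b) * y"]
        by (simp add: ne lt du act4_def e1 m16' gg1 s4 wm; simp add: hs sT' sTc algebra_simps)
    qed (unfold C0 C1, (simp add: ssO; simp add: s3 algebra_simps)+)
  qed
qed

text \<open>The exchanged vectors are adjacent, so only their mutual order changes. This affects
  only the diagonal entries at (a, b) and (b, a), where the diagonal part and the K part overlap;
  their changes compensate by \<open>\<beta>\<close>.\<close>

lemma Rh_swap_middle:
  assumes a: "a \<in> {1..N}" "dl a = b" "b = a + 1" "\<not> od a" "Q a = 1" and z: "z \<noteq> 1"
    and \<pi>: "\<pi> = (\<lambda>x. if x = a then b else if x = b then a else x)"
    and ijkl: "i \<in> {1..N}" "j \<in> {1..N}" "k \<in> {1..N}" "l \<in> {1..N}"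
  shows "Rh z c (\<pi> i) (\<pi> j) (\<pi> k) (\<pi> l) = Rh z c i j k l"
proof -
  have da: "dl b = a" using dl_dl[OF a(1)] a(2) by simp
  have ab: "a \<noteq> b" "b \<noteq> a" "a < b" "\<not> b < a" using a(3) by auto
  have inj: "\<pi> x = \<pi> y \<longleftrightarrow> x = y" for x y by (auto simp: \<pi>)
  have odp: "od (\<pi> x) = od x" for x using od_dl[OF a(1)] a by (auto simp: \<pi>)
  have w1: "w b = w a" and Q1: "Q b = 1" and ww: "w a * w a = 1"
    using w_dl[OF a(1)] Q_dl[OF a(1)] a w[OF a(1)] by auto
  have wp: "w (\<pi> x) = w x" "Q (\<pi> x) = Q x" for x using w1 Q1 a by (auto simp: \<pi>)
  have dlp: "\<pi> x = dl (\<pi> y) \<longleftrightarrow> x = dl y" if "x \<in> {1..N}" "y \<in> {1..N}" for x y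
    using that da a dl_dl dl_in unfolding \<pi> by (smt (verit, best))
  have tpp: "tp (\<pi> x) = tp x" "gg (\<pi> x) = gg x" for x by (simp_all add: tp_def gg_def odp wp)
  have Dp: "Dg (\<pi> k) (\<pi> l) = Dg k l" unfolding Dg_def dlp[OF ijkl(4,3)] inj tpp ..
  have up: "ut (\<pi> x) (\<pi> y) (\<pi> i) (\<pi> j) = ut x y i j" for x y by (simp add: ut_def inj)
  have lt: "\<pi> x < \<pi> y \<longleftrightarrow> x < y" if "\<not> (x = a \<and> y = b)" "\<not> (x = b \<and> y = a)" for x y
    using that a(3) by (auto simp: \<pi>)
  define \<beta> where "\<beta> = hh * (z - c) / (z - 1)"
  have \<beta>: "\<beta> * (z - 1) = hh * (z - c)" using z by (simp add: \<beta>_def)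
  show ?thesis
  proof (cases "(i = k \<and> j = l) \<and> ((k = a \<and> l = b) \<or> (k = b \<and> l = a))")
    case True
    have g: "gg a * w a = 1" "gg b * w b = 1"
      using a od_dl[OF a(1)] ww w1 Q1 by (auto simp: gg_def sn_def)
    have g': "hh * gg a * y * w a = hh * y" "hh * gg b * y * w b = hh * y" for y
      using arg_cong[OF g(1), of "\<lambda>x. hh * y * x"] arg_cong[OF g(2), of "\<lambda>x. hh * y * x"] by (simp_all add: mult_ac)
    have eq: "\<beta> * z - hh * z = \<beta> - hh * c" using \<beta> by (simp add: algebra_simps)
    from True show ?thesis
    proof (elim conjE disjE)
      assume "i = k" "j = l" "k = a" "l = b"
      then show ?thesis using eq da a(2) unfolding Rh_def M4_def Dp \<beta>_def[symmetric]
        by (simp add: \<pi> ut_def g' a(5) Q1 ab)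
    next
      assume "i = k" "j = l" "k = b" "l = a"
      then show ?thesis using eq da a(2) unfolding Rh_def M4_def Dp \<beta>_def[symmetric]
        by (simp add: \<pi> ut_def g' a(5) Q1 ab)
    qed
  next
    case False
    have B: "(if \<pi> k < \<pi> l then z else 1) * ut k l i j = (if k < l then z else 1) * ut k l i j"
      using False lt[of k l] by (auto simp: ut_def)
    have Z: "(if l = dl k \<and> j = dl i then hh * gg k * (if \<pi> k < \<pi> j then z else c) * w i / Q i else 0)
       = (if l = dl k \<and> j = dl i then hh * gg k * (if k < j then z else c) * w i / Q i else 0)"
    proof (cases "l = dl k \<and> j = dl i")
      case True
      have "\<not> (k = a \<and> j = b)" "\<not> (k = b \<and> j = a)"
        using False True a(2) da ijkl dl_dl by metis+
      then have "(\<pi> k < \<pi> j) = (k < j)" by (rule lt)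
      then show ?thesis by (simp only:)
    qed auto
    show ?thesis
      unfolding Rh_def M4_def Dp up odp dlp[OF ijkl(4,3)] dlp[OF ijkl(2,1)] tpp wp Z
      using arg_cong[OF B, of "\<lambda>x. hh * (z - c) / (z - 1) * x"] by (simp only: mult.assoc)
  qed
qed

text \<open>Exchanging v_1 and v_N reverses their order relative to every index, which trades z for
  1 in the diagonal part and z for c in the K part. The weights \<open>\<gamma>\<close> repair the
  former because u = z v; for the latter c \<open>Q_1\<close>^2 = 1 is needed as well, since it
  makes the coefficients at v_1 and v_N differ by the factor c.\<close>

lemma Rh_swap_affine:
  assumes N: "N > 1" and b: "b = 1" and ev: "\<not> od b" and c: "c * (Q b)\<^sup>2 = 1" and u: "u \<noteq> 0" "v \<noteq> 0" "u \<noteq> v" and z: "z = u / v"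
    and \<pi>: "\<pi> = (\<lambda>x. if x = b then N else if x = N then b else x)"
    and \<gamma>: "\<gamma> = (\<lambda>y x. if x = b then y else if x = N then 1 / y else (1::'a))"
    and ijkl: "i \<in> {1..N}" "j \<in> {1..N}" "k \<in> {1..N}" "l \<in> {1..N}"
  shows "Rh z c (\<pi> i) (\<pi> j) (\<pi> k) (\<pi> l) * (\<gamma> u k * \<gamma> v l) = \<gamma> v i * \<gamma> u j * Rh z c i j k l"
proof -
  have one: "b \<in> {1..N}" and d: "dl b = N" "dl N = b" and bN: "b \<noteq> N" "N \<noteq> b" "b < N" "\<not> N < b" using N b by (auto simp: dl_def)
  have inj: "\<pi> x = \<pi> y \<longleftrightarrow> x = y" for x y by (auto simp: \<pi>)
  have odN: "\<not> od N" and wN: "w N = w b" and QN: "Q N = 1 / Q b" and ww: "w b * w b = 1" and qn: "Q b \<noteq> 0"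
    using od_dl[OF one] w_dl[OF one] Q_dl[OF one] ev w[OF one] Q[OF one] d by auto
  have odp: "od (\<pi> x) = od x" for x using ev odN by (auto simp: \<pi>)
  have dlp: "\<pi> x = dl (\<pi> y) \<longleftrightarrow> x = dl y" if "x \<in> {1..N}" "y \<in> {1..N}" for x y
    using that N b unfolding \<pi> dl_def by auto
  have tpp: "tp (\<pi> x) = tp x" for x by (simp add: tp_def odp)
  have Dp: "Dg (\<pi> k) (\<pi> l) = Dg k l" unfolding Dg_def dlp[OF ijkl(4,3)] inj tpp ..
  have up: "ut (\<pi> x) (\<pi> y) (\<pi> i) (\<pi> j) = ut x y i j" for x y by (simp add: ut_def inj)
  have z01: "z \<noteq> 0" "z \<noteq> 1" using u z by auto
  define \<beta> where "\<beta> = hh * (z - c) / (z - 1)"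
  have \<beta>: "\<beta> * (z - 1) = hh * (z - c)" using z01 by (simp add: \<beta>_def)
  have cQ: "c = 1 / (Q b)\<^sup>2" using c qn by (simp add: field_simps)
  define G where "G = \<gamma> u k * \<gamma> v l"
  define G' where "G' = \<gamma> v i * \<gamma> u j"
  define Z where "Z x y = hh * gg x * (if x < dl y then z else c) * w y / Q y" for x y
  have gg1: "gg b = w b / Q b" "gg N = w b * Q b" using ev odN by (simp_all add: gg_def sn_def wN QN)
  have A: "f * ut l k i j * G = G' * (f * ut l k i j)" for f
    by (auto simp: ut_def G_def G'_def)
  have r: "(X + Y - W) * G = G' * (X' + Y' - W')" if "X * G = G' * X'" "Y * G = G' * Y'" "W * G = G' * W'" for X Y W X' Y' W'
    using that by (simp add: algebra_simps)
  have r2: "(X + Y - W) * G = G' * (X' + Y' - W')" if "X * G = G' * X'" "(Y - W) * G = G' * (Y' - W')" for X Y W X' Y' W'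
    using that by (simp add: algebra_simps)
  have Z0: "(if l = dl k \<and> j = dl i then hh * gg x * (if x < j' then z else c) * w y / Q y else 0)
     = (if l = dl k \<and> j = dl i then Z x y else 0)" if "j = dl i \<Longrightarrow> j' = dl y" for x y j'
    using that by (auto simp: Z_def)
  have Zp: "(if l = dl k \<and> j = dl i then hh * gg (\<pi> k) * (if \<pi> k < \<pi> j then z else c) * w (\<pi> i) / Q (\<pi> i) else 0)
     = (if l = dl k \<and> j = dl i then Z (\<pi> k) (\<pi> i) else 0)"
    by (rule Z0) (use dlp[OF ijkl(2,1)] in simp)
  have Zn: "(if l = dl k \<and> j = dl i then hh * gg k * (if k < j then z else c) * w i / Q i else 0)
     = (if l = dl k \<and> j = dl i then Z k i else 0)"
    by (rule Z0) simp
  show ?thesis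
    unfolding Rh_def M4_def Dp up odp dlp[OF ijkl(4,3)] dlp[OF ijkl(2,1)] Zp Zn G_def[symmetric] G'_def[symmetric] \<beta>_def[symmetric]
  \<comment> \<open>In the diagonal entries at (1, N) and (N, 1) the diagonal part and the K part
    contribute together and are invariant only in combination. In all other entries each part is
    invariant by itself.\<close>
  proof (cases "i = k \<and> j = l \<and> l = dl k \<and> (k = b \<or> k = N)")
    case True
    have ZZ: "Z b b = hh * z * c" "Z N N = hh" using N wN QN ww qn bN
      by (auto simp: Z_def gg1 d cQ power2_eq_square field_simps)
    have eq: "\<beta> * z = hh * (z - c) + \<beta>" using \<beta> by (simp add: algebra_simps)
    have "(\<beta> * (if \<pi> k < \<pi> l then z else 1) * ut k l i j - (if l = dl k \<and> j = dl i then Z (\<pi> k) (\<pi> i) else 0)) * G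
       = G' * (\<beta> * (if k < l then z else 1) * ut k l i j - (if l = dl k \<and> j = dl i then Z k i else 0))"
    proof (cases "k = b")
      case k: True
      then have e: "i = b" "j = N" "l = N" "G = z" "G' = 1 / z" using True d bN u z by (auto simp: G_def G'_def \<gamma>)
      have "(\<beta> - hh) * z = 1 / z * (\<beta> * z - hh * z * c)" using z01 eq by (simp add: algebra_simps)
      then show ?thesis using bN e k by (simp add: \<pi> ut_def ZZ d)
    next
      case k: False
      then have e: "i = N" "j = b" "l = b" "k = N" "G' = z" "G = 1 / z" using True d bN u z by (auto simp: G_def G'_def \<gamma>)
      have "(\<beta> * z - hh * z * c) * (1 / z) = z * (\<beta> - hh)" using z01 eq by (simp add: algebra_simps)
      then show ?thesis using bN e k by (simp add: \<pi> ut_def ZZ d)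
    qed
    then show "((z - c) * (sn (od k) (od l) * Dg k l) * ut l k i j + \<beta> * (if \<pi> k < \<pi> l then z else 1) * ut k l i j
        - (if l = dl k \<and> j = dl i then Z (\<pi> k) (\<pi> i) else 0)) * G
      = G' * ((z - c) * (sn (od k) (od l) * Dg k l) * ut l k i j + \<beta> * (if k < l then z else 1) * ut k l i j
        - (if l = dl k \<and> j = dl i then Z k i else 0))"
      by (rule r2[OF A])
  next
    case False
    have B: "\<beta> * (if \<pi> k < \<pi> l then z else 1) * ut k l i j * G = G' * (\<beta> * (if k < l then z else 1) * ut k l i j)"
    proof (cases "i = k \<and> j = l")
      case True
      then have nd: "\<not> (k = b \<and> l = N)" "\<not> (k = N \<and> l = b)" using False d by auto
      have kl: "b \<le> k" "k \<le> N" "b \<le> l" "l \<le> N" using ijkl b by auto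
      have "(if \<pi> k < \<pi> l then z else 1) * G = G' * (if k < l then z else 1)"
      proof -
        have uz: "u = z * v" using z u by simp
        have \<pi>o: "\<pi> b = N" "\<pi> N = b" "x \<noteq> b \<Longrightarrow> x \<noteq> N \<Longrightarrow> \<pi> x = x" for x using bN by (auto simp: \<pi>)
        have \<gamma>o: "\<gamma> y b = y" "\<gamma> y N = 1 / y" "x \<noteq> b \<Longrightarrow> x \<noteq> N \<Longrightarrow> \<gamma> y x = 1" for x y using bN by (auto simp: \<gamma>)
        have ik: "G = \<gamma> u k * \<gamma> v l" "G' = \<gamma> v k * \<gamma> u l" using True by (simp_all add: G_def G'_def)
        have o: "x \<noteq> b \<Longrightarrow> b \<le> x \<Longrightarrow> b < x" "x \<noteq> N \<Longrightarrow> x \<le> N \<Longrightarrow> x < N" for x by auto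
        consider "k \<noteq> b" "k \<noteq> N" "l \<noteq> b" "l \<noteq> N" | "k = l" | "k = b" "l \<noteq> b" "l \<noteq> N" | "k = N" "l \<noteq> b" "l \<noteq> N"
          | "k \<noteq> b" "k \<noteq> N" "l = b" | "k \<noteq> b" "k \<noteq> N" "l = N" using nd by argo
        then show ?thesis
        proof cases
          case 1 then show ?thesis by (simp add: ik \<pi>o \<gamma>o)
        next case 2 then show ?thesis by (simp add: ik)
        next case 3 then show ?thesis using o[of l] kl by (simp add: ik \<pi>o \<gamma>o uz)
        next case 4 then show ?thesis using o[of l] kl u z01 by (simp add: ik \<pi>o \<gamma>o uz)
        next case 5 then show ?thesis using o[of k] kl by (simp add: ik \<pi>o \<gamma>o uz)
        next case 6 then show ?thesis using o[of k] kl u z01 by (simp add: ik \<pi>o \<gamma>o uz)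
        qed
      qed
      then show ?thesis by (simp add: mult_ac)
    qed (auto simp: ut_def)
    have Z: "(if l = dl k \<and> j = dl i then Z (\<pi> k) (\<pi> i) else 0) * G = G' * (if l = dl k \<and> j = dl i then Z k i else 0)"
    proof (cases "l = dl k \<and> j = dl i")
      case True
      then have nn: "\<not> (k = b \<and> i = b)" "\<not> (k = N \<and> i = N)" using False by auto
      have G: "G = (if k = b then z else if k = N then 1 / z else 1)" "G' = (if i = b then 1 / z else if i = N then z else 1)"
        using True bN b u ijkl unfolding G_def G'_def \<gamma> z by (auto simp: dl_def)
      define W where "W y = w y / Q y" for y
      have ZW: "Z x y = hh * gg x * (if x < dl y then z else c) * W y" for x y by (simp add: Z_def W_def)
      have r1: "gg b = gg N * c" and r2: "W b = W N * c"
        unfolding gg1 W_def wN QN cQ power2_eq_square using qn by simp_all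
      have "Z (\<pi> k) (\<pi> i) * G = G' * Z k i"
      proof -
        have \<pi>o: "\<pi> b = N" "\<pi> N = b" "x \<noteq> b \<Longrightarrow> x \<noteq> N \<Longrightarrow> \<pi> x = x" for x using bN by (auto simp: \<pi>)
        have dl1: "b < dl x \<longleftrightarrow> x \<noteq> N" "\<not> N < dl x" "x < N \<longleftrightarrow> x \<noteq> N" "\<not> x < b" if "x \<in> {1..N}" for x
          using that b by (auto simp: dl_def)
        note ss = G \<pi>o ZW d bN z01 dl1[OF ijkl(1)] dl1[OF ijkl(3)]
        consider "k \<noteq> b" "k \<noteq> N" "i \<noteq> b" "i \<noteq> N" | "k = b" "i = N" | "k = N" "i = b" | "k = b" "i \<noteq> b" "i \<noteq> N" | "k = N" "i \<noteq> b" "i \<noteq> N"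
          | "k \<noteq> b" "k \<noteq> N" "i = b" | "k \<noteq> b" "k \<noteq> N" "i = N" using nn by argo
        then show ?thesis
        proof cases
          case 1 then show ?thesis by (simp add: ss)
        next case 2 then show ?thesis by (simp add: ss r1 r2)
        next case 3 then show ?thesis by (simp add: ss r1 r2)
        next case 4 then show ?thesis by (simp add: ss r1)
        next case 5 then show ?thesis by (simp add: ss r1)
        next case 6 then show ?thesis by (simp add: ss r2)
        next case 7 then show ?thesis by (simp add: ss r2)
        qed
      qed
      then show ?thesis using True by simp
    qed auto
    show "((z - c) * (sn (od k) (od l) * Dg k l) * ut l k i j + \<beta> * (if \<pi> k < \<pi> l then z else 1) * ut k l i j
        - (if l = dl k \<and> j = dl i then Z (\<pi> k) (\<pi> i) else 0)) * G
      = G' * ((z - c) * (sn (od k) (od l) * Dg k l) * ut l k i j + \<beta> * (if k < l then z else 1) * ut k l i j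
        - (if l = dl k \<and> j = dl i then Z k i else 0))"
      by (rule r[OF A B Z])
  qed
qed

section \<open>\<open>Rh\<close> and the root vectors of each type\<close>

lemma K_root:
  assumes a: "a \<in> {1..N}" and b: "b \<in> {1..N}" and Qab: "Q a * root_wt a b b = Q b * root_wt a b a"
  shows "intertwines Kt (od a \<noteq> od b) 1 1 (root_wt a b) (root_mat a b)"
  by (rule K_intertwines[OF a b root_wt_dual(3)[OF a b] root_wt_dual(3)[OF a b] root_wt_dual(1)[OF a b] root_wt_dual(2)[OF a b] Qab])

lemma tp_nonzero: "tp i \<noteq> 0" using t by (simp add: tp_def)

lemma Rh_simple:
  assumes a: "a \<in> {1..N}" and b: "b = a + 1" and ord: "b < dl b"
    and Qab: "Q a = Q b * tp a * tp b" and z: "z \<noteq> 1"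
  shows "intertwines (Rh z c) (od a \<noteq> od b) 1 1 (root_wt a b) (root_mat a b)"
proof (rule Rh_intertwinesI[OF z S_simple[OF a b ord Qab] K_root[OF a]])
  show "b \<in> {1..N}" using ord a b by (auto simp: dl_def)
  have "a \<noteq> b" "a \<noteq> dl a" "a \<noteq> dl b" "b \<noteq> dl a" "b \<noteq> dl b" using a b ord by (auto simp: dl_def)
  then show "Q a * root_wt a b b = Q b * root_wt a b a"
    unfolding root_wt_def Qab using tp_nonzero[of b] by (auto simp: mult_ac)
qed

lemma Rh_middle:
  assumes a: "a \<in> {1..N}" and b: "b = a + 1" and ord: "b = dl b"
    and evb: "\<not> od b" and Qb: "Q b = 1" and Qab: "Q a = tp a" and z: "z \<noteq> 1"
  shows "intertwines (Rh z c) (od a \<noteq> od b) 1 1 (root_wt a b) (root_mat a b)"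
proof (rule Rh_intertwinesI[OF z S_middle[OF a b ord evb Qb Qab] K_root[OF a]])
  show "b \<in> {1..N}" using ord a b by (auto simp: dl_def)
  have "a \<noteq> b" "a \<noteq> dl a" "a \<noteq> dl b" "b \<noteq> dl a" using a b ord by (auto simp: dl_def)
  then show "Q a * root_wt a b b = Q b * root_wt a b a"
    unfolding root_wt_def Qab Qb using tp_nonzero[of b] ord[symmetric] by auto
qed

lemma Rh_long:
  assumes a: "a \<in> {1..N}" and b: "b = a + 1" and ord: "b = dl a"
    and oda: "od a" and Qab: "Q a = (tp a)\<^sup>2" and z: "z \<noteq> 1"
  shows "intertwines (Rh z c) (od a \<noteq> od b) 1 1 (root_wt a b) (root_mat a b)"
proof (rule Rh_intertwinesI[OF z S_long[OF a b ord oda Qab] K_root[OF a]])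
  show "b \<in> {1..N}" using ord a b by (auto simp: dl_def)
  have ab: "a \<noteq> b" "dl b = a" "dl a = b" using b ord dl_dl[OF a] by auto
  have x: "root_wt a b a = (tp a)\<^sup>2" "root_wt a b b = 1 / (tp a)\<^sup>2" and Qb: "Q b = 1 / (tp a)\<^sup>2"
    using ab tp_dl[OF a] Q_dl[OF a] Qab by (simp_all add: root_wt_def power2_eq_square)
  show "Q a * root_wt a b b = Q b * root_wt a b a"
    unfolding x Qb Qab by simp
qed

lemma Rh_fork:
  assumes a: "a \<in> {1..N}" and b: "b = a + 1" and b': "b' = b + 1" "b' = dl b" and evb: "\<not> od b" and Qb: "Q b = 1"
    and Qab: "Q a = tp a * tp b" and z: "z \<noteq> 1"
  shows "intertwines (Rh z c) (od a \<noteq> od b') 1 1 (root_wt a b') (root_mat a b')"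
proof -
  define \<pi> where "\<pi> = (\<lambda>x. if x = b then b' else if x = b' then b else x)"
  have bN: "b \<in> {1..N}" "b' \<in> {1..N}" using a b b' by (auto simp: dl_def)
  have db: "dl b = b'" "dl b' = b" using b' dl_dl[OF bN(1)] by auto
  have ne: "a \<noteq> b" "a \<noteq> b'" "b \<noteq> b'" "b \<noteq> a" "b' \<noteq> a" "b' \<noteq> b" "dl a \<noteq> b" "dl a \<noteq> b'" "b \<noteq> dl a" "b' \<noteq> dl a" using a b b' by (auto simp: dl_def)
  have od: "od b' = od b" and w: "w b' = w b" and tp: "tp b' = tp b" using od_dl[OF bN(1)] w_dl[OF bN(1)] tp_dl[OF bN(1)] db evb by auto
  have *: "intertwines (Rh z c) (od a \<noteq> od b) 1 1 (root_wt a b) (root_mat a b)"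
    by (rule Rh_simple[OF a b _ _ z]) (use Qab Qb db b' in auto)
  have "intertwines (Rh z c) (od a \<noteq> od b) 1 1 (root_wt a b') (root_mat a b')"
  proof (rule intertwines_gauge[OF *, where \<pi> = \<pi> and \<gamma>u = "\<lambda>_. 1" and \<gamma>v = "\<lambda>_. 1"])
    show "\<pi> i \<in> {1..N} \<and> \<pi> (\<pi> i) = i \<and> od (\<pi> i) = od i" if "i \<in> {1..N}" for i
      using that bN od by (auto simp: \<pi>_def)
    show "Rh z c (\<pi> i) (\<pi> j) (\<pi> k) (\<pi> l) * (1 * 1) = 1 * 1 * Rh z c i j k l"
      if "i \<in> {1..N}" "j \<in> {1..N}" "k \<in> {1..N}" "l \<in> {1..N}" for i j k l
      using Rh_swap_middle[OF bN(1) db(1) b'(1) evb Qb z \<pi>_def that] by simp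
    show "root_wt a b' i = root_wt a b (\<pi> i)" if "i \<in> {1..N}" for i
      using ne unfolding root_wt_def \<pi>_def db tp by auto
    show "1 * root_mat a b (\<pi> r) (\<pi> l) = 1 * root_mat a b' r l * 1" for r l
      using ne unfolding root_mat_def \<pi>_def db od w by auto
    then show "1 * root_mat a b (\<pi> r) (\<pi> l) = 1 * root_mat a b' r l * 1" for r l .
  qed auto
  then show ?thesis unfolding od .
qed

lemma Rh_affine_even:
  assumes N: "N > 2" and a: "a = 1" and b: "b = 2" and eva: "\<not> od a" and c: "c * (Q a)\<^sup>2 = 1"
    and uv: "u \<noteq> 0" "v \<noteq> 0" "u \<noteq> v" "z = u / v"
    and fin: "intertwines (Rh z c) (od a \<noteq> od b) 1 1 (root_wt a b) (root_mat a b)"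
  shows "intertwines (Rh z c) (od a \<noteq> od b) u v (root_wt (dl b) a) (root_mat (dl b) a)"
proof -
  define \<pi> where "\<pi> = (\<lambda>x. if x = a then N else if x = N then a else x)"
  define \<gamma> where "\<gamma> = (\<lambda>y x. if x = a then y else if x = N then 1 / y else (1::'a))"
  have aN: "a \<in> {1..N}" and bN: "b \<in> {1..N}" and NN: "N \<in> {1..N}" using N a b by auto
  have d: "dl a = N" "dl N = a" "dl (dl b) = b" using a N dl_dl[OF bN] by (auto simp: dl_def)
  have ne: "a \<noteq> b" "b \<noteq> a" "a \<noteq> N" "N \<noteq> a" "b \<noteq> N" "N \<noteq> b" "dl b \<noteq> a" "dl b \<noteq> N" "a \<noteq> dl b" "N \<noteq> dl b"
    using a b N by (auto simp: dl_def)
  have od: "od N = od a" and wN: "w N = w a" and tp: "tp N = tp a"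
    using od_dl[OF aN] w_dl[OF aN] tp_dl[OF aN] d eva by auto
  have N1: "N > 1" using N by simp
  have *: "intertwines (Rh z c) (od a \<noteq> od b) u v (root_wt N b) (root_mat N b)"
  proof (rule intertwines_gauge[OF fin, where \<pi> = \<pi> and \<gamma>u = "\<gamma> u" and \<gamma>v = "\<gamma> v"])
    show "\<pi> i \<in> {1..N} \<and> \<pi> (\<pi> i) = i \<and> od (\<pi> i) = od i" if "i \<in> {1..N}" for i
      using that aN NN od by (auto simp: \<pi>_def)
    show "\<gamma> u i \<noteq> 0" "\<gamma> v i \<noteq> 0" for i using uv by (auto simp: \<gamma>_def)
    show "Rh z c (\<pi> i) (\<pi> j) (\<pi> k) (\<pi> l) * (\<gamma> u k * \<gamma> v l) = \<gamma> v i * \<gamma> u j * Rh z c i j k l"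
      if "i \<in> {1..N}" "j \<in> {1..N}" "k \<in> {1..N}" "l \<in> {1..N}" for i j k l
      by (rule Rh_swap_affine[OF N1 a eva c uv \<pi>_def \<gamma>_def that])
    show "root_wt N b i = root_wt a b (\<pi> i)" if "i \<in> {1..N}" for i
      using ne unfolding root_wt_def \<pi>_def d tp by auto
    have e: "root_mat a b (\<pi> r) (\<pi> l) = (if r = N \<and> l = b then 1 else 0) - (if r = dl b \<and> l = a then sn (od a) (od a \<noteq> od b) * w a * w b else 0)"
      "root_mat N b r l = (if r = N \<and> l = b then 1 else 0) - (if r = dl b \<and> l = a then sn (od a) (od a \<noteq> od b) * w a * w b else 0)" for r l
      using ne unfolding root_mat_def \<pi>_def d od wN by auto
    show "\<gamma> u l * root_mat a b (\<pi> r) (\<pi> l) = u * root_mat N b r l * \<gamma> u r" for r l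
      using ne uv unfolding e by (auto simp: \<gamma>_def)
    show "\<gamma> v l * root_mat a b (\<pi> r) (\<pi> l) = v * root_mat N b r l * \<gamma> v r" for r l
      using ne uv unfolding e by (auto simp: \<gamma>_def)
  qed
  \<comment> \<open>The gauge transformation has produced the index pair (1', 2); renaming it (2',
    1) gives the matrix by which e_0 is defined.\<close>
  show ?thesis
  proof (rule intertwines_scale[OF *])
    show "root_mat (dl b) a r l = - (sn (od N) (od N \<noteq> od b) * w N * w b) * root_mat N b r l" for r l
      using root_mat_dual[OF NN bN, of r l] unfolding d .
    show "root_wt (dl b) a r = root_wt N b r" for r
      unfolding root_wt_def d tp tp_dl[OF bN] by (simp add: mult_ac)
  qed
qed

end

section \<open>The Weyl vector\<close>

lemma emb_simps [simp]:
  "emb 0 = 0" "emb 1 = 1" "emb (x + y) = emb x + emb y" "emb (x * y) = emb x * emb y"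
  "emb (- x) = - emb x" "emb (x - y) = emb x - emb y"
proof -
  have c: "[:[:x + y:]:] = [:[:x:]:] + [:[:y:]:]" "[:[:x - y:]:] = [:[:x:]:] - [:[:y:]:]" "[:[:- x:]:] = - [:[:x:]:]"
    "[:[:x * y:]:] = [:[:x:]:] * [:[:y:]:]" for x y :: K by simp_all
  show "emb 0 = 0" "emb 1 = 1" by (simp_all add: emb_def one_pCons[symmetric])
  show "emb (x + y) = emb x + emb y" "emb (x * y) = emb x * emb y" "emb (- x) = - emb x" "emb (x - y) = emb x - emb y"
    unfolding emb_def c to_fract_add to_fract_mult to_fract_uminus to_fract_diff by (rule refl)+
qed

lemma emb_eq_0_iff [simp]: "emb x = 0 \<longleftrightarrow> x = 0"
  by (simp add: emb_def)

lemma emb_inverse [simp]: "emb (inverse x) = inverse (emb x)"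
proof (cases "x = 0")
  case False
  then have "emb x * emb (inverse x) = 1" unfolding emb_simps(4)[symmetric] by simp
  then show ?thesis by (simp add: inverse_unique)
qed simp

lemma emb_divide [simp]: "emb (x / y) = emb x / emb y"
  by (simp add: divide_inverse)

lemma emb_power [simp]: "emb (x ^ k) = emb x ^ k"
  by (induction k) simp_all

lemma emb_powi [simp]: "emb (x powi k) = emb x powi k"
  by (simp add: power_int_def)

lemma emb_of_int [simp]: "emb (of_int k) = of_int k"
proof -
  have "emb (of_nat k) = of_nat k" for k by (induction k) simp_all
  then show ?thesis by (cases k rule: int_cases2) simp_all
qed

lemma emb_numeral [simp]: "emb (numeral k) = numeral k"
  using emb_of_int[of "numeral k"] by simp

lemma emb_if: "emb (if c then x else y) = (if c then emb x else emb y)"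
  by simp

lemma qhalf_nonzero: "qhalf \<noteq> 0"
  by (simp add: qhalf_def)

lemma qpow_half_int: "qpow (of_int k / 2) = qhalf powi k"
  by (simp add: qpow_def)

lemma indet_nonzero: "indet x \<noteq> 0"
  by (cases x) simp_all

lemma indet_distinct: "indet Param_u \<noteq> indet Param_v" "indet Param_u / indet Param_v \<noteq> 1"
proof -
  show "indet Param_u \<noteq> indet Param_v"
    by (simp add: to_fract_def eq_fract)
  then show "indet Param_u / indet Param_v \<noteq> 1" using indet_nonzero by simp
qed

section \<open>The exponents (rho, eps_i)\<close>

context osp_data begin

lemma dual_in: "i \<in> {1..N} \<Longrightarrow> dual i \<in> {1..N}" and dual_dual: "i \<in> {1..N} \<Longrightarrow> dual (dual i) = i"
  by (auto simp: dual_def)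

lemma p_dual: "i \<in> {1..N} \<Longrightarrow> p (dual i) = p i"
  using parity_dual[of i] by (simp add: dual_def N_def)

lemma vt_dual: "i \<in> {1..N} \<Longrightarrow> vt (dual i) = (if p i = 1 then - vt i else vt i)"
  using sign_odd[of i] sign_even[of i] sign_even[of "dual i"] parity[of i] p_dual[of i] dual_in[of i]
  by (auto simp: dual_def N_def)

lemma p_cases: "i \<in> {1..N} \<Longrightarrow> p i = 0 \<or> p i = 1"
  using parity[of i] by (auto simp: N_def)

lemma odd_N: "odd N \<longleftrightarrow> odd m" using even_n by (simp add: N_def)

lemma N_s: "N = (if odd m then 2 * s + 1 else 2 * s)"
  using odd_N unfolding s_def by auto

lemma s_pos: "1 \<le> s" "even m \<Longrightarrow> 2 \<le> s" and N_gt_2: "N > 2"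
  using dim N_s by (auto simp: N_def split: if_splits)

text \<open>The middle index is its own dual; if it were odd, its sign would equal its own
  negative.\<close>

lemma p_middle: assumes "odd m" shows "p (s + 1) = 0"
proof -
  have N: "N = 2 * s + 1" using N_s assms by simp
  then have "dual (s + 1) = s + 1" "s + 1 \<in> {1..N}" by (auto simp: dual_def)
  then show ?thesis using vt_dual[of "s + 1"] p_cases[of "s + 1"] sign[of "s + 1"] by (auto simp: N_def)
qed

definition pos_pairs :: "(nat \<times> nat) set" where
  "pos_pairs = (SIGMA a:{1..s}. {a<..<dual a})"

lemma pos_pairs_iff: "(a, b) \<in> pos_pairs \<longleftrightarrow> 1 \<le> a \<and> a < b \<and> b < dual a"
  using N_s by (auto simp: pos_pairs_def dual_def split: if_splits)

text \<open>\<open>rho\<close> is defined by sums over sets of roots, so distinct pairs must give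
  distinct roots. The first nonzero coordinate of eps_a - eps_b is at a and recovers a; then eps_b
  recovers b, the middle index being the only one with eps_b = 0.\<close>

lemma eps_diff_inj: "inj_on (\<lambda>(a, b) k. eps a k - eps b k) pos_pairs"
proof (rule inj_onI, clarsimp simp: pos_pairs_iff)
  fix a b c d assume *: "Suc 0 \<le> a" "a < b" "b < dual a" "Suc 0 \<le> c" "c < d" "d < dual c"
    and eq: "(\<lambda>k. eps a k - eps b k) = (\<lambda>k. eps c k - eps d k)"
  have lead: "eps a a - eps b a = 1" "k < a \<Longrightarrow> eps a k - eps b k = 0" "a \<in> {1..s}"
    if "1 \<le> a" "a < b" "b < dual a" for a b k
    using that N_s by (auto simp: eps_def dual_def split: if_splits)
  have ac: "a = c"
  proof (rule linorder_cases[of a c])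
    assume "a < c"
    then show ?thesis using lead(1)[of a b] lead(2)[of c d a] fun_cong[OF eq, of a] * by simp
  next
    assume "c < a"
    then show ?thesis using lead(1)[of c d] lead(2)[of a b c] fun_cong[OF eq, of c] * by simp
  qed
  have eb: "eps b k = eps d k" for k using fun_cong[OF eq, of k] ac by simp
  have bd: "b \<in> {1..N}" "d \<in> {1..N}" using * by (auto simp: dual_def)
  have "b = d"
  proof (cases "b \<in> {1..s}")
    case True
    then show ?thesis using eb[of b] bd N_s by (auto simp: eps_def dual_def split: if_splits)
  next
    case b: False
    show ?thesis
    proof (cases "d \<in> {1..s}")
      case True
      then show ?thesis using eb[of d] bd N_s by (auto simp: eps_def dual_def split: if_splits)
    next
      case False
      then show ?thesis using b eb[of "dual b"] eb[of "dual d"] bd N_s by (auto simp: eps_def dual_def split: if_splits)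
    qed
  qed
  with ac show "a = c \<and> b = d" by simp
qed

lemma finite_pos_pairs: "finite pos_pairs"
  unfolding pos_pairs_def by auto

text \<open>Even and odd roots merge into one signed sum over pairs. A difference eps_a - eps_b
  never equals some 2 eps_c, because b < a' excludes b = a'.\<close>

lemma rho_eq:
  "rho k = ((\<Sum>(a, b)\<in>pos_pairs. (-1) ^ (p a + p b) * (eps a k - eps b k)) + (\<Sum>a | a \<in> {1..s} \<and> p a = 1. 2 * eps a k)) / 2"
proof -
  let ?f = "\<lambda>(a, b) k. eps a k - eps b k"
  let ?E = "{x \<in> pos_pairs. even (p (fst x) + p (snd x))}" and ?O = "{x \<in> pos_pairs. odd (p (fst x) + p (snd x))}"
  let ?L = "{a. a \<in> {1..s} \<and> p a = 1}"
  have O: "odd_pos_roots = ?f ` ?O"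
  proof (intro Set.set_eqI iffI)
    fix \<beta> assume "\<beta> \<in> odd_pos_roots"
    then obtain i j where "\<beta> = (\<lambda>k. eps i k - eps j k)" "(i, j) \<in> pos_pairs" "odd (p i + p j)"
      unfolding odd_pos_roots_def pos_pairs_iff by blast
    then show "\<beta> \<in> ?f ` ?O" by (intro image_eqI[of _ _ "(i, j)"]) auto
  next
    fix \<beta> assume "\<beta> \<in> ?f ` ?O"
    then obtain x where x: "\<beta> = ?f x" "x \<in> ?O" by (rule imageE)
    moreover obtain i j where "x = (i, j)" by (cases x)
    ultimately have ij: "\<beta> = ?f (i, j)" "(i, j) \<in> ?O" by (simp_all only:)
    then have "\<beta> = (\<lambda>k. eps i k - eps j k)" "(i, j) \<in> pos_pairs" "odd (p i + p j)" by simp_all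
    then show "\<beta> \<in> odd_pos_roots" unfolding odd_pos_roots_def pos_pairs_iff by blast
  qed
  have E: "even_pos_roots = ?f ` ?E \<union> (\<lambda>a k. 2 * eps a k) ` ?L"
  proof -
    have "{(\<lambda>k. eps i k - eps j k) | i j. 1 \<le> i \<and> i < j \<and> j < dual i \<and> even (p i + p j)} = ?f ` ?E"
    proof (intro Set.set_eqI iffI)
      fix \<beta> assume "\<beta> \<in> {(\<lambda>k. eps i k - eps j k) | i j. 1 \<le> i \<and> i < j \<and> j < dual i \<and> even (p i + p j)}"
      then obtain i j where "\<beta> = (\<lambda>k. eps i k - eps j k)" "(i, j) \<in> pos_pairs" "even (p i + p j)"
        unfolding pos_pairs_iff by blast
      then show "\<beta> \<in> ?f ` ?E" by (intro image_eqI[of _ _ "(i, j)"]) auto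
    next
      fix \<beta> assume "\<beta> \<in> ?f ` ?E"
      then obtain x where x: "\<beta> = ?f x" "x \<in> ?E" by (rule imageE)
    moreover obtain i j where "x = (i, j)" by (cases x)
    ultimately have ij: "\<beta> = ?f (i, j)" "(i, j) \<in> ?E" by (simp_all only:)
    then have "\<beta> = (\<lambda>k. eps i k - eps j k)" "(i, j) \<in> pos_pairs" "even (p i + p j)" by simp_all
      then show "\<beta> \<in> {(\<lambda>k. eps i k - eps j k) | i j. 1 \<le> i \<and> i < j \<and> j < dual i \<and> even (p i + p j)}"
        unfolding pos_pairs_iff by blast
    qed
    moreover have "{(\<lambda>k. 2 * eps i k) | i. 1 \<le> i \<and> i \<le> s \<and> p i = 1} = (\<lambda>a k. 2 * eps a k) ` ?L"
      by auto
    ultimately show ?thesis unfolding even_pos_roots_def by simp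
  qed
  have disj: "?f ` ?E \<inter> (\<lambda>a k. 2 * eps a k) ` ?L = {}"
  proof -
    have "(\<lambda>k. eps a k - eps b k) \<noteq> (\<lambda>k. 2 * eps c k)" if "(a, b) \<in> pos_pairs" "c \<in> {1..s}" for a b c
    proof
      assume "(\<lambda>k. eps a k - eps b k) = (\<lambda>k. 2 * eps c k)"
      then have "eps a c - eps b c = 2 * eps c c" by (rule fun_cong)
      then show False using that N_s by (auto simp: pos_pairs_iff eps_def dual_def split: if_splits)
    qed
    then show ?thesis by fastforce
  qed
  have L: "inj_on (\<lambda>a k. 2 * eps a k) ?L"
  proof (rule inj_onI)
    fix a c assume "a \<in> ?L" "c \<in> ?L" "(\<lambda>k. 2 * eps a k) = (\<lambda>k. 2 * eps c k)"
    then show "a = c" using N_s by (auto simp: eps_def dual_def split: if_splits dest!: fun_cong[of _ _ a])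
  qed
  have fin: "finite ?E" "finite ?O" "finite ?L" using finite_pos_pairs by auto
  have s1: "(\<Sum>\<beta>\<in>odd_pos_roots. \<beta> k) = (\<Sum>x\<in>?O. ?f x k)"
    unfolding O by (subst sum.reindex) (auto intro: inj_on_subset[OF eps_diff_inj])
  have "(\<Sum>\<beta>\<in>even_pos_roots. \<beta> k) = (\<Sum>\<beta>\<in>?f ` ?E. \<beta> k) + (\<Sum>\<beta>\<in>(\<lambda>a k. 2 * eps a k) ` ?L. \<beta> k)"
    unfolding E by (rule sum.union_disjoint) (use fin disj in auto)
  also have "(\<Sum>\<beta>\<in>?f ` ?E. \<beta> k) = (\<Sum>x\<in>?E. ?f x k)"
    by (subst sum.reindex) (auto intro: inj_on_subset[OF eps_diff_inj])
  also have "(\<Sum>\<beta>\<in>(\<lambda>a k. 2 * eps a k) ` ?L. \<beta> k) = (\<Sum>a\<in>?L. 2 * eps a k)"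
    by (subst sum.reindex) (use L in auto)
  finally have s2: "(\<Sum>\<beta>\<in>even_pos_roots. \<beta> k) = (\<Sum>x\<in>?E. ?f x k) + (\<Sum>a\<in>?L. 2 * eps a k)" .
  have "(\<Sum>(a, b)\<in>pos_pairs. (-1) ^ (p a + p b) * (eps a k - eps b k))
      = (\<Sum>x\<in>?E. (-1) ^ (p (fst x) + p (snd x)) * ?f x k) + (\<Sum>x\<in>?O. (-1) ^ (p (fst x) + p (snd x)) * ?f x k)"
    by (subst sum.union_disjoint[symmetric]) (use fin in \<open>auto intro!: sum.cong\<close>)
  also have "\<dots> = (\<Sum>x\<in>?E. ?f x k) + (\<Sum>x\<in>?O. - ?f x k)"
    by (intro arg_cong2[where f = "(+)"] sum.cong) auto
  finally show ?thesis
    unfolding rho_def s1 s2 by (simp add: sum_negf diff_divide_distrib add_divide_distrib)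
qed

text \<open>Only pairs with first index k contribute: for a < k the partners k and k' both occur,
  with equal sign and opposite coordinate, and for a > k neither occurs.\<close>

lemma rho_coord:
  assumes k: "k \<in> {1..s}"
  shows "rho k = (-1) ^ p k * (\<Sum>b\<in>{k<..<dual k}. (-1) ^ p b) / 2 + (if p k = 1 then 1 else 0)"
proof -
  have "(\<Sum>(a, b)\<in>pos_pairs. (-1) ^ (p a + p b) * (eps a k - eps b k))
     = (\<Sum>a=1..s. \<Sum>b\<in>{a<..<dual a}. (-1) ^ (p a + p b) * (eps a k - eps b k))"
    unfolding pos_pairs_def by (subst sum.Sigma) auto
  also have "\<dots> = (\<Sum>a=1..s. if a = k then (-1) ^ p k * (\<Sum>b\<in>{k<..<dual k}. (-1) ^ p b) else 0)"
  proof (rule sum.cong[OF refl])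
    fix a assume a: "a \<in> {1..s}"
    show "(\<Sum>b\<in>{a<..<dual a}. (-1) ^ (p a + p b) * (eps a k - eps b k))
      = (if a = k then (-1) ^ p k * (\<Sum>b\<in>{k<..<dual k}. (-1) ^ p b) else 0)"
    proof (cases "a = k")
      case True
      have "eps k k - eps b k = 1" if "b \<in> {k<..<dual k}" for b
        using that k N_s by (auto simp: eps_def dual_def split: if_splits)
      then show ?thesis using True by (simp add: power_add sum_distrib_left)
    next
      case False
      have dk: "dual k \<noteq> k" "dual k \<in> {1..N}" "k \<in> {1..N}" using k N_s by (auto simp: dual_def split: if_splits)
      have ea: "eps a k = 0" using False a k N_s by (auto simp: eps_def dual_def split: if_splits)
      have eb: "eps b k = (if b = k then 1 else 0) - (if b = dual k then 1 else 0)" if "b \<in> {a<..<dual a}" for b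
      proof -
        have "b \<in> {1..N}" using that by (auto simp: dual_def)
        then have "k = dual b \<longleftrightarrow> b = dual k" using dual_dual dk(3) by metis
        then show ?thesis using k dk(1) unfolding eps_def by auto
      qed
      have "(\<Sum>b\<in>{a<..<dual a}. (-1) ^ (p a + p b) * (eps a k - eps b k))
        = (\<Sum>b\<in>{a<..<dual a}. (if b = dual k then (-1) ^ (p a + p k) else 0) - (if b = k then (-1) ^ (p a + p k) else 0))"
        by (rule sum.cong[OF refl]) (use ea eb dk p_dual[of k] in \<open>auto\<close>)
      also have "\<dots> = 0"
        using k a by (auto simp: sum_subtractf dual_def)
      finally show ?thesis using False by simp
    qed
  qed
  also have "\<dots> = (-1) ^ p k * (\<Sum>b\<in>{k<..<dual k}. (-1) ^ p b)"
    using k by simp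
  finally have 1: "(\<Sum>(a, b)\<in>pos_pairs. (-1) ^ (p a + p b) * (eps a k - eps b k)) = (-1) ^ p k * (\<Sum>b\<in>{k<..<dual k}. (-1) ^ p b)" .
  have "(\<Sum>a | a \<in> {1..s} \<and> p a = 1. 2 * eps a k) = (\<Sum>a | a \<in> {1..s} \<and> p a = 1. if a = k then 2 else 0)"
    by (rule sum.cong[OF refl]) (use k N_s in \<open>auto simp: eps_def dual_def split: if_splits\<close>)
  also have "\<dots> = (if p k = 1 then 2 else 0)"
    using k by simp
  finally show ?thesis unfolding rho_eq 1 by simp
qed

lemma eps_dual: "i \<in> {1..N} \<Longrightarrow> eps (dual i) = (\<lambda>k. - eps i k)"
  using dual_dual[of i] dual_in[of i] N_s by (auto simp: eps_def dual_def fun_eq_iff split: if_splits)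

lemma form_eps:
  assumes "k \<in> {1..s}"
  shows "form x (eps k) = (-1) ^ p k * x k"
proof -
  have "eps k l = (if l = k then 1 else 0)" if "l \<in> {1..s}" for l
    using assms that N_s by (auto simp: eps_def dual_def split: if_splits)
  then have "form x (eps k) = (\<Sum>l=1..s. if l = k then (-1) ^ p k * x k else 0)"
    unfolding form_def by (intro sum.cong) auto
  then show ?thesis using assms by simp
qed

lemma form_neg: "form x (\<lambda>k. - y k) = - form x y"
  by (simp add: form_def sum_negf)

lemma form_diff: "form x (\<lambda>k. y k - y' k) = form x y - form x y'"
  by (simp add: form_def sum_subtractf right_diff_distrib)

text \<open>Twice the exponent \<open>(\<rho>, \<epsilon>\<^sub>i)\<close>, as an integer.\<close>

definition rexp :: "nat \<Rightarrow> int" where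
  "rexp i = (if i \<le> s then (\<Sum>b\<in>{i<..<dual i}. (-1) ^ p b) - (if p i = 1 then 2 else 0)
    else if dual i \<le> s then - (\<Sum>b\<in>{dual i<..<i}. (-1) ^ p b) + (if p i = 1 then 2 else 0) else 0)"

lemma form_rho_eps:
  assumes i: "i \<in> {1..N}"
  shows "form rho (eps i) = of_int (rexp i) / 2"
proof -
  have 1: "form rho (eps k) = of_int (rexp k) / 2" if k: "k \<in> {1..s}" for k
  proof -
    have "p k = 0 \<or> p k = 1" using p_cases[of k] k N_s by (auto split: if_splits)
    then show ?thesis unfolding form_eps[OF k] rho_coord[OF k] rexp_def using k by auto
  qed
  show ?thesis
  proof (cases "i \<le> s")
    case True then show ?thesis using 1[of i] i by simp
  next
    case F: False
    show ?thesis
    proof (cases "dual i \<le> s")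
      case True
      then have d: "dual i \<in> {1..s}" using dual_in[OF i] by simp
      have "form rho (eps i) = - form rho (eps (dual i))"
        using eps_dual[OF dual_in[OF i]] dual_dual[OF i] form_neg by metis
      also have "\<dots> = of_int (rexp i) / 2"
        unfolding 1[OF d] using F True by (simp add: rexp_def dual_dual[OF i] p_dual[OF i] field_simps)
      finally show ?thesis .
    next
      case False
      then have "eps i = (\<lambda>k. 0)" using F by (auto simp: eps_def fun_eq_iff dual_def)
      then show ?thesis using F False by (simp add: form_def rexp_def)
    qed
  qed
qed

lemma rexp_dual: "i \<in> {1..N} \<Longrightarrow> rexp (dual i) = - rexp i"
  using form_rho_eps[of i] form_rho_eps[of "dual i"] dual_in[of i] eps_dual[of i] form_neg[of rho "eps i"]
  by simp

text \<open>This is 2 (rho, alpha_i) = (alpha_i, alpha_i). From i to i + 1 the range of summation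
  loses i + 1 and its dual, which have equal parity; the corrections for odd vectors supply the
  rest.\<close>

lemma rexp_step:
  assumes i: "1 \<le> i" "i + 1 \<le> s"
  shows "rexp i = rexp (i + 1) + (if p i = 1 then -1 else 1) + (if p (i + 1) = 1 then -1 else 1)"
proof -
  have iN: "i \<in> {1..N}" "i + 1 \<in> {1..N}" using i N_s by (auto split: if_splits)
  have d: "dual (i + 1) = dual i - 1" "i + 1 < dual (i + 1)" "dual i = dual (i + 1) + 1" using i N_s by (auto simp: dual_def split: if_splits)
  have "{i<..<dual i} = insert (i + 1) (insert (dual (i + 1)) {i + 1<..<dual (i + 1)})"
    using d by auto
  then have "(\<Sum>b\<in>{i<..<dual i}. (-1) ^ p b) = (\<Sum>b\<in>{i + 1<..<dual (i + 1)}. (-1) ^ p b) + (2 * (-1) ^ p (i + 1) :: int)"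
    using d(2) p_dual[OF iN(2)] by simp
  then show ?thesis using i p_cases[OF iN(1)] p_cases[OF iN(2)] by (auto simp: rexp_def)
qed

text \<open>Between s and s' there is nothing for even m, and only the even middle vector for odd
  m.\<close>

lemma rexp_last:
  shows "odd m \<Longrightarrow> rexp s = (if p s = 1 then -1 else 1)" and "odd m \<Longrightarrow> rexp (s + 1) = 0"
    and "even m \<Longrightarrow> rexp s = (if p s = 1 then -2 else 0)"
proof -
  have sN: "s \<in> {1..N}" using s_pos N_s by (auto split: if_splits)
  show "rexp s = (if p s = 1 then -1 else 1)" if "odd m"
  proof -
    have "{s<..<dual s} = {s + 1}" using that N_s by (auto simp: dual_def)
    then show ?thesis using p_middle[OF that] p_cases[OF sN] by (auto simp: rexp_def)
  qed
  show "rexp (s + 1) = 0" if "odd m" using that N_s by (simp add: rexp_def dual_def)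
  show "rexp s = (if p s = 1 then -2 else 0)" if "even m"
  proof -
    have "{s<..<dual s} = {}" using that N_s by (auto simp: dual_def)
    then show ?thesis by (auto simp: rexp_def)
  qed
qed

lemma sum_parity: "(\<Sum>b=1..N. (-1) ^ p b) = int m - int n"
proof -
  have "(\<Sum>b=1..N. (-1) ^ p b :: int) = (\<Sum>b\<in>{b \<in> {1..N}. p b = 0} \<union> {b \<in> {1..N}. p b = 1}. (-1) ^ p b)"
    by (intro sum.cong refl Set.set_eqI) (use p_cases in blast)
  also have "\<dots> = (\<Sum>b\<in>{b \<in> {1..N}. p b = 0}. (-1) ^ p b) + (\<Sum>b\<in>{b \<in> {1..N}. p b = 1}. (-1) ^ p b)"
    by (rule sum.union_disjoint) auto
  also have "\<dots> = int m - int n"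
    using card_even card_odd by (simp add: N_def)
  finally show ?thesis .
qed

text \<open>The range between 1 and N omits only the two ends, so the supertrace m - n appears. This
  links rho to the exponent in \<open>crit\<close>.\<close>

lemma rexp_first: "rexp 1 = int m - int n - (if p 1 = 1 then 0 else 2)"
proof -
  have d: "dual 1 = N" "1 < N" "1 \<in> {1..N}" using N_gt_2 by (auto simp: dual_def)
  have "{1..N} = insert 1 (insert N {1<..<N})" using d by auto
  then have "(\<Sum>b=1..N. (-1) ^ p b) = 2 * (-1) ^ p 1 + (\<Sum>b\<in>{1<..<N}. (-1) ^ p b :: int)"
    using d p_dual[of 1] by simp
  then show ?thesis using sum_parity p_cases[OF d(3)] s_pos d by (auto simp: rexp_def)
qed

section \<open>Matrix entries of the R-matrix\<close>

abbreviation Qrho :: "nat \<Rightarrow> L" where "Qrho i \<equiv> emb (qpow (form rho (eps i)))"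

lemma Qrho_eq: "i \<in> {1..N} \<Longrightarrow> Qrho i = emb qhalf powi rexp i"
  by (simp add: form_rho_eps qpow_half_int)

sublocale rm: osp_rmatrix N "\<lambda>i. odd (p i)" "\<lambda>i. of_int (vt i)" Qrho "emb qhalf"
proof
  show "emb qhalf \<noteq> 0" using qhalf_nonzero by simp
  fix i assume i: "i \<in> {1..N}"
  show "of_int (vt i) \<in> {1, - 1 :: L}" using sign[of i] i by (auto simp: N_def)
  show "odd (p (N + 1 - i)) = odd (p i)" using p_dual[OF i] by (simp add: dual_def)
  show "of_int (vt (N + 1 - i)) = (if odd (p i) then - of_int (vt i) else of_int (vt i) :: L)"
    using vt_dual[OF i] p_cases[OF i] by (auto simp: dual_def)
  show "Qrho i \<noteq> 0" using qhalf_nonzero by (simp add: Qrho_eq[OF i])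
  show "Qrho (N + 1 - i) = 1 / Qrho i"
    using rexp_dual[OF i] dual_in[OF i] unfolding dual_def[symmetric]
    by (simp only: Qrho_eq[OF i] Qrho_eq power_int_minus_divide)
qed

lemma dl_dual: "rm.dl = dual"
  by (simp add: fun_eq_iff rm.dl_def dual_def)

lemma sn_power: "i \<in> {1..N} \<Longrightarrow> j \<in> {1..N} \<Longrightarrow> (-1) ^ (p i * p j) = rm.sn (odd (p i)) (odd (p j))"
  using p_cases[of i] p_cases[of j] by (auto simp: rm.sn_def)

lemma sgn_q_eq:
  assumes "i \<in> {1..N}" "j \<in> {1..N}"
  shows "sgn_q i j = of_int (vt i) * of_int (vt j) * Qrho i / Qrho j"
proof -
  have "form rho (\<lambda>k. eps i k - eps j k) = of_int (rexp i - rexp j) / 2"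
    by (simp add: form_diff form_rho_eps[OF assms(1)] form_rho_eps[OF assms(2)] diff_divide_distrib)
  then have "emb (qpow (form rho (\<lambda>k. eps i k - eps j k))) = emb qhalf powi (rexp i - rexp j)"
    by (simp only: qpow_half_int emb_powi)
  then show ?thesis
    using qhalf_nonzero by (simp add: sgn_q_def Qrho_eq[OF assms(1)] Qrho_eq[OF assms(2)] power_int_diff)
qed

lemma form_eps_eps:
  assumes "k \<in> {1..N}"
  shows "form (eps k) (eps k) = (if dual k = k then 0 else (-1) ^ p k)"
proof -
  have 1: "form (eps i) (eps i) = (-1) ^ p i" if "i \<in> {1..s}" for i
    using form_eps[OF that, of "eps i"] that N_s by (auto simp: eps_def dual_def split: if_splits)
  have sym: "form (\<lambda>k. - x k) (\<lambda>k. - x k) = form x x" for x by (simp add: form_def)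
  show ?thesis
  proof (cases "k \<le> s")
    case True
    then have "dual k \<noteq> k" using assms N_s by (auto simp: dual_def split: if_splits)
    then show ?thesis using 1[of k] True assms by simp
  next
    case F: False
    show ?thesis
    proof (cases "dual k \<le> s")
      case True
      then have d: "dual k \<in> {1..s}" "dual k \<noteq> k" using dual_in[OF assms] F by auto
      have "form (eps k) (eps k) = form (eps (dual k)) (eps (dual k))"
        unfolding eps_dual[OF assms] sym ..
      then show ?thesis using 1[OF d(1)] d(2) p_dual[OF assms] by simp
    next
      case False
      then have "dual k = k" using F assms N_s by (auto simp: dual_def split: if_splits)
      moreover have "eps k = (\<lambda>k. 0)" using F False by (auto simp: eps_def fun_eq_iff dual_def)
      ultimately show ?thesis by (simp add: form_def)
    qed
  qed
qed

lemma hh_eq: "rm.hh = emb (qq - inverse qq)"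
  by (simp add: rm.hh_def qq_def divide_inverse)

lemma qpow_values: "qpow 0 = 1" "qpow (1 / 2) = qhalf" "qpow (- 1 / 2) = inverse qhalf" "qpow (- (1 / 2)) = inverse qhalf"
  using qpow_half_int[of 0] qpow_half_int[of 1] qpow_half_int[of "-1"] by simp_all

text \<open>q = 1 + (\<open>q^(1/2)\<close> - \<open>q^(-1/2)\<close>) \<open>q^(1/2)\<close>, and
  similarly for 1/q, turn the additive terms of the first sum in \<open>R\<close> into powers of q.
  At the middle index the two matrix units coincide and cancel.\<close>

lemma Dg_eq:
  assumes k: "k \<in> {1..N}" and l: "l \<in> {1..N}"
  shows "rm.Dg k l = 1 + (emb qhalf - inverse (emb qhalf)) * ((-1) ^ p k *
     (emb (qpow (form (eps k) (eps k) / 2)) * (if l = k then 1 else 0) - emb (qpow (- form (eps k) (eps k) / 2)) * (if l = dual k then 1 else 0)))"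
proof -
  define T where "T = emb qhalf"
  have dg: "rm.Dg k l = (if l = dual k then (if k = l then 1 else 1 / (if odd (p k) then 1 / T else T)\<^sup>2)
      else if k = l then (if odd (p k) then 1 / T else T)\<^sup>2 else 1)"
    by (simp only: rm.Dg_def rm.tp_def dl_dual T_def)
  have q: "T \<noteq> 0" using qhalf_nonzero by (simp add: T_def)
  have sq: "T\<^sup>2 = 1 + (T - inverse T) * T" "1 / T\<^sup>2 = 1 - (T - inverse T) * inverse T"
    using q by (simp_all add: power2_eq_square left_diff_distrib divide_inverse)
  show ?thesis
  proof (cases "dual k = k")
    case True
    then show ?thesis unfolding form_eps_eps[OF k] rm.Dg_def dl_dual by (simp add: qpow_values rm.tp_def)
  next
    case False
    consider "p k = 0" | "p k = 1" using p_cases[OF k] by (elim disjE)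
    then show ?thesis
    proof cases
      case 1
      then have f: "form (eps k) (eps k) = 1" using form_eps_eps[OF k] False by simp
      show ?thesis using False 1 sq unfolding f dg
        by (cases "l = k"; cases "l = dual k") (simp_all add: qpow_values T_def[symmetric])
    next
      case 2
      then have f: "form (eps k) (eps k) = - 1" using form_eps_eps[OF k] False by simp
      have "(1 / T)\<^sup>2 = 1 / T\<^sup>2" "1 / (1 / T)\<^sup>2 = T\<^sup>2" by (simp_all add: power_divide)
      then show ?thesis using False 2 sq unfolding f dg
        by (cases "l = k"; cases "l = dual k") (simp_all add: qpow_values T_def[symmetric])
    qed
  qed
qed

lemma gtensor_unit:
  "gtensor (munit a b) Y (j, i) (k, l) = (if j = a \<and> k = b then (-1) ^ ((p i + p l) * p b) * Y i l else 0)"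
  by (auto simp: gtensor_def munit_def)

text \<open>The left-hand side is what composition with \<open>tau\<close> makes of row (i, j). For
  a fixed entry each sum over matrix units in \<open>R\<close> collapses to the one summand
  prescribed by the row and the column.\<close>

lemma R_entry:
  assumes i: "i \<in> {1..N}" and j: "j \<in> {1..N}" and k: "k \<in> {1..N}" and l: "l \<in> {1..N}" and z: "z \<noteq> 1"
  shows "(-1) ^ (p i * p j) * R z (j, i) (k, l) = rm.Rh z crit i j k l"
proof -
  let ?h = "emb (qq - inverse qq)"
  let ?sg = "(-1) ^ (p i * p j) :: L"
  have s1: "(\<Sum>a=1..N. (-1) ^ p a * gtensor (munit a a)
              (\<lambda>k l. emb (qpow (form (eps a) (eps a) / 2)) * munit a a k l
                    - emb (qpow (- form (eps a) (eps a) / 2)) * munit (dual a) (dual a) k l) (j, i) (k, l))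
     = (if j = k \<and> i = l then (-1) ^ p k * (emb (qpow (form (eps k) (eps k) / 2)) * (if l = k then 1 else 0)
         - emb (qpow (- form (eps k) (eps k) / 2)) * (if l = dual k then 1 else 0)) else 0)" (is "?S1 = ?T1")
  proof -
    have "?S1 = (\<Sum>a=1..N. if a = k then ?T1 else 0)"
      unfolding gtensor_unit by (rule sum.cong[OF refl]) (auto simp: munit_def)
    then show ?thesis using k by simp
  qed
  have s2: "(\<Sum>(a, b) \<in> {(a, b). a \<in> {1..N} \<and> b \<in> {1..N} \<and> a > b}.
              (-1) ^ p b * gtensor (munit a b)
              (\<lambda>k l. munit b a k l
                    - (-1) ^ (p b * (p a + p b)) * sgn_q a b * munit (dual a) (dual b) k l) (j, i) (k, l))
     = (if k < j then (if i = k \<and> l = j then (-1) ^ (p k * p j) else 0)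
         - (if i = dual j \<and> l = dual k then (-1) ^ p k * sgn_q j k else 0) else 0)" (is "?S2 = ?T2")
  proof -
    have pj: "p (dual j) = p j" "p (dual k) = p k" using p_dual j k by auto
    let ?I = "{(a, b). a \<in> {1..N} \<and> b \<in> {1..N} \<and> a > b}"
    have fin: "finite ?I" by (rule finite_subset[of _ "{1..N} \<times> {1..N}"]) auto
    have "?S2 = (\<Sum>x\<in>?I. if x = (j, k) then ?T2 else 0)"
    proof (rule sum.cong[OF refl], clarify)
      fix a b assume ab: "a \<in> {1..N}" "b \<in> {1..N}" "b < a"
      have pc: "p j = 0 \<or> p j = 1" "p k = 0 \<or> p k = 1" using p_cases j k by auto
      show "(-1) ^ p b * gtensor (munit a b)
              (\<lambda>k l. munit b a k l
                    - (-1) ^ (p b * (p a + p b)) * sgn_q a b * munit (dual a) (dual b) k l) (j, i) (k, l)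
          = (if (a, b) = (j, k) then ?T2 else 0)"
      proof (cases "a = j \<and> b = k")
        case True
        have sg: "(-1) ^ p k * (-1) ^ ((p i + p l) * p k) = ((-1) ^ (p k * p j) :: L)" if "i = k \<and> l = j"
        proof -
          have "p i = p k" "p l = p j" using that by auto
          then show ?thesis using pc by auto
        qed
        have sg': "(-1) ^ p k * ((-1) ^ ((p i + p l) * p k) * (-1) ^ (p k * (p j + p k))) = ((-1) ^ p k :: L)"
          if "i = dual j \<and> l = dual k"
        proof -
          have "p i = p j" "p l = p k" using that pj by auto
          then show ?thesis using pc by auto
        qed
        have e1: "(-1) ^ p k * ((-1) ^ ((p i + p l) * p k) * (if i = k \<and> l = j then 1 else 0))
           = (if i = k \<and> l = j then (-1) ^ (p k * p j) else 0 :: L)"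
          using sg by (simp add: mult.assoc[symmetric])
        have e2: "(-1) ^ p k * ((-1) ^ ((p i + p l) * p k) * ((-1) ^ (p k * (p j + p k)) * sgn_q j k * (if i = dual j \<and> l = dual k then 1 else 0)))
           = (if i = dual j \<and> l = dual k then (-1) ^ p k * sgn_q j k else 0)"
          using sg' by (simp add: mult.assoc[symmetric])
        have "(-1) ^ p k * ((-1) ^ ((p i + p l) * p k) * ((if i = k \<and> l = j then 1 else 0)
           - (-1) ^ (p k * (p j + p k)) * sgn_q j k * (if i = dual j \<and> l = dual k then 1 else 0)))
           = (if i = k \<and> l = j then (-1) ^ (p k * p j) else 0)
         - (if i = dual j \<and> l = dual k then (-1) ^ p k * sgn_q j k else 0)"
          unfolding right_diff_distrib e1 e2 ..
        moreover have "k < j" using True ab by simp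
        ultimately show ?thesis using True unfolding gtensor_unit unfolding munit_def by (simp only: if_True simp_thms)
      next
        case False
        then have "(j = a \<and> k = b) = False" "((a, b) = (j, k)) = False" by auto
        then show ?thesis unfolding gtensor_unit by (simp only: if_False mult_zero_right)
      qed
    qed
    also have "\<dots> = ?T2" using fin j k by simp
    finally show ?thesis .
  qed
  have s3: "(\<Sum>a=1..N. \<Sum>b=1..N. (-1) ^ (p a * p b) * sgn_q a b
           * gtensor (munit a b) (munit (dual a) (dual b)) (j, i) (k, l))
     = (if i = dual j \<and> l = dual k then (-1) ^ p k * sgn_q j k else 0)" (is "?S3 = ?T3")
  proof -
    have pj: "p (dual j) = p j" "p (dual k) = p k" using p_dual j k by auto
    have pc: "p j = 0 \<or> p j = 1" "p k = 0 \<or> p k = 1" using p_cases j k by auto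
    have "?S3 = (\<Sum>a=1..N. \<Sum>b=1..N. if b = k then if a = j then ?T3 else 0 else 0)"
      unfolding gtensor_unit by (intro sum.cong refl) (use pc pj in \<open>auto simp: munit_def\<close>)
    also have "\<dots> = ?T3" using j k by simp
    finally show ?thesis .
  qed
  have tau: "tau (j, i) (k, l) = (if i = k \<and> j = l then (-1) ^ (p k * p l) else 0)"
    by (auto simp: tau_def)
  have pc: "p j = 0 \<or> p j = 1" "p k = 0 \<or> p k = 1" "p i = 0 \<or> p i = 1" using p_cases i j k by auto
  \<comment> \<open>The K-type entry that the ordered sum and the last sum of \<open>R\<close> have
    in common.\<close>
  define W where "W = (if i = dual j \<and> l = dual k then (-1) ^ (p k + p j) * sgn_q j k else 0)"
  define I1 where "I1 = (if i = l \<and> j = k then 1 else 0 :: L)"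
  define I2 where "I2 = (if i = k \<and> j = l then 1 else 0 :: L)"
  have A: "?sg * ((if (j, i) = (k, l) then 1 else 0) + emb (qhalf - inverse qhalf) *
      (if j = k \<and> i = l then (-1) ^ p k * (emb (qpow (form (eps k) (eps k) / 2)) * (if l = k then 1 else 0)
         - emb (qpow (- form (eps k) (eps k) / 2)) * (if l = dual k then 1 else 0)) else 0))
      = rm.sn (odd (p k)) (odd (p l)) * rm.Dg k l * I1"
  proof (cases "i = l \<and> j = k")
    case True
    then have "?sg = rm.sn (odd (p k)) (odd (p l))" using sn_power[OF k l] by (simp add: mult.commute)
    moreover have "((j, i) = (k, l)) = True" "(j = k \<and> i = l) = True" "I1 = 1" using True by (auto simp: I1_def)
    ultimately show ?thesis unfolding Dg_eq[OF k l] by (simp only: if_True emb_simps emb_inverse mult_1_right)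
  next
    case False
    then have "((j, i) = (k, l)) = False" "(j = k \<and> i = l) = False" "I1 = 0" by (auto simp: I1_def)
    then show ?thesis by (simp only: if_False mult_zero_right add_0)
  qed
  have c: "i = l \<and> j = k \<Longrightarrow> p i = p l" "i = k \<and> l = j \<Longrightarrow> p i = p k" "i = dual j \<and> l = dual k \<Longrightarrow> p i = p j"
    using p_dual[OF j] by auto
  have one: "(-1) ^ e * (-1) ^ e = (1 :: L)" for e :: nat by (simp flip: power_add)
  have B1: "?sg * (if i = k \<and> l = j then (-1) ^ (p k * p j) else 0) = I2"
  proof (cases "i = k \<and> l = j")
    case True
    then have "I2 = 1" by (simp add: I2_def)
    then show ?thesis using True c(2) by (simp only: if_True simp_thms one)
  next
    case False
    then have "I2 = 0" by (auto simp: I2_def)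
    then show ?thesis using False by (simp only: if_False mult_zero_right)
  qed
  have C: "?sg * (if i = dual j \<and> l = dual k then (-1) ^ p k * sgn_q j k else 0) = W"
  proof (cases "i = dual j \<and> l = dual k")
    case True
    have "(-1) ^ (p j * p j) * (-1) ^ p k = ((-1) ^ (p k + p j) :: L)" using pc(1) by auto
    then show ?thesis using True c(3) unfolding W_def by (simp only: if_True simp_thms mult.assoc[symmetric])
  next
    case False
    then show ?thesis unfolding W_def by (simp only: if_False mult_zero_right)
  qed
  have B: "?sg * (if k < j then (if i = k \<and> l = j then (-1) ^ (p k * p j) else 0)
         - (if i = dual j \<and> l = dual k then (-1) ^ p k * sgn_q j k else 0) else 0)
      = (if k < j then I2 - W else 0)"
    by (cases "k < j") (simp_all only: if_True if_False right_diff_distrib B1 C mult_zero_right)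
  have T: "?sg * tau (j, i) (k, l) = I2"
  proof (cases "i = k \<and> j = l")
    case True
    then have "I2 = 1" "(-1) ^ (p k * p l) = ?sg" by (auto simp: I2_def)
    then show ?thesis using True unfolding tau by (simp only: if_True simp_thms one)
  next
    case False
    then have "I2 = 0" by (simp add: I2_def)
    then show ?thesis using False unfolding tau by (simp only: if_False mult_zero_right)
  qed
  have ij: "(i = dual j \<and> l = dual k) = (l = dual k \<and> j = dual i)"
    using dual_dual i j by metis
  have W: "W = (if l = dual k \<and> j = dual i then rm.gg k * of_int (vt i) / Qrho i else 0)"
  proof (cases "l = dual k \<and> j = dual i")
    case True
    then have j': "j = dual i" by simp
    have "(-1) ^ (p k + p j) * sgn_q j k = rm.gg k * of_int (vt i) / Qrho i"
      using pc vt_dual[OF i] p_dual[OF i] rm.Q_dl[OF i, unfolded dl_dual]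
      unfolding sgn_q_eq[OF j k] unfolding j' rm.gg_def rm.sn_def
      by (auto simp: mult_ac)
    then show ?thesis unfolding W_def ij using True by simp
  next
    case False
    then show ?thesis unfolding W_def ij by (simp only: if_False)
  qed
  have z1: "z - 1 \<noteq> 0" using z by simp
  define d where "d = (z - crit) / (z - 1)"
  \<comment> \<open>This merges the diagonal term of the ordered sum with the \<open>tau\<close>
    term: for k < j their coefficients add up to h d z.\<close>
  have d: "d * z = z - crit + d" using z1 by (simp add: d_def field_simps)
  define h where "h = ?h"
  have hd: "h * d * z = h * (z - crit) + h * d" by (simp only: mult.assoc d distrib_left)
  have r: "(-1) ^ (p i * p j) * (\<alpha> * (x1 + x2 * x3 + h * x4) + h * d * x5 - h * crit * x6)
     = \<alpha> * ((-1) ^ (p i * p j) * (x1 + x2 * x3) + h * ((-1) ^ (p i * p j) * x4)) + h * d * ((-1) ^ (p i * p j) * x5) - h * crit * ((-1) ^ (p i * p j) * x6)"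
    for \<alpha> x1 x2 x3 x4 x5 x6 :: L
    by (simp only: ring_distribs mult_ac)
  have "?sg * R z (j, i) (k, l) = (z - crit) * (?sg * ((if (j, i) = (k, l) then 1 else 0) + emb (qhalf - inverse qhalf) * ?T1)
      + h * (?sg * ?T2)) + h * d * (?sg * tau (j, i) (k, l)) - h * crit * (?sg * ?T3)"
    unfolding R_def s1 s2 s3 d_def[symmetric] h_def[symmetric] by (rule r)
  also have "\<dots> = (z - crit) * (rm.sn (odd (p k)) (odd (p l)) * rm.Dg k l * I1 + h * (if k < j then I2 - W else 0)) + h * d * I2 - h * crit * W"
    unfolding A B C T ..
  also have "\<dots> = (z - crit) * (rm.sn (odd (p k)) (odd (p l)) * rm.Dg k l) * I1
      + (h * d * (if k < j then z else 1)) * I2 - h * (if k < j then z else crit) * W"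
    by (cases "k < j") (simp_all only: if_True if_False hd, simp_all add: algebra_simps)
  also have "\<dots> = (z - crit) * (rm.sn (odd (p k)) (odd (p l)) * rm.Dg k l) * I1
      + (h * d * (if k < l then z else 1)) * I2 - h * (if k < j then z else crit) * W"
  proof -
    have "(h * d * (if k < j then z else 1)) * I2 = (h * d * (if k < l then z else 1)) * I2"
      unfolding I2_def by (cases "i = k \<and> j = l") (simp_all only: if_True if_False mult_zero_right simp_thms)
    then show ?thesis by (simp only:)
  qed
  also have "h * (if k < j then z else crit) * W = (if l = rm.dl k \<and> j = rm.dl i then rm.hh * rm.gg k * (if k < j then z else crit) * of_int (vt i) / Qrho i else 0)"
  proof (cases "l = dual k \<and> j = dual i")
    case True
    then have e: "(l = dual k \<and> j = dual i) = True" by simp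
    show ?thesis unfolding W hh_eq dl_dual h_def[symmetric] e by (simp only: if_True times_divide_eq_right mult_ac)
  next
    case False
    then have e: "(l = dual k \<and> j = dual i) = False" by simp
    show ?thesis unfolding W hh_eq dl_dual h_def[symmetric] e by (simp only: if_False mult_zero_right)
  qed
  also have "h * d = rm.hh * (z - crit) / (z - 1)"
    unfolding hh_eq h_def d_def by (simp only: times_divide_eq_right)
  also have "I1 = rm.ut l k i j" unfolding I1_def rm.ut_def ..
  also have "I2 = rm.ut k l i j" unfolding I2_def rm.ut_def ..
  finally show ?thesis unfolding rm.Rh_def rm.M4_def .
qed

end

section \<open>Root vectors of the generators\<close>

text \<open>For roots of the form 2 eps_a, \<open>root_mat\<close> is twice the matrix unit, so that
  2 has to be inverted.\<close>

lemma two_nonzero: "(2 :: L) \<noteq> 0"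
proof -
  have "(2 :: K) = to_fract 2" using to_fract_add[of "1 :: complex poly" 1] by simp
  then have "(2 :: K) \<noteq> 0" using to_fract_eq_0_iff[of "2 :: complex poly"] by (metis zero_neq_numeral)
  then show ?thesis using emb_eq_0_iff[of 2] by simp
qed

context osp_data begin

text \<open>Up to \<open>\<delta>\<close>, \<open>\<alpha>\<^sub>i\<close> is \<open>\<epsilon>\<^sub>a - \<epsilon>\<^sub>b\<close> with \<open>a = root_fst i\<close> and \<open>b = root_snd i\<close>.\<close>

definition root_fst :: "nat \<Rightarrow> nat" where
  "root_fst i = (if i = 0 then if p 1 = 0 then dual 2 else N
    else if odd m \<or> i < s then i else if p s = 0 then s - 1 else s)"

definition root_snd :: "nat \<Rightarrow> nat" where
  "root_snd i = (if i = 0 then 1 else if odd m \<or> i < s then i + 1 else s + 1)"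

lemma gen_cases:
  assumes "i \<le> s"
  obtains (aff_even) "i = 0" "p 1 = 0" "root_fst i = dual 2" "root_snd i = 1"
    | (aff_odd) "i = 0" "p 1 = 1" "root_fst i = N" "root_snd i = 1"
    | (simple) "i \<noteq> 0" "odd m \<or> i < s" "root_fst i = i" "root_snd i = i + 1"
    | (fork) "i = s" "i \<noteq> 0" "even m" "p s = 0" "root_fst i = s - 1" "root_snd i = s + 1"
    | (long) "i = s" "i \<noteq> 0" "even m" "p s = 1" "root_fst i = s" "root_snd i = s + 1"
proof -
  have s: "s \<in> {1..N}" "1 \<in> {1..N}" "s \<noteq> 0" using s_pos N_s N_gt_2 by auto
  consider "i = 0" "p 1 = 0" | "i = 0" "p 1 = 1" | "i \<noteq> 0" "odd m \<or> i < s"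
    | "i = s" "i \<noteq> 0" "even m" "p s = 0" | "i = s" "i \<noteq> 0" "even m" "p s = 1"
    using assms p_cases[OF s(1)] p_cases[OF s(2)] s(3) by fastforce
  then show ?thesis
    by cases (use that s(3) in \<open>simp_all add: root_fst_def root_snd_def\<close>)
qed

lemma root_in:
  assumes "i \<le> s" shows "root_fst i \<in> {1..N}" "root_snd i \<in> {1..N}"
  using assms s_pos N_s N_gt_2 unfolding root_fst_def root_snd_def dual_def by auto

lemma palpha_parity:
  assumes "i \<le> s"
  shows "odd (palpha i) = (odd (p (root_fst i)) \<noteq> odd (p (root_snd i)))"
proof -
  have N: "2 \<in> {1..N}" "1 \<in> {1..N}" "dual 1 = N" using N_gt_2 by (auto simp: dual_def)
  have "even m \<Longrightarrow> dual s = s + 1" "s \<in> {1..N}" using N_s s_pos by (auto simp: dual_def)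
  then have ps: "even m \<Longrightarrow> p (s + 1) = p s" using p_dual[of s] by simp
  from assms show ?thesis
  proof (cases rule: gen_cases)
    case aff_even then show ?thesis using p_dual[OF N(1)] unfolding palpha_def by auto
  next case aff_odd then show ?thesis using p_dual[OF N(2)] N(3) unfolding palpha_def by auto
  next case simple then show ?thesis unfolding palpha_def by auto
  next case fork then show ?thesis using ps unfolding palpha_def by auto
  next case long then show ?thesis using ps unfolding palpha_def by auto
  qed
qed

lemma emb_Xm:
  assumes "a \<in> {1..N}" "b \<in> {1..N}"
  shows "emb (Xm a b k l) = rm.root_mat a b k l"
proof -
  have "emb ((-1) ^ (p a * (p a + p b))) = rm.sn (odd (p a)) (odd (p a) \<noteq> odd (p b))"
    using p_cases[OF assms(1)] p_cases[OF assms(2)] by (auto simp: rm.sn_def)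
  then show ?thesis
    unfolding Xm_def rm.root_mat_def munit_def dl_dual emb_simps emb_if emb_of_int of_int_mult
    by (cases "k = dual b \<and> l = dual a") (simp_all only: if_True if_False mult_zero_right mult_1_right mult.assoc simp_thms)
qed

definition wt :: "nat \<Rightarrow> nat \<Rightarrow> int" where
  "wt a k = (if k = a then 1 else 0) - (if k = dual a then 1 else 0)"

lemma Xm_diag:
  assumes "a \<in> {1..N}" shows "Xm a a k k = (of_int (wt a k) :: rat)"
proof -
  have "vt a * vt a = 1" using sign[of a] assms by (auto simp: N_def)
  then show ?thesis by (simp add: Xm_def munit_def wt_def minus_one_power_iff)
qed

lemma wt_dual: "a \<in> {1..N} \<Longrightarrow> wt (dual a) k = - wt a k"
  by (simp add: wt_def dual_dual)

text \<open>Half of (alpha_i, eps_k) in terms of the index pair. One formula for all five shapes of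
  h_i is what allows a comparison with \<open>root_wt\<close>.\<close>

lemma half_h_diag:
  assumes i: "i \<le> s"
  shows "half_h i k k = of_int ((-1) ^ p (root_fst i) * wt (root_fst i) k - (-1) ^ p (root_snd i) * wt (root_snd i) k) / 2"
proof -
  have N: "2 \<in> {1..N}" "1 \<in> {1..N}" "dual 1 = N" "s \<in> {1..N}" "s + 1 \<in> {1..N}" using N_gt_2 N_s s_pos by (auto simp: dual_def)
  have ds: "even m \<Longrightarrow> dual s = s + 1" using N_s by (simp add: dual_def)
  have ps: "even m \<Longrightarrow> p (s + 1) = p s" using p_dual[of s] N ds by simp
  from i show ?thesis
  proof (cases rule: gen_cases)
    case aff_even
    then show ?thesis using p_dual[OF N(1)] wt_dual[OF N(1)] Xm_diag[OF N(1)] Xm_diag[OF N(2)]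
      by (simp add: half_h_def field_simps)
  next
    case aff_odd
    then show ?thesis using p_dual[OF N(2)] wt_dual[OF N(2)] Xm_diag[OF N(2)] N(3) by (simp add: half_h_def)
  next
    case simple
    have "i \<in> {1..N}" "i + 1 \<in> {1..N}" using simple i N by auto
    then show ?thesis using simple by (simp add: half_h_def h_mat_def Xm_diag)
  next
    case fork
    have "s - 1 \<in> {1..N}" using fork N s_pos by auto
    then show ?thesis using fork Xm_diag[OF N(5)] by (simp add: half_h_def h_mat_def Xm_diag)
  next
    case long
    have "wt (s + 1) k = - wt s k" using wt_dual[OF N(4)] ds long by simp
    then show ?thesis using long ps Xm_diag[OF N(4)] by (simp add: half_h_def h_mat_def)
  qed
qed

lemma tp_powi: "rm.tp a = emb qhalf powi ((-1) ^ p a)"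
  by (simp add: rm.tp_def power_int_minus divide_inverse)

lemma root_wt_powi:
  assumes "a \<in> {1..N}" "b \<in> {1..N}"
  shows "rm.root_wt a b k = emb qhalf powi ((-1) ^ p a * wt a k - (-1) ^ p b * wt b k)"
proof -
  define T where "T = emb qhalf"
  have T: "T \<noteq> 0" using qhalf_nonzero by (simp add: T_def)
  have 1: "(if k = a then T powi ((-1) ^ p a) else 1) * (if k = dual a then 1 / T powi ((-1) ^ p a) else 1)
     = T powi ((-1) ^ p a * wt a k)" for a
    using T by (auto simp: wt_def power_int_minus divide_inverse)
  have 2: "(if k = b then 1 / T powi ((-1) ^ p b) else 1) * (if k = dual b then T powi ((-1) ^ p b) else 1)
     = T powi (- ((-1) ^ p b * wt b k))" for b
    using T by (auto simp: wt_def power_int_minus divide_inverse)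
  have "rm.root_wt a b k = (if k = a then T powi ((-1) ^ p a) else 1) * (if k = dual a then 1 / T powi ((-1) ^ p a) else 1)
    * ((if k = b then 1 / T powi ((-1) ^ p b) else 1) * (if k = dual b then T powi ((-1) ^ p b) else 1))"
    unfolding rm.root_wt_def tp_powi dl_dual T_def by (simp only: mult.assoc)
  also have "\<dots> = T powi ((-1) ^ p a * wt a k - (-1) ^ p b * wt b k)"
    unfolding 1 2 using T by (simp add: power_int_add[symmetric])
  finally show ?thesis unfolding T_def .
qed

lemma qdiag_half_h:
  assumes i: "i \<le> s"
  shows "emb (qdiag (half_h i) k l) = (if k = l then rm.root_wt (root_fst i) (root_snd i) k else 0)"
    "emb (qdiag (\<lambda>k l. - half_h i k l) k l) = (if k = l then 1 / rm.root_wt (root_fst i) (root_snd i) k else 0)"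
proof -
  let ?e = "(-1) ^ p (root_fst i) * wt (root_fst i) k - (-1) ^ p (root_snd i) * wt (root_snd i) k"
  have "qpow (half_h i k k) = qhalf powi ?e"
    unfolding half_h_diag[OF i] by (rule qpow_half_int)
  then show "emb (qdiag (half_h i) k l) = (if k = l then rm.root_wt (root_fst i) (root_snd i) k else 0)"
    unfolding root_wt_powi[OF root_in[OF i]] qdiag_def by (simp only: emb_powi[symmetric] emb_if emb_simps(1))
  have "qpow (- half_h i k k) = qhalf powi (- ?e)"
    unfolding half_h_diag[OF i] minus_divide_left of_int_minus[symmetric] by (rule qpow_half_int)
  then have "emb (qpow (- half_h i k k)) = 1 / rm.root_wt (root_fst i) (root_snd i) k"
    unfolding root_wt_powi[OF root_in[OF i]] by (simp only: emb_powi power_int_minus_divide emb_divide emb_simps)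
  then show "emb (qdiag (\<lambda>k l. - half_h i k l) k l) = (if k = l then 1 / rm.root_wt (root_fst i) (root_snd i) k else 0)"
    unfolding qdiag_def by (cases "k = l") simp_all
qed

definition e_gen :: "nat \<Rightarrow> K mtx" where "e_gen i = (if i = 0 then e0_mat else e_mat i)"
definition f_gen :: "nat \<Rightarrow> K mtx" where "f_gen i = (if i = 0 then f0_mat else (\<lambda>k l. kappa i * f_mat i k l))"

lemma root_mat_long:
  assumes "a \<in> {1..N}" "p a = 1" shows "rm.root_mat a (dual a) k l = 2 * emb (munit a (dual a) k l)"
proof -
  have "vt a * vt a = 1" using sign[of a] assms by (auto simp: N_def)
  then have "of_int (vt a) * of_int (vt a) = (1 :: L)" by (metis of_int_1 of_int_mult)
  then show ?thesis
    using dual_dual[OF assms(1)] p_dual[OF assms(1)] vt_dual[OF assms(1)] assms(2)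
    unfolding rm.root_mat_def dl_dual rm.sn_def munit_def by simp
qed

text \<open>The intertwining equation is homogeneous in the matrix, so proportionality to a root
  vector is enough. The factor absorbs the signs, \<open>kappa\<close> and the 2 from
  \<open>root_mat_long\<close>.\<close>

lemma gen_matrix:
  assumes i: "i \<le> s"
  shows "\<exists>\<alpha>. \<forall>k l. emb (e_gen i k l) = \<alpha> * rm.root_mat (root_fst i) (root_snd i) k l"
    and "\<exists>\<alpha>. \<forall>k l. emb (f_gen i k l) = \<alpha> * rm.root_mat (root_snd i) (root_fst i) k l"
proof -
  have N: "2 \<in> {1..N}" "1 \<in> {1..N}" "N \<in> {1..N}" "dual 1 = N" "dual N = 1" "s \<in> {1..N}" "s + 1 \<in> {1..N}" using N_gt_2 N_s s_pos by (auto simp: dual_def)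
  have d2: "dual 2 \<in> {1..N}" using dual_in[OF N(1)] .
  have ds: "even m \<Longrightarrow> dual s = s + 1" "even m \<Longrightarrow> dual (s + 1) = s" using N_s by (simp_all add: dual_def)
  have ps: "even m \<Longrightarrow> p (s + 1) = p s" using p_dual[of s] N ds by simp
  have pN: "p N = p 1" using p_dual[OF N(2)] N(4) by simp
  have half: "x = inverse 2 * (2 * x)" for x :: L using two_nonzero by simp
  have "(\<exists>\<alpha>. \<forall>k l. emb (e_gen i k l) = \<alpha> * rm.root_mat (root_fst i) (root_snd i) k l) \<and>
    (\<exists>\<alpha>. \<forall>k l. emb (f_gen i k l) = \<alpha> * rm.root_mat (root_snd i) (root_fst i) k l)"
    using i
  proof (cases rule: gen_cases)
    case aff_even
    have e: "e_gen i = Xm (dual 2) 1" "f_gen i = Xm 1 (dual 2)" using aff_even by (simp_all add: e_gen_def f_gen_def e0_mat_def f0_mat_def)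
    show ?thesis unfolding e aff_even(3,4) emb_Xm[OF d2 N(2)] emb_Xm[OF N(2) d2] by (intro conjI exI[of _ 1]) simp_all
  next
    case aff_odd
    have e: "e_gen i = munit N 1" "f_gen i = munit 1 N"
      using aff_odd N(4) by (simp_all add: e_gen_def f_gen_def e0_mat_def f0_mat_def)
    have "rm.root_mat N 1 k l = 2 * emb (munit N 1 k l)" "rm.root_mat 1 N k l = 2 * emb (munit 1 N k l)" for k l
      using root_mat_long[OF N(3), of k l] root_mat_long[OF N(2), of k l] aff_odd pN N(4,5) by auto
    then show ?thesis unfolding e aff_odd(3,4) using half by metis
  next
    case simple
    have *: "i \<in> {1..N}" "i + 1 \<in> {1..N}" using simple i N by auto
    have e: "e_gen i k l = Xm i (i + 1) k l" "f_gen i k l = kappa i * (-1) ^ p i * Xm (i + 1) i k l" for k l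
      using simple by (simp_all add: e_gen_def f_gen_def e_mat_def f_mat_def)
    show ?thesis unfolding e simple(3,4) emb_simps(4) emb_Xm[OF *] emb_Xm[OF *(2,1)]
      by (intro conjI exI[of _ 1] exI[of _ "emb (kappa i) * emb ((-1) ^ p i)"]) simp_all
  next
    case fork
    have *: "s - 1 \<in> {1..N}" "s + 1 \<in> {1..N}" using fork s_pos N by auto
    have e: "e_gen i k l = Xm (s - 1) (s + 1) k l" "f_gen i k l = kappa i * (-1) ^ p (s - 1) * Xm (s + 1) (s - 1) k l" for k l
      using fork by (simp_all add: e_gen_def f_gen_def e_mat_def f_mat_def)
    show ?thesis unfolding e fork(5,6) emb_simps(4) emb_Xm[OF *] emb_Xm[OF *(2,1)]
      by (intro conjI exI[of _ 1] exI[of _ "emb (kappa i) * emb ((-1) ^ p (s - 1))"]) simp_all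
  next
    case long
    have e: "e_gen i k l = munit s (s + 1) k l" "f_gen i k l = kappa i * (- 2) * munit (s + 1) s k l" for k l
      using long by (simp_all add: e_gen_def f_gen_def e_mat_def f_mat_def)
    have r: "rm.root_mat s (s + 1) k l = 2 * emb (munit s (s + 1) k l)" "rm.root_mat (s + 1) s k l = 2 * emb (munit (s + 1) s k l)" for k l
      using root_mat_long[OF N(6), of k l] root_mat_long[OF N(7), of k l] long ps ds by auto
    show ?thesis unfolding e long(5,6) r emb_simps(4)
      by (intro conjI exI[of _ "inverse 2"] exI[of _ "- emb (kappa i)"]) (simp_all add: two_nonzero)
  qed
  then show "\<exists>\<alpha>. \<forall>k l. emb (e_gen i k l) = \<alpha> * rm.root_mat (root_fst i) (root_snd i) k l"
    "\<exists>\<alpha>. \<forall>k l. emb (f_gen i k l) = \<alpha> * rm.root_mat (root_snd i) (root_fst i) k l" by blast+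
qed

text \<open>The value required of c by the affine root vectors: q^2 if v_1 is odd, 1 if v_1 is
  even.\<close>

lemma crit_Q: "crit * (Qrho 1)\<^sup>2 = (if p 1 = 1 then emb qhalf ^ 4 else 1)"
proof -
  define T where "T = emb qhalf"
  have T: "T \<noteq> 0" using qhalf_nonzero by (simp add: T_def)
  have 1: "1 \<in> {1..N}" using N_gt_2 by simp
  have "qpow (- of_nat m + of_nat n + 2) = qhalf powi (2 * (- int m + int n + 2))"
  proof -
    have "- of_nat m + of_nat n + 2 = of_int (2 * (- int m + int n + 2)) / (2 :: rat)" by simp
    then show ?thesis by (simp only: qpow_half_int)
  qed
  then have "crit = T powi (2 * (- int m + int n + 2))" by (simp add: crit_def T_def del: emb_powi add: emb_powi)
  then have "crit * (Qrho 1)\<^sup>2 = T powi (2 * (- int m + int n + 2) + rexp 1 + rexp 1)"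
  proof -
    have "T powi (x + y + y) = T powi x * (T powi y)\<^sup>2" for x y
      by (simp only: power_int_add[OF disjI1[OF T]] power2_eq_square mult.assoc)
    then show ?thesis unfolding Qrho_eq[OF 1] T_def[symmetric] \<open>crit = _\<close> by (simp only:)
  qed
  also have "2 * (- int m + int n + 2) + rexp 1 + rexp 1 = (if p 1 = 1 then 4 else 0)"
    unfolding rexp_first by simp
  finally show ?thesis unfolding T_def by (auto simp: power_int_def)
qed

lemma Qrho_step:
  assumes "1 \<le> i" "i + 1 \<le> s" shows "Qrho i = Qrho (i + 1) * rm.tp i * rm.tp (i + 1)"
proof -
  have q: "emb qhalf \<noteq> 0" using qhalf_nonzero by simp
  have iN: "i \<in> {1..N}" "i + 1 \<in> {1..N}" using assms N_s by (auto split: if_splits)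
  have r: "rexp i = rexp (i + 1) + (-1) ^ p i + (-1) ^ p (i + 1)"
    using rexp_step[OF assms] p_cases[OF iN(1)] p_cases[OF iN(2)] by auto
  show ?thesis unfolding Qrho_eq[OF iN(1)] Qrho_eq[OF iN(2)] tp_powi r using q by (simp add: power_int_add)
qed

lemma Qrho_last:
  shows "odd m \<Longrightarrow> Qrho s = rm.tp s" and "odd m \<Longrightarrow> Qrho (s + 1) = 1"
    and "even m \<Longrightarrow> p s = 0 \<Longrightarrow> Qrho s = 1" and "even m \<Longrightarrow> p s = 1 \<Longrightarrow> Qrho s = (rm.tp s)\<^sup>2"
proof -
  have N: "s \<in> {1..N}" "odd m \<Longrightarrow> s + 1 \<in> {1..N}" using N_s s_pos by auto
  show "odd m \<Longrightarrow> Qrho s = rm.tp s" unfolding Qrho_eq[OF N(1)] tp_powi using rexp_last(1) p_cases[OF N(1)] by auto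
  show "odd m \<Longrightarrow> Qrho (s + 1) = 1" using Qrho_eq[OF N(2)] rexp_last(2) by simp
  show "even m \<Longrightarrow> p s = 0 \<Longrightarrow> Qrho s = 1" unfolding Qrho_eq[OF N(1)] using rexp_last(3) by simp
  show "Qrho s = (rm.tp s)\<^sup>2" if "even m" "p s = 1"
  proof -
    have "Qrho s = emb qhalf powi (- 2)" unfolding Qrho_eq[OF N(1)] using rexp_last(3) that by simp
    also have "\<dots> = (rm.tp s)\<^sup>2" using that by (simp add: rm.tp_def power_int_minus power_divide inverse_eq_divide)
    finally show ?thesis .
  qed
qed

lemma Rh_intertwines:
  assumes i: "i \<le> s" and uv: "u \<noteq> 0" "v \<noteq> 0" "u \<noteq> v"
  shows "rm.intertwines (rm.Rh (u / v) crit) (odd (palpha i)) (if i = 0 then u else 1) (if i = 0 then v else 1)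
    (rm.root_wt (root_fst i) (root_snd i)) (rm.root_mat (root_fst i) (root_snd i))"
proof -
  have z: "u / v \<noteq> 1" "u / v \<noteq> 0" using uv by auto
  have N: "2 \<in> {1..N}" "1 \<in> {1..N}" "N \<in> {1..N}" "dual 1 = N" "N > 1" using N_gt_2 by (auto simp: dual_def)
  have simple: "rm.intertwines (rm.Rh (u / v) crit) (odd (p i) \<noteq> odd (p (i + 1))) 1 1 (rm.root_wt i (i + 1)) (rm.root_mat i (i + 1))"
    if "1 \<le> i" "i \<le> s" "odd m \<or> i < s" for i
  proof (cases "i < s")
    case True
    have a: "i \<in> {1..N}" "i + 1 < rm.dl (i + 1)" unfolding dl_dual using that True N_s by (auto simp: dual_def split: if_splits)
    show ?thesis
      by (rule rm.Rh_simple[OF a(1) refl a(2) Qrho_step z(1)]) (use that True in auto)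
  next
    case False
    then have m: "odd m" "i = s" using that by auto
    have a: "s \<in> {1..N}" "s + 1 = rm.dl (s + 1)" unfolding dl_dual using m s_pos N_s by (auto simp: dual_def)
    show ?thesis unfolding m(2)
      by (rule rm.Rh_middle[OF a(1) refl a(2) _ Qrho_last(2)[OF m(1)] Qrho_last(1)[OF m(1)] z(1)]) (use m p_middle in auto)
  qed
  from i show ?thesis
  proof (cases rule: gen_cases)
    case aff_even
    have s1: "odd m \<or> 1 < s" using s_pos by auto
    have c: "crit * (Qrho 1)\<^sup>2 = 1" using crit_Q aff_even(2) by simp
    have 12: "(1::nat) + 1 = 2" by simp
    have ev: "\<not> odd (p 1)" using aff_even(2) by simp
    have P: "odd (palpha i) = (odd (p 1) \<noteq> odd (p 2))"
      unfolding palpha_parity[OF i] aff_even(3,4) p_dual[OF N(1)] by auto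
    have "rm.intertwines (rm.Rh (u / v) crit) (odd (p 1) \<noteq> odd (p 2)) u v (rm.root_wt (rm.dl 2) 1) (rm.root_mat (rm.dl 2) 1)"
      using rm.Rh_affine_even[OF N_gt_2 refl refl ev c uv refl simple[of 1, unfolded 12]] s_pos s1 by simp
    then show ?thesis unfolding P aff_even(3,4) dl_dual using aff_even(1) by simp
  next
    case aff_odd
    have c: "crit * (Qrho 1)\<^sup>2 = emb qhalf ^ 4" using crit_Q aff_odd(2) by simp
    have "rm.intertwines (rm.Rh (u / v) crit) (odd (p N) \<noteq> odd (p 1)) (u / v * v) v (rm.root_wt N 1) (rm.root_mat N 1)"
      by (rule rm.Rh_affine_long[OF refl _ N(5) _ c z uv(2)]) (use aff_odd N(4) in \<open>simp_all add: dl_dual\<close>)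
    then show ?thesis unfolding palpha_parity[OF i] aff_odd(3,4) using aff_odd(1) uv by simp
  next
    case s: simple
    then show ?thesis using simple[of i] i unfolding palpha_parity[OF i] s(3,4) by auto
  next
    case fork
    have s2: "s \<ge> 2" "s - 1 + 1 = s" using s_pos fork by auto
    have a: "s - 1 \<in> {1..N}" using s2 N_s by auto
    have a': "s + 1 = rm.dl s" unfolding dl_dual using fork N_s by (simp add: dual_def)
    have Q: "Qrho s = 1" "Qrho (s - 1) = rm.tp (s - 1) * rm.tp s"
      using Qrho_last(3) Qrho_step[of "s - 1"] fork s2 by simp_all
    have "rm.intertwines (rm.Rh (u / v) crit) (odd (p (s - 1)) \<noteq> odd (p (s + 1))) 1 1 (rm.root_wt (s - 1) (s + 1)) (rm.root_mat (s - 1) (s + 1))"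
      by (rule rm.Rh_fork[OF a s2(2)[symmetric] refl a' _ Q z(1)]) (use fork in auto)
    then show ?thesis unfolding palpha_parity[OF i] fork(5,6) using fork(2) by simp
  next
    case long
    have a: "s \<in> {1..N}" using s_pos N_s by auto
    have a': "s + 1 = rm.dl s" unfolding dl_dual using long N_s by (simp add: dual_def)
    have "rm.intertwines (rm.Rh (u / v) crit) (odd (p s) \<noteq> odd (p (s + 1))) 1 1 (rm.root_wt s (s + 1)) (rm.root_mat s (s + 1))"
      by (rule rm.Rh_long[OF a refl a' _ Qrho_last(4)[OF long(3,4)] z(1)]) (use long in auto)
    then show ?thesis unfolding palpha_parity[OF i] long(5,6) using long(2) by simp
  qed
qed

end

section \<open>Tensor products of evaluation modules\<close>

lemma scale_poly_add: "scale_poly w c (f + g) = scale_poly w c f + scale_poly w c g"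
proof (cases w)
  case Param_u
  show ?thesis unfolding Param_u scale_poly.simps
    by (rule poly_eqI) (simp add: coeff_map_poly pcompose_add)
qed (simp add: pcompose_add)

lemma scale_poly_const: "scale_poly w c [:[:k:]:] = [:[:k:]:]"
  by (cases w) (simp_all add: map_poly_pCons pcompose_pCons)

lemma scale_to_fract:
  assumes "c \<noteq> 0" shows "scale w c (to_fract f) = to_fract (scale_poly w c f)"
proof -
  have "scale_poly w c 1 = 1" using scale_poly_const[of w c 1] by (simp add: one_pCons)
  then show ?thesis unfolding to_fract_def using scale_Fract[OF assms, of 1 w f] by simp
qed

lemma scale_emb: "c \<noteq> 0 \<Longrightarrow> scale w c (emb k) = emb k"
  by (simp add: emb_def scale_to_fract scale_poly_const)

lemma scale_add:
  assumes c: "c \<noteq> 0" shows "scale w c (x + y) = scale w c x + scale w c y"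
proof -
  obtain f g where x: "x = Fract f g" "g \<noteq> 0" by (cases x) auto
  obtain f' g' where y: "y = Fract f' g'" "g' \<noteq> 0" by (cases y) auto
  have "g * g' \<noteq> 0" using x y by simp
  then show ?thesis
    using x y scale_poly_nonzero[OF c] c
    by (simp add: add_fract scale_Fract scale_poly_add scale_poly_mult)
qed

lemma scale_mult:
  assumes c: "c \<noteq> 0" shows "scale w c (x * y) = scale w c x * scale w c y"
proof -
  obtain f g where x: "x = Fract f g" "g \<noteq> 0" by (cases x) auto
  obtain f' g' where y: "y = Fract f' g'" "g' \<noteq> 0" by (cases y) auto
  have "g * g' \<noteq> 0" using x y by simp
  then show ?thesis
    using x y scale_poly_nonzero[OF c] c
    by (simp add: mult_fract scale_Fract scale_poly_mult)
qed

lemma scale_0: "c \<noteq> 0 \<Longrightarrow> scale w c 0 = 0" and scale_1: "c \<noteq> 0 \<Longrightarrow> scale w c 1 = 1"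
  using scale_emb[of c w 0] scale_emb[of c w 1] by simp_all

lemma scale_uminus: "c \<noteq> 0 \<Longrightarrow> scale w c (- x) = - scale w c x"
  using scale_add[of c w x "- x"] scale_0[of c w] by (simp add: eq_neg_iff_add_eq_0 add.commute)

lemma scale_diff: "c \<noteq> 0 \<Longrightarrow> scale w c (x - y) = scale w c x - scale w c y"
  using scale_add[of c w x "- y"] scale_uminus[of c w y] by simp

lemma scale_inverse:
  assumes c: "c \<noteq> 0" shows "scale w c (inverse x) = inverse (scale w c x)"
proof (cases "x = 0")
  case False
  then have "scale w c x * scale w c (inverse x) = 1"
    using scale_mult[OF c, of w x "inverse x"] scale_1[OF c] by simp
  then show ?thesis by (metis inverse_unique)
qed (simp add: scale_0[OF c])

lemma scale_divide: "c \<noteq> 0 \<Longrightarrow> scale w c (x / y) = scale w c x / scale w c y"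
  by (simp add: divide_inverse scale_mult scale_inverse)

lemma scale_power: "c \<noteq> 0 \<Longrightarrow> scale w c (x ^ k) = scale w c x ^ k"
  by (induction k) (simp_all add: scale_1 scale_mult)

lemma scale_sum: "c \<noteq> 0 \<Longrightarrow> scale w c (sum f A) = (\<Sum>x\<in>A. scale w c (f x))"
  by (induction A rule: infinite_finite_induct) (simp_all add: scale_0 scale_add)

lemma scale_sign: "c \<noteq> 0 \<Longrightarrow> scale w c ((-1) ^ k) = (-1) ^ k"
  by (simp add: scale_power scale_uminus scale_1)

lemma scale_of_int: "c \<noteq> 0 \<Longrightarrow> scale w c (of_int k) = of_int k"
  using scale_emb[of c w "of_int k"] by simp

lemma scale_indet:
  assumes "c \<noteq> 0"
  shows "scale w c (indet w) = emb c * indet w" "w \<noteq> w' \<Longrightarrow> scale w c (indet w') = indet w'"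
proof -
  have "emb c * indet w = to_fract ([:[:c:]:] * (case w of Param_u \<Rightarrow> [:[:0, 1:]:] | Param_v \<Rightarrow> [:0, 1:]))"
    unfolding to_fract_mult emb_def by (cases w) simp_all
  also have "\<dots> = scale w c (indet w)"
    by (cases w) (simp_all add: scale_to_fract[OF assms] map_poly_pCons pcompose_pCons)
  finally show "scale w c (indet w) = emb c * indet w" by simp
  show "scale w c (indet w') = indet w'" if "w \<noteq> w'"
    using that by (cases w; cases w') (simp_all add: scale_to_fract[OF assms] map_poly_pCons pcompose_pCons one_pCons)
qed

text \<open>Both substitutions are ring homomorphisms, so it suffices to compare them on polynomials
  in u and on the outer variable v.\<close>

lemma scale_commute:
  assumes "c \<noteq> 0" "d \<noteq> 0"
  shows "scale Param_u c (scale Param_v d x) = scale Param_v d (scale Param_u c x)"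
proof -
  obtain f g where x: "x = Fract f g" "g \<noteq> 0" by (cases x) auto
  have "scale_poly Param_u c (scale_poly Param_v d f) = scale_poly Param_v d (scale_poly Param_u c f)" for f
  proof (induction f)
    case 0 show ?case by simp
  next
    case (pCons r f)
    have e: "pCons r f = [:r:] + [:0, 1:] * f" by simp
    have 1: "scale_poly Param_u c [:r:] = [:pcompose r [:0, c:]:]" "scale_poly Param_v d [:r:] = [:r:]" for r
      by (simp_all add: map_poly_pCons)
    have 2: "scale_poly Param_u c [:0, 1:] = [:0, 1:]" "scale_poly Param_v d [:0, 1:] = [:0, [:d:]:]" "scale_poly Param_u c [:0, [:d:]:] = [:0, [:d:]:]"
      by (simp_all add: map_poly_pCons pcompose_pCons one_pCons)
    show ?case unfolding e scale_poly_add scale_poly_mult pCons.IH 1 2 ..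
  qed
  then show ?thesis using x scale_poly_nonzero assms by (simp add: scale_Fract del: scale_poly.simps)
qed

context osp_data begin

section \<open>Operators on the two tensor factors and their signs\<close>

definition op1 :: "((nat \<Rightarrow> L) \<Rightarrow> nat \<Rightarrow> L) \<Rightarrow> (nat \<times> nat \<Rightarrow> L) \<Rightarrow> nat \<times> nat \<Rightarrow> L" where
  "op1 X \<phi> = (\<lambda>(k, l). X (\<lambda>i. \<phi> (i, l)) k)"

definition op2 :: "((nat \<Rightarrow> L) \<Rightarrow> nat \<Rightarrow> L) \<Rightarrow> (nat \<times> nat \<Rightarrow> L) \<Rightarrow> nat \<times> nat \<Rightarrow> L" where
  "op2 Y \<phi> = (\<lambda>(k, l). Y (\<lambda>j. \<phi> (k, j)) l)"

definition sgn_op :: "nat \<Rightarrow> (nat \<times> nat \<Rightarrow> L) \<Rightarrow> nat \<times> nat \<Rightarrow> L" where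
  "sgn_op d \<phi> = (\<lambda>(k, l). (-1) ^ (d * p k) * \<phi> (k, l))"

lemma tensor_op_eq: "tensor_op d X Y \<phi> = op1 X (sgn_op d (op2 Y \<phi>))"
  by (simp add: tensor_op_def op1_def op2_def sgn_op_def)

text \<open>Linearity is asked only over K because D acts semilinearly over K(u, v).\<close>

definition K_linear :: "(('i \<Rightarrow> L) \<Rightarrow> 'j \<Rightarrow> L) \<Rightarrow> bool" where
  "K_linear X \<longleftrightarrow> (\<forall>\<phi> \<psi>. X (\<lambda>i. \<phi> i + \<psi> i) = (\<lambda>k. X \<phi> k + X \<psi> k)) \<and>
     (\<forall>c \<phi>. X (\<lambda>i. emb c * \<phi> i) = (\<lambda>k. emb c * X \<phi> k))"

lemma K_linearD:
  assumes "K_linear X"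
  shows "X (\<lambda>i. \<phi> i + \<psi> i) = (\<lambda>k. X \<phi> k + X \<psi> k)" "X (\<lambda>i. emb c * \<phi> i) = (\<lambda>k. emb c * X \<phi> k)"
    "X (\<lambda>i. (-1) ^ e * \<phi> i) = (\<lambda>k. (-1) ^ e * X \<phi> k)" "X (\<lambda>i. 0) = (\<lambda>k. 0)"
proof -
  show a: "X (\<lambda>i. \<phi> i + \<psi> i) = (\<lambda>k. X \<phi> k + X \<psi> k)" and b: "X (\<lambda>i. emb c * \<phi> i) = (\<lambda>k. emb c * X \<phi> k)" for \<phi> \<psi> c
    using assms by (simp_all add: K_linear_def)
  show "X (\<lambda>i. (-1) ^ e * \<phi> i) = (\<lambda>k. (-1) ^ e * X \<phi> k)" using b[of "(-1) ^ e" \<phi>] by simp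
  show "X (\<lambda>i. 0) = (\<lambda>k. 0)" using b[of 0 "\<lambda>_. 0"] by simp
qed

lemma K_linear_sum:
  assumes "K_linear X"
  shows "X (\<lambda>i. \<Sum>a\<in>A. emb (c a) * f a i) = (\<lambda>k. \<Sum>a\<in>A. emb (c a) * X (f a) k)"
  by (induction A rule: infinite_finite_induct) (simp_all add: K_linearD[OF assms])

lemma K_linear_comp: "K_linear X \<Longrightarrow> K_linear Y \<Longrightarrow> K_linear (\<lambda>\<phi>. X (Y \<phi>))"
  by (simp add: K_linear_def)

lemma K_linear_mat_op: "K_linear (mat_op A)"
  by (auto simp: K_linear_def mat_op_def fun_eq_iff distrib_left sum.distrib sum_distrib_left mult_ac)

lemma K_linear_mat_op2: "K_linear (mat_op2 A)"
  by (auto simp: K_linear_def mat_op2_def fun_eq_iff distrib_left sum.distrib sum_distrib_left mult_ac)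

text \<open>The three kinds of operators by which generators act. A matrix comes with two facts: its
  entries are fixed by rescaling the other indeterminate, so it commutes with D on the other factor,
  and they vanish unless row and column differ by the parity of the generator.\<close>

lemma ev_gen_cases:
  obtains (mat) A where "ev_gen a b w g = mat_op A"
      "\<And>w' c k l. w' \<noteq> w \<Longrightarrow> c \<noteq> 0 \<Longrightarrow> scale w' c (A k l) = A k l"
      "g \<in> gens \<Longrightarrow> \<forall>k\<in>{1..N}. \<forall>l\<in>{1..N}. A k l \<noteq> 0 \<longrightarrow> odd (gpar g) = (odd (p k) \<noteq> odd (p l))"
    | (id) "ev_gen a b w g = id" "gpar g = 0"
    | (scale) c where "c \<noteq> 0" "ev_gen a b w g = (\<lambda>\<phi> k. scale w c (\<phi> k))" "gpar g = 0"
proof (cases g)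
  case (gE i)
  have par: "odd (palpha i) = (odd (p k) \<noteq> odd (p l))" if h: "i \<le> s" "e_gen i k l \<noteq> 0" "k \<in> {1..N}" "l \<in> {1..N}" for k l
  proof -
    obtain \<alpha> where \<alpha>: "emb (e_gen i k l) = \<alpha> * rm.root_mat (root_fst i) (root_snd i) k l"
      using gen_matrix(1)[OF h(1)] by blast
    then have "rm.root_mat (root_fst i) (root_snd i) k l \<noteq> 0" using h(2) emb_eq_0_iff[of "e_gen i k l"] by auto
    then show ?thesis using rm.root_mat_parity[OF root_in[OF h(1)]] palpha_parity[OF h(1)] by blast
  qed
  show ?thesis
    by (rule mat, unfold gE ev_gen.simps, rule refl)
       (use par in \<open>auto simp: gens_def scale_mult scale_emb scale_indet e_gen_def split: if_splits\<close>)
next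
  case (gF i)
  have par: "odd (palpha i) = (odd (p k) \<noteq> odd (p l))" if h: "i \<le> s" "f_gen i k l \<noteq> 0" "k \<in> {1..N}" "l \<in> {1..N}" for k l
  proof -
    obtain \<alpha> where \<alpha>: "emb (f_gen i k l) = \<alpha> * rm.root_mat (root_snd i) (root_fst i) k l"
      using gen_matrix(2)[OF h(1)] by blast
    then have "rm.root_mat (root_snd i) (root_fst i) k l \<noteq> 0" using h(2) emb_eq_0_iff[of "f_gen i k l"] by auto
    then show ?thesis using rm.root_mat_parity[OF root_in(2,1)[OF h(1)]] palpha_parity[OF h(1)] by blast
  qed
  show ?thesis
    by (rule mat, unfold gF ev_gen.simps, rule refl)
       (use par in \<open>auto simp: gens_def scale_mult scale_inverse scale_emb scale_indet f_gen_def split: if_splits\<close>)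
next
  case (gQ i)
  show ?thesis
    by (rule mat, unfold gQ ev_gen.simps, rule refl) (auto simp: scale_emb qdiag_def split: if_splits)
next
  case (gQi i)
  show ?thesis
    by (rule mat, unfold gQi ev_gen.simps, rule refl) (auto simp: scale_emb qdiag_def split: if_splits)
next
  case gD
  have "qq \<noteq> 0" using qhalf_nonzero by (simp add: qq_def)
  then show ?thesis by (rule scale) (simp_all add: gD)
next
  case gDi
  have "inverse qq \<noteq> 0" using qhalf_nonzero by (simp add: qq_def)
  then show ?thesis by (rule scale) (simp_all add: gDi)
qed (use id in \<open>simp_all\<close>)

lemma K_linear_ev_gen: "K_linear (ev_gen a b w g)"
  by (cases rule: ev_gen_cases[of a b w g])
     (simp_all add: K_linear_mat_op, simp_all add: K_linear_def scale_add scale_mult scale_emb)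

lemma ev_word_simps:
  "ev_word a b w (Word []) = id" "ev_word a b w (Word (g # gs)) = ev_gen a b w g \<circ> ev_word a b w (Word gs)"
  by (simp_all add: ev_word_def)

lemma ev_word_plus: "ev_word a b w (x + y) = ev_word a b w x \<circ> ev_word a b w y"
proof -
  have "ev_word a b w (Word (gs @ hs)) = ev_word a b w (Word gs) \<circ> ev_word a b w (Word hs)" for gs hs
    by (induction gs) (simp_all add: ev_word_simps comp_assoc)
  then show ?thesis by (cases x; cases y) (simp add: plus_word_def)
qed

lemma K_linear_ev_word: "K_linear (ev_word a b w x)"
proof -
  have "K_linear (ev_word a b w (Word gs))" for gs
  proof (induction gs)
    case Nil then show ?case by (simp add: ev_word_simps K_linear_def)
  next
    case (Cons g gs)
    then show ?case using K_linear_comp[OF K_linear_ev_gen[of a b w g] Cons] by (simp add: ev_word_simps comp_def)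
  qed
  then show ?thesis by (cases x) simp
qed

lemma op_comp: "op1 (X \<circ> X') \<phi> = op1 X (op1 X' \<phi>)" "op2 (X \<circ> X') \<phi> = op2 X (op2 X' \<phi>)" "op1 id \<phi> = \<phi>" "op2 id \<phi> = \<phi>"
  by (auto simp: op1_def op2_def fun_eq_iff)

text \<open>No sign occurs, because \<open>sgn_op\<close> carries all signs of the graded tensor
  product. When one operator is a substitution, \<open>w \<noteq> w'\<close> makes it fix the matrix
  entries of the other.\<close>

lemma ev_gen_commute:
  assumes "w \<noteq> w'"
  shows "op1 (ev_gen a b w g) (op2 (ev_gen a b w' h) \<phi>) = op2 (ev_gen a b w' h) (op1 (ev_gen a b w g) \<phi>)"
proof (cases rule: ev_gen_cases[of a b w g])
  case (mat A)
  note A = this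
  show ?thesis
  proof (cases rule: ev_gen_cases[of a b w' h])
    case (mat B)
    have "(\<Sum>i=1..N. A k i * (\<Sum>j=1..N. B l j * \<phi> (i, j))) = (\<Sum>j=1..N. B l j * (\<Sum>i=1..N. A k i * \<phi> (i, j)))" for k l
      unfolding sum_distrib_left by (subst sum.swap) (simp add: mult_ac)
    then show ?thesis unfolding A(1) mat(1) by (auto simp: op1_def op2_def mat_op_def fun_eq_iff)
  next
    case id then show ?thesis by (simp add: op_comp)
  next
    case (scale c)
    then show ?thesis unfolding A(1) scale(2) using A(2)[OF assms[symmetric] scale(1)]
      by (auto simp: op1_def op2_def mat_op_def fun_eq_iff scale_sum scale_mult scale_0)
  qed
next
  case id then show ?thesis by (simp add: op_comp)
next
  case (scale c)
  note C = this
  show ?thesis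
  proof (cases rule: ev_gen_cases[of a b w' h])
    case (mat B)
    then show ?thesis unfolding C(2) mat(1) using mat(2)[OF assms C(1)] C(1)
      by (auto simp: op1_def op2_def mat_op_def fun_eq_iff scale_sum scale_mult scale_0)
  next
    case id then show ?thesis by (simp add: op_comp)
  next
    case (scale d)
    then show ?thesis unfolding C(2) scale(2) using C(1) assms scale_commute[of c d] scale_commute[of d c]
      by (cases w; cases w') (auto simp: op1_def op2_def fun_eq_iff)
  qed
qed

lemma ev_word_commute:
  assumes "w \<noteq> w'"
  shows "op1 (ev_word a b w x) (op2 (ev_word a b w' y) \<phi>) = op2 (ev_word a b w' y) (op1 (ev_word a b w x) \<phi>)"
proof -
  have 1: "op1 (ev_gen a b w g) (op2 (ev_word a b w' (Word hs)) \<phi>) = op2 (ev_word a b w' (Word hs)) (op1 (ev_gen a b w g) \<phi>)" for g hs \<phi>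
    by (induction hs) (simp_all only: ev_word_simps op_comp ev_gen_commute[OF assms])
  have "op1 (ev_word a b w (Word gs)) (op2 (ev_word a b w' (Word hs)) \<phi>) = op2 (ev_word a b w' (Word hs)) (op1 (ev_word a b w (Word gs)) \<phi>)" for gs hs
    by (induction gs) (simp_all only: ev_word_simps op_comp 1)
  then show ?thesis by (cases x; cases y) simp
qed

lemma sgn_op_ev_gen:
  assumes g: "g \<in> gens"
  shows "sgn_op d (op1 (ev_gen a b w g) \<phi>) = (\<lambda>x. (-1) ^ (d * gpar g) * op1 (ev_gen a b w g) (sgn_op d \<phi>) x)"
proof (cases rule: ev_gen_cases[of a b w g])
  case (mat A)
  have "(-1) ^ (d * p k) * (A k i * x) = (-1) ^ (d * gpar g) * (A k i * ((-1) ^ (d * p i) * x))"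
    if "k \<in> {1..N}" "i \<in> {1..N}" for k i x
  proof (cases "A k i = 0")
    case False
    then have "odd (gpar g) = (odd (p k) \<noteq> odd (p i))" using mat(3)[OF g] that by blast
    then have "(-1) ^ (d * p k) = ((-1) ^ (d * gpar g) * (-1) ^ (d * p i) :: L)"
      by (cases "odd d"; cases "odd (p k)"; cases "odd (p i)"; simp add: minus_one_power_iff)
    then show ?thesis by (simp add: mult_ac)
  qed simp
  then show ?thesis unfolding mat(1)
    by (auto simp: op1_def sgn_op_def mat_op_def fun_eq_iff sum_distrib_left intro!: sum.cong)
next
  case id then show ?thesis by (simp add: op_comp)
next
  case (scale c)
  then show ?thesis by (auto simp: op1_def sgn_op_def fun_eq_iff scale_mult scale_sign)
qed

lemma op1_K_linear: "K_linear X \<Longrightarrow> K_linear (op1 X)"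
  unfolding K_linear_def op1_def by (auto simp: fun_eq_iff)

lemma op2_K_linear: "K_linear X \<Longrightarrow> K_linear (op2 X)"
  unfolding K_linear_def op2_def by (auto simp: fun_eq_iff)

lemma sgn_op_K_linear: "K_linear (sgn_op d)"
  unfolding K_linear_def sgn_op_def by (auto simp: fun_eq_iff algebra_simps)

lemma sgn_op_ev_word:
  assumes "set (letters x) \<subseteq> gens"
  shows "sgn_op d (op1 (ev_word a b w x) \<phi>) = (\<lambda>y. (-1) ^ (d * wpar x) * op1 (ev_word a b w x) (sgn_op d \<phi>) y)"
proof -
  have "sgn_op d (op1 (ev_word a b w (Word gs)) \<phi>)
      = (\<lambda>y. (-1) ^ (d * wpar (Word gs)) * op1 (ev_word a b w (Word gs)) (sgn_op d \<phi>) y)"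
    if "set gs \<subseteq> gens" for gs
    using that
  proof (induction gs)
    case Nil
    then show ?case by (simp only: ev_word_simps op_comp) (simp add: wpar_def)
  next
    case (Cons g gs)
    have lin: "K_linear (op1 (ev_gen a b w g))" by (rule op1_K_linear[OF K_linear_ev_gen])
    have "sgn_op d (op1 (ev_word a b w (Word (g # gs))) \<phi>) = sgn_op d (op1 (ev_gen a b w g) (op1 (ev_word a b w (Word gs)) \<phi>))"
      by (simp only: ev_word_simps op_comp)
    also have "\<dots> = (\<lambda>x. (-1) ^ (d * gpar g) * op1 (ev_gen a b w g) (sgn_op d (op1 (ev_word a b w (Word gs)) \<phi>)) x)"
      using Cons.prems by (intro sgn_op_ev_gen) simp
    also have "\<dots> = (\<lambda>x. (-1) ^ (d * gpar g) * ((-1) ^ (d * wpar (Word gs)) * op1 (ev_gen a b w g) (op1 (ev_word a b w (Word gs)) (sgn_op d \<phi>)) x))"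
      using Cons by (simp only: K_linearD(3)[OF lin] set_simps insert_subset simp_thms)
    also have "\<dots> = (\<lambda>x. (-1) ^ (d * wpar (Word (g # gs))) * op1 (ev_word a b w (Word (g # gs))) (sgn_op d \<phi>) x)"
      by (simp only: ev_word_simps op_comp) (simp add: wpar_def distrib_left power_add mult_ac)
    finally show ?case .
  qed
  then show ?thesis using assms by (cases x) simp
qed

text \<open>The operator of x' has to pass the operator of y and the sign operator of y. The first
  passage is free of signs; the second yields the sign of the graded product.\<close>

lemma tensor_op_mult:
  assumes "w \<noteq> w'" and "set (letters x') \<subseteq> gens"
  shows "(\<lambda>k. (-1) ^ (wpar y * wpar x') * tensor_op (wpar (y + y')) (ev_word a b w (x + x')) (ev_word a b w' (y + y')) \<phi> k)
    = tensor_op (wpar y) (ev_word a b w x) (ev_word a b w' y) (tensor_op (wpar y') (ev_word a b w x') (ev_word a b w' y') \<phi>)"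
proof -
  let ?X = "op1 (ev_word a b w x)" and ?X' = "op1 (ev_word a b w x')"
    and ?Y = "op2 (ev_word a b w' y)" and ?Y' = "op2 (ev_word a b w' y')"
  have sg: "sgn_op (wpar (y + y')) \<psi> = sgn_op (wpar y) (sgn_op (wpar y') \<psi>)" for \<psi>
    by (cases y; cases y') (auto simp: sgn_op_def wpar_def plus_word_def fun_eq_iff distrib_right power_add)
  have Y: "?Y (sgn_op d \<psi>) = sgn_op d (?Y \<psi>)" for d \<psi>
    using K_linearD(3)[OF K_linear_ev_word[of a b w' y]]
    by (simp add: op2_def sgn_op_def fun_eq_iff)
  have lin: "K_linear ?X" by (rule op1_K_linear[OF K_linear_ev_word])
  have "tensor_op (wpar y) (ev_word a b w x) (ev_word a b w' y) (tensor_op (wpar y') (ev_word a b w x') (ev_word a b w' y') \<phi>)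
    = ?X (sgn_op (wpar y) (?Y (?X' (sgn_op (wpar y') (?Y' \<phi>)))))"
    by (simp only: tensor_op_eq)
  also have "\<dots> = ?X (sgn_op (wpar y) (?X' (?Y (sgn_op (wpar y') (?Y' \<phi>)))))"
    by (simp only: ev_word_commute[OF assms(1)])
  also have "\<dots> = ?X (\<lambda>k. (-1) ^ (wpar y * wpar x') * ?X' (sgn_op (wpar y) (?Y (sgn_op (wpar y') (?Y' \<phi>)))) k)"
    by (simp only: sgn_op_ev_word[OF assms(2)])
  also have "\<dots> = (\<lambda>k. (-1) ^ (wpar y * wpar x') * ?X (?X' (sgn_op (wpar y) (?Y (sgn_op (wpar y') (?Y' \<phi>))))) k)"
    by (simp only: K_linearD(3)[OF lin])
  also have "?X (?X' (sgn_op (wpar y) (?Y (sgn_op (wpar y') (?Y' \<phi>))))) = tensor_op (wpar (y + y')) (ev_word a b w (x + x')) (ev_word a b w' (y + y')) \<phi>"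
    unfolding tensor_op_eq ev_word_plus op_comp sg Y ..
  finally show ?thesis by (rule sym)
qed

lemma tensor_op_K_linear: "K_linear X \<Longrightarrow> K_linear Y \<Longrightarrow> K_linear (tensor_op d X Y)"
proof -
  assume "K_linear X" "K_linear Y"
  then have "K_linear (\<lambda>\<phi>. op1 X (sgn_op d (op2 Y \<phi>)))"
    by (rule K_linear_comp[OF op1_K_linear K_linear_comp[OF sgn_op_K_linear op2_K_linear]])
  moreover have "tensor_op d X Y = (\<lambda>\<phi>. op1 X (sgn_op d (op2 Y \<phi>)))" by (rule ext) (rule tensor_op_eq)
  ultimately show ?thesis by simp
qed

section \<open>Multiplicativity of the action on the tensor product\<close>

definition term_op :: "K \<Rightarrow> K \<Rightarrow> spectral \<Rightarrow> spectral \<Rightarrow> gen word \<times> gen word \<Rightarrow> (nat \<times> nat \<Rightarrow> L) \<Rightarrow> nat \<times> nat \<Rightarrow> L" where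
  "term_op a b w w' = (\<lambda>(x, y). tensor_op (wpar y) (ev_word a b w x) (ev_word a b w' y))"

lemma term_op_K_linear: "K_linear (term_op a b w w' xy)"
  unfolding term_op_def by (cases xy) (simp add: tensor_op_K_linear K_linear_ev_word)

text \<open>The support of a sum can shrink by cancellation; summing over a common finite superset
  makes the action visibly additive.\<close>

lemma ev2_superset:
  assumes "finite A" "Poly_Mapping.keys T \<subseteq> A"
  shows "ev2 a b w w' T \<phi> = (\<lambda>k. \<Sum>xy\<in>A. emb (Poly_Mapping.lookup T xy) * term_op a b w w' xy \<phi> k)"
  unfolding ev2_def
proof (rule ext)
  fix k
  have "(\<Sum>(x, y)\<in>Poly_Mapping.keys T. emb (Poly_Mapping.lookup T (x, y)) * tensor_op (wpar y) (ev_word a b w x) (ev_word a b w' y) \<phi> k)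
    = (\<Sum>xy\<in>Poly_Mapping.keys T. emb (Poly_Mapping.lookup T xy) * term_op a b w w' xy \<phi> k)"
    by (rule sum.cong[OF refl]) (auto simp: term_op_def)
  also have "\<dots> = (\<Sum>xy\<in>A. emb (Poly_Mapping.lookup T xy) * term_op a b w w' xy \<phi> k)"
    by (rule sum.mono_neutral_left) (use assms in \<open>auto simp: in_keys_iff\<close>)
  finally show "(\<Sum>(x, y)\<in>Poly_Mapping.keys T. emb (Poly_Mapping.lookup T (x, y)) * tensor_op (wpar y) (ev_word a b w x) (ev_word a b w' y) \<phi> k)
    = (\<Sum>xy\<in>A. emb (Poly_Mapping.lookup T xy) * term_op a b w w' xy \<phi> k)" .
qed

lemmas ev2_keys = ev2_superset[OF finite_keys order_refl]

lemma ev2_add: "ev2 a b w w' (S + T) \<phi> = (\<lambda>k. ev2 a b w w' S \<phi> k + ev2 a b w w' T \<phi> k)"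
proof -
  let ?A = "Poly_Mapping.keys S \<union> Poly_Mapping.keys T"
  have f: "finite ?A" by simp
  show ?thesis
    using keys_add[of S T] by (simp add: ev2_superset[OF f] lookup_add distrib_right sum.distrib)
qed

lemma ev2_zero: "ev2 a b w w' 0 \<phi> = (\<lambda>k. 0)"
  by (simp add: ev2_def)

lemma ev2_sum: "ev2 a b w w' (sum f A) \<phi> = (\<lambda>k. \<Sum>x\<in>A. ev2 a b w w' (f x) \<phi> k)"
  by (induction A rule: infinite_finite_induct) (simp_all add: ev2_zero ev2_add)

lemma ev2_single: "ev2 a b w w' (Poly_Mapping.single xy c) \<phi> = (\<lambda>k. emb c * term_op a b w w' xy \<phi> k)"
  by (subst ev2_superset[of "{xy}"]) (auto simp: lookup_single)

text \<open>Only words in \<open>gens\<close> are known to act with the parity \<open>wpar\<close>,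
  and in \<open>tensor_op_mult\<close> this is needed for the first factor of the right-hand
  term.\<close>

definition gen_pairs :: "free2 \<Rightarrow> bool" where
  "gen_pairs T \<longleftrightarrow> (\<forall>(x, y)\<in>Poly_Mapping.keys T. set (letters x) \<subseteq> gens)"

lemma ev2_gmult:
  assumes "w \<noteq> w'" and T: "gen_pairs T"
  shows "ev2 a b w w' (gmult S T) \<phi> = ev2 a b w w' S (ev2 a b w w' T \<phi>)"
proof (rule ext)
  fix k
  let ?l = Poly_Mapping.lookup
  have 1: "term_op a b w w' (x, y) (term_op a b w w' (x', y') \<phi>) k = (-1) ^ (wpar y * wpar x') * term_op a b w w' (x + x', y + y') \<phi> k"
    if "(x', y') \<in> Poly_Mapping.keys T" for x y x' y'
    unfolding term_op_def prod.case
    using T that fun_cong[OF tensor_op_mult[OF assms(1), of x' y y' a b x \<phi>], of k] by (auto simp: gen_pairs_def)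
  have "ev2 a b w w' (gmult S T) \<phi> k = (\<Sum>(x, y)\<in>Poly_Mapping.keys S. \<Sum>(x', y')\<in>Poly_Mapping.keys T.
      emb ((-1) ^ (wpar y * wpar x') * ?l S (x, y) * ?l T (x', y')) * term_op a b w w' (x + x', y + y') \<phi> k)"
    unfolding gmult_def by (simp only: ev2_sum ev2_single case_prod_unfold)
  also have "\<dots> = (\<Sum>(x, y)\<in>Poly_Mapping.keys S. emb (?l S (x, y)) * (\<Sum>(x', y')\<in>Poly_Mapping.keys T.
      emb (?l T (x', y')) * term_op a b w w' (x, y) (term_op a b w w' (x', y') \<phi>) k))"
    by (rule sum.cong[OF refl]) (auto simp: 1 sum_distrib_left mult_ac intro!: sum.cong)
  also have "\<dots> = ev2 a b w w' S (ev2 a b w w' T \<phi>) k"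
  proof -
    have "term_op a b w w' v (ev2 a b w w' T \<phi>) k = (\<Sum>xy\<in>Poly_Mapping.keys T.
      emb (?l T xy) * term_op a b w w' v (term_op a b w w' xy \<phi>) k)" for v
      unfolding ev2_keys[of a b w w' T \<phi>] by (simp only: K_linear_sum[OF term_op_K_linear])
    then show ?thesis unfolding ev2_keys[of a b w w' S] by (simp only: case_prod_unfold prod.collapse)
  qed
  finally show "ev2 a b w w' (gmult S T) \<phi> k = ev2 a b w w' S (ev2 a b w w' T \<phi>) k" .
qed

lemma gen_pairs_add: "gen_pairs S \<Longrightarrow> gen_pairs T \<Longrightarrow> gen_pairs (S + T)"
  using keys_add[of S T] unfolding gen_pairs_def by blast

lemma gen_pairs_sum: "(\<And>x. x \<in> A \<Longrightarrow> gen_pairs (f x)) \<Longrightarrow> gen_pairs (sum f A)"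
  by (induction A rule: infinite_finite_induct) (auto simp: gen_pairs_add, simp_all add: gen_pairs_def)

lemma gen_pairs_single: "set (letters (fst xy)) \<subseteq> gens \<Longrightarrow> gen_pairs (Poly_Mapping.single xy c)"
  by (auto simp: gen_pairs_def)

lemma gen_pairs_gmult: "gen_pairs S \<Longrightarrow> gen_pairs T \<Longrightarrow> gen_pairs (gmult S T)"
  unfolding gmult_def
  by (rule gen_pairs_sum, clarsimp, rule gen_pairs_sum, clarsimp, rule gen_pairs_single)
     (auto simp: gen_pairs_def plus_word_def)

lemma gen_pairs_pure: "g \<in> gens \<Longrightarrow> gen_pairs (pure g h)"
  unfolding pure_def by (rule gen_pairs_single) simp

lemma gen_pairs_Delta_gen: "g \<in> gens \<Longrightarrow> gen_pairs (Delta_gen g)"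
  by (cases g) (auto intro!: gen_pairs_add gen_pairs_pure, auto simp: gens_def)

lemma Delta_word_simps:
  "Delta_word (Word []) = Poly_Mapping.single (0, 0) 1"
  "Delta_word (Word (g # gs)) = gmult (Delta_gen g) (Delta_word (Word gs))"
  by (simp_all add: Delta_word_def)

lemma gen_pairs_Delta_word: "set gs \<subseteq> gens \<Longrightarrow> gen_pairs (Delta_word (Word gs))"
  by (induction gs) (auto simp: Delta_word_simps gen_pairs_gmult gen_pairs_Delta_gen zero_word_def intro!: gen_pairs_single)

lemma ev2_Delta_word:
  assumes "w \<noteq> w'" and "set gs \<subseteq> gens"
  shows "ev2 a b w w' (Delta_word (Word gs)) \<phi> = foldr (\<lambda>g. ev2 a b w w' (Delta_gen g)) gs \<phi>"
  using assms(2)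
proof (induction gs)
  case Nil
  have "term_op a b w w' (0, 0) \<phi> = \<phi>"
    unfolding term_op_def prod.case zero_word_def ev_word_simps tensor_op_eq op_comp
    by (auto simp: sgn_op_def wpar_def)
  then show ?case unfolding Delta_word_simps ev2_single by simp
next
  case (Cons g gs)
  then show ?case using ev2_gmult[OF assms(1) gen_pairs_Delta_word[of gs], of a b "Delta_gen g" \<phi>] by (simp add: Delta_word_simps)
qed

lemma act_eq:
  "act a b w w' x \<phi> = (\<lambda>k. \<Sum>y\<in>Poly_Mapping.keys x. emb (Poly_Mapping.lookup x y) * ev2 a b w w' (Delta_word y) \<phi> k)"
proof -
  have "ev2 a b w w' (Poly_Mapping.map (\<lambda>r. c * r) T) \<phi> = (\<lambda>k. emb c * ev2 a b w w' T \<phi> k)" for c T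
  proof -
    have k: "Poly_Mapping.keys (Poly_Mapping.map (\<lambda>r. c * r) T) \<subseteq> Poly_Mapping.keys T"
      by (auto simp: in_keys_iff map.rep_eq when_def split: if_splits)
    have l: "Poly_Mapping.lookup (Poly_Mapping.map (\<lambda>r. c * r) T) xy = c * Poly_Mapping.lookup T xy" for xy
      by (simp add: map.rep_eq when_def)
    show ?thesis unfolding ev2_superset[OF finite_keys k] l ev2_keys[of a b w w' T]
      by (simp add: sum_distrib_left mult_ac)
  qed
  then show ?thesis unfolding act_def Delta_def ev2_sum by simp
qed

lemma mat_op2_cong:
  assumes "\<And>x y. x \<in> {1..N} \<times> {1..N} \<Longrightarrow> y \<in> {1..N} \<times> {1..N} \<Longrightarrow> A x y = B x y"
  shows "mat_op2 A = mat_op2 B"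
  using assms by (auto simp: mat_op2_def fun_eq_iff intro!: sum.cong)

lemma mat_op2_mult:
  "mat_op2 A (mat_op2 B \<phi>) = mat_op2 (\<lambda>x y. \<Sum>v\<in>{1..N} \<times> {1..N}. A x v * B v y) \<phi>"
proof -
  have "(\<Sum>y\<in>J. A x y * (\<Sum>v\<in>J. B y v * \<phi> v)) = (\<Sum>y\<in>J. (\<Sum>v\<in>J. A x v * B v y) * \<phi> y)" for x J
    unfolding sum_distrib_left sum_distrib_right by (subst sum.swap) (simp add: mult_ac)
  then show ?thesis by (auto simp: mat_op2_def fun_eq_iff)
qed

lemma Rhat_eq:
  assumes "z \<noteq> 1"
  shows "Rhat z = mat_op2 (\<lambda>(i, j) (k, l). rm.Rh z crit i j k l)"
proof -
  have "(\<Sum>v\<in>{1..N} \<times> {1..N}. tau (i, j) v * R z v (k, l)) = rm.Rh z crit i j k l"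
    if "i \<in> {1..N}" "j \<in> {1..N}" "k \<in> {1..N}" "l \<in> {1..N}" for i j k l
  proof -
    have "(\<Sum>v\<in>{1..N} \<times> {1..N}. tau (i, j) v * R z v (k, l)) = (\<Sum>v\<in>{1..N} \<times> {1..N}. if v = (j, i) then (-1) ^ (p i * p j) * R z (j, i) (k, l) else 0)"
      by (rule sum.cong[OF refl]) (auto simp: tau_def mult.commute split: if_splits)
    also have "\<dots> = (-1) ^ (p i * p j) * R z (j, i) (k, l)" using that by simp
    finally show ?thesis using R_entry[OF that assms] by simp
  qed
  then have "mat_op2 (\<lambda>x y. \<Sum>v\<in>{1..N} \<times> {1..N}. tau x v * R z v y) = mat_op2 (\<lambda>(i, j) (k, l). rm.Rh z crit i j k l)"
    by (intro mat_op2_cong) auto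
  then show ?thesis unfolding Rhat_def by (auto simp: fun_eq_iff mat_op2_mult)
qed

end

text \<open>From here on u and v enter only through \<open>indet_nonzero\<close>,
  \<open>indet_distinct\<close> and \<open>scale_indet\<close>; their representation as fractions
  stays closed.\<close>

declare indet.simps [simp del]

context osp_data begin

section \<open>Generators commute with the R-matrix\<close>

lemma ev2_pure: "ev2 a b w w' (pure g h) \<phi> = tensor_op (gpar h) (ev_gen a b w g) (ev_gen a b w' h) \<phi>"
  unfolding pure_def ev2_single term_op_def prod.case ev_word_simps by (simp add: wpar_def)

lemma tensor_op_mat_op:
  "tensor_op d (mat_op A) (mat_op B) \<phi> = mat_op2 (\<lambda>(k, l) (i, j). A k i * ((-1) ^ (d * p i) * B l j)) \<phi>"
proof -
  have "(\<Sum>i=1..N. A k i * ((-1) ^ (d * p i) * (\<Sum>j=1..N. B l j * \<phi> (i, j))))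
    = (\<Sum>y\<in>{1..N} \<times> {1..N}. case y of (i, j) \<Rightarrow> A k i * ((-1) ^ (d * p i) * B l j) * \<phi> (i, j))" for k l
    unfolding sum.cartesian_product[symmetric] sum_distrib_left by (simp add: mult_ac)
  then show ?thesis
    unfolding tensor_op_def mat_op_def mat_op2_def by (auto simp: fun_eq_iff case_prod_unfold)
qed

lemma mat_op2_add: "(\<lambda>x. mat_op2 A \<phi> x + mat_op2 B \<phi> x) = mat_op2 (\<lambda>x y. A x y + B x y) \<phi>"
  by (auto simp: mat_op2_def fun_eq_iff distrib_right sum.distrib)

lemma mat_op2_pair_cong:
  assumes "\<And>i j k l. i \<in> {1..N} \<Longrightarrow> j \<in> {1..N} \<Longrightarrow> k \<in> {1..N} \<Longrightarrow> l \<in> {1..N} \<Longrightarrow> A (i, j) (k, l) = B (i, j) (k, l)"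
  shows "mat_op2 A = mat_op2 B"
proof (rule mat_op2_cong)
  fix x y assume "x \<in> {1..N} \<times> {1..N}" "y \<in> {1..N} \<times> {1..N}"
  then show "A x y = B x y" using assms[of "fst x" "snd x" "fst y" "snd y"] by (simp add: mem_Times_iff)
qed

text \<open>The coproduct of a root vector e of parity \<open>d\<close> that acts as
  \<open>U * e\<close> on the first and \<open>V * e\<close> on the second factor. Exchanging
  \<open>U\<close> and \<open>V\<close> passes from V(u) \<otimes> V(v) to V(v) \<otimes>
  V(u).\<close>

definition root_op :: "nat \<Rightarrow> (nat \<Rightarrow> L) \<Rightarrow> L mtx \<Rightarrow> L \<Rightarrow> L \<Rightarrow> L mtx2" where
  "root_op d X e U V = (\<lambda>(k, l) (i, j). (if k = i then X k else 0) * ((-1) ^ (d * p i) * (V * e l j))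
     + U * e k i * (if l = j then 1 / X l else 0))"

lemma Rhat_root_op:
  assumes z: "z \<noteq> 1" and M: "rm.intertwines (rm.Rh z crit) (odd d) U V X e"
  shows "Rhat z (mat_op2 (root_op d X e U V) \<phi>) = mat_op2 (root_op d X e V U) (Rhat z \<phi>)"
proof -
  let ?R = "rm.Rh z crit" and ?M = "\<lambda>(i, j) (k, l). rm.Rh z crit i j k l"
  have sg: "(-1) ^ (d * p i) = rm.sn (odd d) (odd (p i))" for i
    by (simp add: rm.sn_def minus_one_power_iff)
  have *: "(\<Sum>v\<in>{1..N} \<times> {1..N}. ?M (i, j) v * root_op d X e U V v (k, l))
    = (\<Sum>v\<in>{1..N} \<times> {1..N}. root_op d X e V U (i, j) v * ?M v (k, l))"
    if ijkl: "i \<in> {1..N}" "j \<in> {1..N}" "k \<in> {1..N}" "l \<in> {1..N}" for i j k l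
  proof -
    \<comment> \<open>In each of the four products the diagonal tensor factor fixes one summation
      index; what is left are the four sums of \<open>intertwines\<close>.\<close>
    have S1: "(\<Sum>r=1..N. \<Sum>r'=1..N. ?R i j r r' * ((if r = k then X r else 0) * ((-1) ^ (d * p k) * (V * e r' l))))
      = V * rm.sn (odd d) (odd (p k)) * X k * (\<Sum>r'=1..N. ?R i j k r' * e r' l)"
    proof -
      have "(\<Sum>r=1..N. \<Sum>r'=1..N. ?R i j r r' * ((if r = k then X r else 0) * ((-1) ^ (d * p k) * (V * e r' l))))
        = (\<Sum>r=1..N. if r = k then (\<Sum>r'=1..N. ?R i j k r' * (X k * ((-1) ^ (d * p k) * (V * e r' l)))) else 0)"
        by (rule sum.cong[OF refl]) auto
      then show ?thesis using ijkl unfolding sg by (simp add: sum_distrib_left mult_ac)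
    qed
    have S2: "(\<Sum>r=1..N. \<Sum>r'=1..N. ?R i j r r' * (U * e r k * (if r' = l then 1 / X r' else 0)))
      = U / X l * (\<Sum>r=1..N. ?R i j r l * e r k)"
    proof -
      have "(\<Sum>r'=1..N. ?R i j r r' * (U * e r k * (if r' = l then 1 / X r' else 0)))
        = (\<Sum>r'=1..N. if r' = l then ?R i j r l * (U * e r k * (1 / X l)) else 0)" for r
        by (rule sum.cong[OF refl]) auto
      then show ?thesis using ijkl by (simp add: sum_distrib_left mult_ac)
    qed
    have S3: "(\<Sum>r=1..N. \<Sum>r'=1..N. (if i = r then X i else 0) * ((-1) ^ (d * p r) * (U * e j r')) * ?R r r' k l)
      = U * rm.sn (odd d) (odd (p i)) * X i * (\<Sum>r'=1..N. e j r' * ?R i r' k l)"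
    proof -
      have "(\<Sum>r=1..N. \<Sum>r'=1..N. (if i = r then X i else 0) * ((-1) ^ (d * p r) * (U * e j r')) * ?R r r' k l)
        = (\<Sum>r=1..N. if r = i then (\<Sum>r'=1..N. X i * ((-1) ^ (d * p i) * (U * e j r')) * ?R i r' k l) else 0)"
        by (rule sum.cong[OF refl]) auto
      then show ?thesis using ijkl unfolding sg by (simp add: sum_distrib_left mult_ac)
    qed
    have S4: "(\<Sum>r=1..N. \<Sum>r'=1..N. V * e i r * (if j = r' then 1 / X j else 0) * ?R r r' k l)
      = V / X j * (\<Sum>r=1..N. e i r * ?R r j k l)"
    proof -
      have "(\<Sum>r'=1..N. V * e i r * (if j = r' then 1 / X j else 0) * ?R r r' k l)
        = (\<Sum>r'=1..N. if r' = j then V * e i r * (1 / X j) * ?R r j k l else 0)" for r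
        by (rule sum.cong[OF refl]) auto
      then show ?thesis using ijkl by (simp add: sum_distrib_left mult_ac)
    qed
    have "(\<Sum>v\<in>{1..N} \<times> {1..N}. ?M (i, j) v * root_op d X e U V v (k, l))
      = V * rm.sn (odd d) (odd (p k)) * X k * (\<Sum>r'=1..N. ?R i j k r' * e r' l) + U / X l * (\<Sum>r=1..N. ?R i j r l * e r k)"
      unfolding S1[symmetric] S2[symmetric] sum.distrib[symmetric] distrib_left[symmetric]
      unfolding sum.cartesian_product by (rule sum.cong[OF refl]) (auto simp: root_op_def)
    also have "\<dots> = U * rm.sn (odd d) (odd (p i)) * X i * (\<Sum>r'=1..N. e j r' * ?R i r' k l) + V / X j * (\<Sum>r=1..N. e i r * ?R r j k l)"
      by (rule M[unfolded rm.intertwines_def, rule_format, OF ijkl])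
    also have "\<dots> = (\<Sum>v\<in>{1..N} \<times> {1..N}. root_op d X e V U (i, j) v * ?M v (k, l))"
      unfolding S3[symmetric] S4[symmetric] sum.distrib[symmetric] distrib_right[symmetric]
      unfolding sum.cartesian_product by (rule sum.cong[OF refl]) (auto simp: root_op_def)
    finally show ?thesis .
  qed
  show ?thesis
    unfolding Rhat_eq[OF z] mat_op2_mult by (rule fun_cong[OF mat_op2_pair_cong]) (rule *; assumption)
qed

text \<open>Nonzero entries of \<open>Rh\<close> preserve the weight: either the row is the column
  up to order, or both are dual pairs, on which the eigenvalues multiply to 1.\<close>

lemma Rhat_diag:
  assumes z: "z \<noteq> 1" and X: "\<And>i. i \<in> {1..N} \<Longrightarrow> X (dual i) = 1 / X i \<and> X i \<noteq> 0"
  shows "Rhat z (mat_op2 (\<lambda>(k, l) (i, j). (if k = i then X k else 0) * (1 * (if l = j then X l else 0))) \<phi>)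
    = mat_op2 (\<lambda>(k, l) (i, j). (if k = i then X k else 0) * (1 * (if l = j then X l else 0))) (Rhat z \<phi>)"
proof -
  let ?R = "rm.Rh z crit" and ?M = "\<lambda>(i, j) (k, l). rm.Rh z crit i j k l"
  let ?D = "\<lambda>(k, l) (i, j). (if k = i then X k else 0) * (1 * (if l = j then X l else 0))"
  have *: "(\<Sum>v\<in>{1..N} \<times> {1..N}. ?M (i, j) v * ?D v (k, l))
    = (\<Sum>v\<in>{1..N} \<times> {1..N}. ?D (i, j) v * ?M v (k, l))"
    if ijkl: "i \<in> {1..N}" "j \<in> {1..N}" "k \<in> {1..N}" "l \<in> {1..N}" for i j k l
  proof -
    have "(\<Sum>v\<in>{1..N} \<times> {1..N}. ?M (i, j) v * ?D v (k, l))
      = (\<Sum>v\<in>{1..N} \<times> {1..N}. if v = (k, l) then ?R i j k l * (X k * X l) else 0)"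
      by (rule sum.cong[OF refl]) (auto split: if_splits)
    also have "\<dots> = ?R i j k l * (X k * X l)" using ijkl by simp
    also have "\<dots> = X i * X j * ?R i j k l"
    proof (cases "?R i j k l = 0")
      case False
      then have "(i = l \<and> j = k) \<or> (i = k \<and> j = l) \<or> (l = dual k \<and> j = dual i)"
        using rm.Rh_support[of z crit i j k l] dl_dual by simp
      then have "X k * X l = X i * X j" using X[OF ijkl(1)] X[OF ijkl(3)] by auto
      then show ?thesis by simp
    qed simp
    also have "\<dots> = (\<Sum>v\<in>{1..N} \<times> {1..N}. if v = (i, j) then X i * X j * ?R i j k l else 0)" using ijkl by simp
    also have "\<dots> = (\<Sum>v\<in>{1..N} \<times> {1..N}. ?D (i, j) v * ?M v (k, l))"
      by (rule sum.cong[OF refl]) (auto split: if_splits)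
    finally show ?thesis .
  qed
  show ?thesis
    unfolding Rhat_eq[OF z] mat_op2_mult by (rule fun_cong[OF mat_op2_pair_cong]) (rule *; assumption)
qed

text \<open>Both sides are homogeneous of degree 1 in \<open>U\<close> and \<open>V\<close>
  together. This brings in the constants a and b and the passage from u, v to their
  inverses.\<close>

lemma intertwines_scale_spectral:
  assumes "rm.intertwines M P U V X e"
  shows "rm.intertwines M P (c * U) (c * V) X e"
proof -
  have r: "c * V * x1 * x2 * x3 + c * U / x4 * x5 = c * U * x6 * x7 * x8 + c * V / x9 * x10"
    if "V * x1 * x2 * x3 + U / x4 * x5 = U * x6 * x7 * x8 + V / x9 * x10" for x1 x2 x3 x4 x5 x6 x7 x8 x9 x10
    using arg_cong[OF that, of "\<lambda>y. c * y"] by (simp only: distrib_left mult.assoc times_divide_eq_right times_divide_eq_left)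
  show ?thesis
    unfolding rm.intertwines_def by (intro ballI r) (rule assms[unfolded rm.intertwines_def, rule_format])
qed

lemma ev2_Delta_E:
  assumes i: "i \<le> s" and \<alpha>: "\<forall>k l. emb (e_gen i k l) = \<alpha> * rm.root_mat (root_fst i) (root_snd i) k l"
  shows "ev2 a b w w' (Delta_gen (gE i)) \<phi> = mat_op2 (root_op (palpha i) (rm.root_wt (root_fst i) (root_snd i))
    (\<lambda>k l. \<alpha> * rm.root_mat (root_fst i) (root_snd i) k l)
    (if i = 0 then emb a * indet w else 1) (if i = 0 then emb a * indet w' else 1)) \<phi>"
proof -
  let ?X = "rm.root_wt (root_fst i) (root_snd i)" and ?e = "\<lambda>k l. \<alpha> * rm.root_mat (root_fst i) (root_snd i) k l"
  have e: "(\<lambda>k l. if i = 0 then emb a * indet w * emb (e0_mat k l) else emb (e_mat i k l))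
    = (\<lambda>k l. (if i = 0 then emb a * indet w else 1) * ?e k l)" for w
    using \<alpha> by (auto simp: e_gen_def fun_eq_iff)
  show ?thesis
    unfolding Delta_gen.simps ev2_add ev2_pure ev_gen.simps e qdiag_half_h[OF i] tensor_op_mat_op mat_op2_add
    by (rule fun_cong[OF mat_op2_cong]) (auto simp: root_op_def)
qed

lemma ev2_Delta_F:
  assumes i: "i \<le> s" and \<alpha>: "\<forall>k l. emb (f_gen i k l) = \<alpha> * rm.root_mat (root_snd i) (root_fst i) k l"
  shows "ev2 a b w w' (Delta_gen (gF i)) \<phi> = mat_op2 (root_op (palpha i) (rm.root_wt (root_fst i) (root_snd i))
    (\<lambda>k l. \<alpha> * rm.root_mat (root_snd i) (root_fst i) k l)
    (if i = 0 then emb b * inverse (indet w) else 1) (if i = 0 then emb b * inverse (indet w') else 1)) \<phi>"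
proof -
  let ?X = "rm.root_wt (root_fst i) (root_snd i)" and ?e = "\<lambda>k l. \<alpha> * rm.root_mat (root_snd i) (root_fst i) k l"
  have e: "(\<lambda>k l. if i = 0 then emb b * inverse (indet w) * emb (f0_mat k l) else emb (kappa i * f_mat i k l))
    = (\<lambda>k l. (if i = 0 then emb b * inverse (indet w) else 1) * ?e k l)" for w
    using \<alpha> by (auto simp: f_gen_def fun_eq_iff simp del: emb_simps)
  show ?thesis
    unfolding Delta_gen.simps ev2_add ev2_pure ev_gen.simps e qdiag_half_h[OF i] tensor_op_mat_op mat_op2_add
    by (rule fun_cong[OF mat_op2_cong]) (auto simp: root_op_def)
qed

abbreviation zz :: L where "zz \<equiv> indet Param_u / indet Param_v"

lemma Rhat_E:
  assumes i: "i \<le> s"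
  shows "Rhat zz (ev2 a b Param_u Param_v (Delta_gen (gE i)) \<phi>) = ev2 a b Param_v Param_u (Delta_gen (gE i)) (Rhat zz \<phi>)"
proof -
  let ?a = "root_fst i" and ?b = "root_snd i"
  obtain \<alpha> where \<alpha>: "\<forall>k l. emb (e_gen i k l) = \<alpha> * rm.root_mat ?a ?b k l" using gen_matrix(1)[OF i] by blast
  have "rm.intertwines (rm.Rh zz crit) (odd (palpha i)) (if i = 0 then indet Param_u else 1) (if i = 0 then indet Param_v else 1)
      (rm.root_wt ?a ?b) (rm.root_mat ?a ?b)"
    by (rule Rh_intertwines[OF i indet_nonzero indet_nonzero indet_distinct(1)])
  then have "rm.intertwines (rm.Rh zz crit) (odd (palpha i)) ((if i = 0 then emb a else 1) * (if i = 0 then indet Param_u else 1))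
      ((if i = 0 then emb a else 1) * (if i = 0 then indet Param_v else 1)) (rm.root_wt ?a ?b) (\<lambda>k l. \<alpha> * rm.root_mat ?a ?b k l)"
    by (rule rm.intertwines_scale[OF intertwines_scale_spectral refl refl])
  then have *: "rm.intertwines (rm.Rh zz crit) (odd (palpha i)) (if i = 0 then emb a * indet Param_u else 1)
      (if i = 0 then emb a * indet Param_v else 1) (rm.root_wt ?a ?b) (\<lambda>k l. \<alpha> * rm.root_mat ?a ?b k l)"
    by (cases "i = 0") simp_all
  show ?thesis unfolding ev2_Delta_E[OF i \<alpha>] by (rule Rhat_root_op[OF indet_distinct(2) *])
qed

lemma Rhat_F:
  assumes i: "i \<le> s"
  shows "Rhat zz (ev2 a b Param_u Param_v (Delta_gen (gF i)) \<phi>) = ev2 a b Param_v Param_u (Delta_gen (gF i)) (Rhat zz \<phi>)"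
proof -
  let ?a = "root_fst i" and ?b = "root_snd i" and ?u = "indet Param_u" and ?v = "indet Param_v"
  obtain \<alpha> where \<alpha>: "\<forall>k l. emb (f_gen i k l) = \<alpha> * rm.root_mat ?b ?a k l" using gen_matrix(2)[OF i] by blast
  have P: "odd (palpha i) = (odd (p ?a) \<noteq> odd (p ?b))" by (rule palpha_parity[OF i])
  have "rm.intertwines (rm.Rh zz crit) (odd (palpha i)) (if i = 0 then ?v else 1) (if i = 0 then ?u else 1)
      (rm.root_wt ?a ?b) (rm.root_mat ?b ?a)"
    using rm.Rh_intertwines_transpose[OF root_in[OF i]] Rh_intertwines[OF i indet_nonzero indet_nonzero indet_distinct(1)]
    unfolding P by blast
  \<comment> \<open>Transposition has left the spectral factors (v, u); multiplied by b / (u v) they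
    become (b / u, b / v), the factors of f_0.\<close>
  then have "rm.intertwines (rm.Rh zz crit) (odd (palpha i)) ((if i = 0 then emb b / (?u * ?v) else 1) * (if i = 0 then ?v else 1))
      ((if i = 0 then emb b / (?u * ?v) else 1) * (if i = 0 then ?u else 1)) (rm.root_wt ?a ?b) (\<lambda>k l. \<alpha> * rm.root_mat ?b ?a k l)"
    by (rule rm.intertwines_scale[OF intertwines_scale_spectral refl refl])
  moreover have "emb b / (?u * ?v) * ?v = emb b * inverse ?u" "emb b / (?u * ?v) * ?u = emb b * inverse ?v"
    using indet_nonzero[of Param_u] indet_nonzero[of Param_v] by (simp_all add: field_simps)
  ultimately have *: "rm.intertwines (rm.Rh zz crit) (odd (palpha i)) (if i = 0 then emb b * inverse ?u else 1)
      (if i = 0 then emb b * inverse ?v else 1) (rm.root_wt ?a ?b) (\<lambda>k l. \<alpha> * rm.root_mat ?b ?a k l)"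
    by (cases "i = 0") (simp_all only: if_True if_False mult_1_left simp_thms)
  show ?thesis unfolding ev2_Delta_F[OF i \<alpha>] by (rule Rhat_root_op[OF indet_distinct(2) *])
qed

lemma Rhat_Q:
  assumes i: "i \<le> s"
  shows "Rhat zz (ev2 a b w w' (Delta_gen (gQ i)) \<phi>) = ev2 a b w' w (Delta_gen (gQ i)) (Rhat zz \<phi>)"
    "Rhat zz (ev2 a b w w' (Delta_gen (gQi i)) \<phi>) = ev2 a b w' w (Delta_gen (gQi i)) (Rhat zz \<phi>)"
proof -
  let ?X = "rm.root_wt (root_fst i) (root_snd i)"
  have X: "?X (dual j) = 1 / ?X j \<and> ?X j \<noteq> 0" if j: "j \<in> {1..N}" for j
  proof -
    have "wt a (dual j) = - wt a j" if "a \<in> {1..N}" for a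
    proof -
      have e: "dual j = a \<longleftrightarrow> j = dual a" "dual j = dual a \<longleftrightarrow> j = a"
        using dual_dual[OF that] dual_dual[OF j] by metis+
      show ?thesis unfolding wt_def e by simp
    qed
    note w = this[OF root_in(1)[OF i]] this[OF root_in(2)[OF i]]
    have r: "- ((x :: int) * y - x' * y') = x * - y - x' * - y'" for x y x' y' by simp
    have X: "?X (dual j) = emb qhalf powi (- ((-1) ^ p (root_fst i) * wt (root_fst i) j - (-1) ^ p (root_snd i) * wt (root_snd i) j))"
      unfolding root_wt_powi[OF root_in[OF i]] w r ..
    have pw: "x powi (- k) = 1 / x powi k \<and> x powi k \<noteq> 0" if "x \<noteq> 0" for x :: L and k
      using that by (simp add: power_int_minus_divide)
    show ?thesis
      unfolding X unfolding root_wt_powi[OF root_in[OF i], of j] by (rule pw) (simp add: qhalf_nonzero)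
  qed
  have X': "1 / ?X (dual j) = 1 / (1 / ?X j) \<and> 1 / ?X j \<noteq> 0" if "j \<in> {1..N}" for j
    using X[OF that] by (simp only: divide_eq_0_iff one_neq_zero simp_thms)
  have D: "ev2 a b w w' (Delta_gen (gQ i)) \<phi> = mat_op2 (\<lambda>(k, l) (i, j). (if k = i then ?X k else 0) * (1 * (if l = j then ?X l else 0))) \<phi>"
    "ev2 a b w w' (Delta_gen (gQi i)) \<phi> = mat_op2 (\<lambda>(k, l) (i, j). (if k = i then 1 / ?X k else 0) * (1 * (if l = j then 1 / ?X l else 0))) \<phi>" for w w' \<phi>
    unfolding Delta_gen.simps ev2_pure ev_gen.simps qdiag_half_h[OF i] tensor_op_mat_op by (simp_all only: gpar.simps mult_zero_left power_0)
  show "Rhat zz (ev2 a b w w' (Delta_gen (gQ i)) \<phi>) = ev2 a b w' w (Delta_gen (gQ i)) (Rhat zz \<phi>)"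
    unfolding D by (rule Rhat_diag[OF indet_distinct(2)]) (rule X)
  show "Rhat zz (ev2 a b w w' (Delta_gen (gQi i)) \<phi>) = ev2 a b w' w (Delta_gen (gQi i)) (Rhat zz \<phi>)"
    unfolding D by (rule Rhat_diag[OF indet_distinct(2)]) (rule X')
qed

text \<open>The action of D \<otimes> D and of its inverse. Both indeterminates are multiplied by
  the same constant, so u / v and with it every entry of \<open>Rh\<close> are fixed.\<close>

definition rescale :: "K \<Rightarrow> L \<Rightarrow> L" where "rescale c x = scale Param_u c (scale Param_v c x)"

lemma rescale_simps:
  assumes "c \<noteq> 0"
  shows "rescale c (x + y) = rescale c x + rescale c y" "rescale c (x * y) = rescale c x * rescale c y"
    "rescale c (x - y) = rescale c x - rescale c y" "rescale c (x / y) = rescale c x / rescale c y"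
    "rescale c (- x) = - rescale c x" "rescale c (x ^ k) = rescale c x ^ k"
    "rescale c 0 = 0" "rescale c 1 = 1" "rescale c (emb y') = emb y'" "rescale c (of_int n') = of_int n'" "rescale c zz = zz"
  using assms unfolding rescale_def
  by (simp_all add: scale_add scale_mult scale_diff scale_divide scale_uminus scale_power scale_0 scale_1 scale_emb scale_of_int scale_indet)

lemma rescale_if: "rescale c (if P then x else y) = (if P then rescale c x else rescale c y)"
  by simp

lemma rescale_sum: "c \<noteq> 0 \<Longrightarrow> rescale c (sum f A) = (\<Sum>x\<in>A. rescale c (f x))"
  by (simp add: rescale_def scale_sum)

lemma rescale_Rh:
  assumes c: "c \<noteq> 0" and z: "rescale c z = z"
  shows "rescale c (rm.Rh z crit i j k l) = rm.Rh z crit i j k l"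
proof -
  note r = rescale_simps(1-10)[OF c] rescale_if z
  have 1: "rescale c (rm.tp i) = rm.tp i" "rescale c rm.hh = rm.hh" "rescale c (rm.sn x y) = rm.sn x y" "rescale c crit = crit"
    "rescale c (rm.ut i' j' k' l') = rm.ut i' j' k' l'" for i x y i' j' k' l'
    unfolding rm.tp_def rm.hh_def rm.sn_def crit_def rm.ut_def by (simp_all only: r)
  have 2: "rescale c (rm.Dg k l) = rm.Dg k l" "rescale c (rm.gg k) = rm.gg k" for k l
    unfolding rm.Dg_def rm.gg_def by (simp_all only: r 1)
  show ?thesis unfolding rm.Rh_def rm.M4_def by (simp only: r 1 2)
qed

lemma Rhat_rescale:
  assumes c: "c \<noteq> 0"
  shows "Rhat zz (\<lambda>x. rescale c (\<phi> x)) = (\<lambda>x. rescale c (Rhat zz \<phi> x))"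
proof -
  have e: "rescale c ((\<lambda>(i, j) (k, l). rm.Rh zz crit i j k l) x y) = (\<lambda>(i, j) (k, l). rm.Rh zz crit i j k l) x y" for x y
    by (cases x; cases y) (simp add: rescale_Rh[OF c rescale_simps(11)[OF c]])
  show ?thesis
    unfolding Rhat_eq[OF indet_distinct(2)] mat_op2_def
    by (simp only: rescale_if rescale_sum[OF c] rescale_simps(2,7)[OF c] e)
qed

lemma Rhat_D:
  assumes "g = gD \<or> g = gDi"
  shows "Rhat zz (ev2 a b Param_u Param_v (Delta_gen g) \<phi>) = ev2 a b Param_v Param_u (Delta_gen g) (Rhat zz \<phi>)"
proof -
  have q: "qq \<noteq> 0" "inverse qq \<noteq> 0" using qhalf_nonzero by (simp_all add: qq_def)
  have "ev2 a b Param_u Param_v (Delta_gen gD) \<phi> = (\<lambda>x. rescale qq (\<phi> x))"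
    "ev2 a b Param_v Param_u (Delta_gen gD) \<phi> = (\<lambda>x. rescale qq (\<phi> x))"
    "ev2 a b Param_u Param_v (Delta_gen gDi) \<phi> = (\<lambda>x. rescale (inverse qq) (\<phi> x))"
    "ev2 a b Param_v Param_u (Delta_gen gDi) \<phi> = (\<lambda>x. rescale (inverse qq) (\<phi> x))" for \<phi>
    using scale_commute[OF q(1) q(1)] scale_commute[OF q(2) q(2)]
    by (auto simp: ev2_pure tensor_op_def rescale_def fun_eq_iff)
  then show ?thesis using assms Rhat_rescale[OF q(1), of \<phi>] Rhat_rescale[OF q(2), of \<phi>] by auto
qed

lemma Rhat_gen:
  assumes "g \<in> gens"
  shows "Rhat zz (ev2 a b Param_u Param_v (Delta_gen g) \<phi>) = ev2 a b Param_v Param_u (Delta_gen g) (Rhat zz \<phi>)"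
proof (cases g)
  case gGam
  have "ev2 a b w w' (Delta_gen gGam) \<phi> = \<phi>" for w w' \<phi> by (simp add: ev2_pure tensor_op_def fun_eq_iff)
  then show ?thesis using gGam by simp
next
  case gGami
  have "ev2 a b w w' (Delta_gen gGami) \<phi> = \<phi>" for w w' \<phi> by (simp add: ev2_pure tensor_op_def fun_eq_iff)
  then show ?thesis using gGami by simp
qed (use assms Rhat_E Rhat_F Rhat_Q Rhat_D in \<open>auto simp: gens_def simp del: Delta_gen.simps\<close>)

lemma Rhat_act:
  assumes "x \<in> carrier free_alg"
  shows "Rhat zz (act a b Param_u Param_v x \<phi>) = act a b Param_v Param_u x (Rhat zz \<phi>)"
proof -
  have word: "Rhat zz (ev2 a b Param_u Param_v (Delta_word y) \<phi>) = ev2 a b Param_v Param_u (Delta_word y) (Rhat zz \<phi>)"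
    if y: "y \<in> Poly_Mapping.keys x" for y
  proof -
    obtain gs where gs: "y = Word gs" "set gs \<subseteq> gens"
      using assms y carrier_free_alg by (cases y) fastforce
    have "Rhat zz (foldr (\<lambda>g. ev2 a b Param_u Param_v (Delta_gen g)) gs \<phi>)
      = foldr (\<lambda>g. ev2 a b Param_v Param_u (Delta_gen g)) gs (Rhat zz \<phi>)"
      using gs(2) by (induction gs) (simp_all add: Rhat_gen)
    then show ?thesis using gs by (simp add: ev2_Delta_word)
  qed
  have "K_linear (Rhat zz)" unfolding Rhat_eq[OF indet_distinct(2)] by (rule K_linear_mat_op2)
  note sum = K_linear_sum[OF this]
  show ?thesis
    unfolding act_eq sum by (intro ext sum.cong refl) (simp only: word)
qed

text \<open>Cosets of the ideal consist of elements of the free algebra, so \<open>Rhat_act\<close>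
  applies to every representative.\<close>

lemma carrier_Uq: "X \<in> carrier Uq \<Longrightarrow> x \<in> X \<Longrightarrow> x \<in> carrier free_alg"
proof -
  assume X: "X \<in> carrier Uq" "x \<in> X"
  interpret R: ring free_alg by (rule ring_free_alg)
  interpret I: ideal "genideal free_alg relations" free_alg by (rule R.genideal_ideal[OF relations_carrier])
  from X(1) obtain y where y: "y \<in> carrier free_alg" "X = genideal free_alg relations +>\<^bsub>free_alg\<^esub> y"
    unfolding Uq_def FactRing_def A_RCOSETS_def' by auto
  then show "x \<in> carrier free_alg"
    using X(2) I.a_subset R.a_r_coset_subset_G by blast
qed

end

theorem theorem6p3:
  fixes m n :: nat and p :: "nat \<Rightarrow> nat" and vt :: "nat \<Rightarrow> int" and a b :: K
  assumes "osp_data m n p vt"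
    and "a \<noteq> 0" and "b \<noteq> 0"
    and "p 1 = 1 \<Longrightarrow> a * b = - (qq + inverse qq)"
    and "p 1 = 0 \<Longrightarrow> a * b = (-1) ^ p 2"
  shows "\<forall>X \<in> carrier (osp_data.Uq m n p). \<forall>x \<in> X. \<forall>\<phi> \<in> osp_data.VV m n.
    osp_data.Rhat m n p vt (indet Param_u / indet Param_v)
      (osp_data.act m n p vt a b Param_u Param_v x \<phi>)
    = osp_data.act m n p vt a b Param_v Param_u x
        (osp_data.Rhat m n p vt (indet Param_u / indet Param_v) \<phi>)"
proof -
  interpret osp_data m n p vt by (rule assms(1))
  show ?thesis using Rhat_act carrier_Uq by blast
qed

end
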